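(* Let $R=K[C]$ be a normal affine semigroup ring and $\Delta$ an order ideal of the face poset of $\mathbb{R}_{\ge0}C$. Then $K[\Delta]$ is sequentially Cohen–Macaulay if and only if $K[\Delta^{[i]}]$ is Cohen–Macaulay for all $i\in\mathbb{N}$ with $i\le\dim|\Delta|$.
   Context: $K$ a field; $C\subset\mathbb{Z}^d$ an affine semigroup with $\mathbb{Z}C=\mathbb{Z}^d$, $C\cap(-C)=\{0\}$, normal ($C=\mathbb{Z}^d\cap\mathbf P$ where $\mathbf P=\mathbb{R}_{\ge0}C$); $R=K[C]$. $\mathbf L$ is the set of nonempty faces of $\mathbf P$ (including $\mathbf P$ and $\{0\}$), ordered by inclusion; an order ideal is a nonempty $\Delta\subset\mathbf L$ with $F\in\Delta$, $G\subset F$, $G\in\mathbf L\Rightarrow G\in\Delta$. For $u\in\mathbf P$, $s(u)$ is the face whose relative interior contains $u$. $I_\Delta=(x^c\mid c\in C,\ s(c)\notin\Delta)$ and $K[\Delta]=R/I_\Delta$. For a face $F$ put $\dim|F|=\dim F-1$, and $\dim|\Delta|=\max\{\dim|F|\mid F\in\Delta\}$. For $F\in\Delta$, $\delta(F)=\max\{\dim|G|\mid G\in\Delta,\ G\supset F\}$. For $i\le\dim|\Delta|$: $\Delta^{(i)}=\{F\in\Delta\mid\dim|F|\le i\}$ and $\Delta^{[i]}=\{F\in\Delta^{(i)}\mid\delta(F)\ge i\}$ (the pure $i$-skeleton). Sequentially Cohen–Macaulay: there is a filtration $0=M_0\subset\cdots\subset M_r=M$ by graded submodules with Cohen–Macaulay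 quotients of strictly increasing dimensions. *)

theory Defs
  imports "HOL-Analysis.Analysis" "HOL-Library.Poly_Mapping" "HOL-Library.Extended_Nat"
begin

definition realv :: "int^'n \<Rightarrow> real^'n" where
  "realv c = (\<chi> i. real_of_int (c $ i))"

definition cone_of :: "(int^'n) set \<Rightarrow> (real^'n) set" where
  "cone_of C = {x. \<exists>S u. finite S \<and> S \<subseteq> C \<and> (\<forall>s\<in>S. u s \<ge> 0) \<and>
                        x = (\<Sum>s\<in>S. u s *\<^sub>R realv s)}"

definition affine_semigroup :: "(int^'n) set \<Rightarrow> bool" where
  "affine_semigroup C \<longleftrightarrow>
     (\<exists>G. finite G \<and> C = {(\<Sum>g\<in>G. int (k g) *s g) | k. True})"

definition generates_lattice :: "(int^'n) set \<Rightarrow> bool" where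
  "generates_lattice C \<longleftrightarrow> {a - b | a b. a \<in> C \<and> b \<in> C} = UNIV"

definition pointed :: "(int^'n) set \<Rightarrow> bool" where
  "pointed C \<longleftrightarrow> C \<inter> uminus ` C = {0}"

definition normal_sg :: "(int^'n) set \<Rightarrow> bool" where
  "normal_sg C \<longleftrightarrow> C = {c. realv c \<in> cone_of C}"

definition faces :: "(real^'n) set \<Rightarrow> (real^'n) set set" where
  "faces P = {F. F face_of P \<and> F \<noteq> {}}"

definition order_ideal :: "(real^'n) set \<Rightarrow> (real^'n) set set \<Rightarrow> bool" where
  "order_ideal P \<Delta> \<longleftrightarrow> \<Delta> \<noteq> {} \<and> \<Delta> \<subseteq> faces P \<and>
     (\<forall>F\<in>\<Delta>. \<forall>G\<in>faces P. G \<subseteq> F \<longrightarrow> G \<in> \<Delta>)"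

definition supp_face :: "(real^'n) set \<Rightarrow> real^'n \<Rightarrow> (real^'n) set" where
  "supp_face P u = (THE F. F face_of P \<and> u \<in> rel_interior F)"

definition dimbar :: "(real^'n) set \<Rightarrow> int" where
  "dimbar F = aff_dim F - 1"

definition dim_cplx :: "(real^'n) set set \<Rightarrow> int" where
  "dim_cplx \<Delta> = Max (dimbar ` \<Delta>)"

definition delta_face :: "(real^'n) set set \<Rightarrow> (real^'n) set \<Rightarrow> int" where
  "delta_face \<Delta> F = Max {dimbar G | G. G \<in> \<Delta> \<and> F \<subseteq> G}"

definition skel :: "(real^'n) set set \<Rightarrow> int \<Rightarrow> (real^'n) set set" where
  "skel \<Delta> i = {F \<in> \<Delta>. dimbar F \<le> i}"

definition pure_skel :: "(real^'n) set set \<Rightarrow> int \<Rightarrow> (real^'n) set set" where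
  "pure_skel \<Delta> i = {F \<in> skel \<Delta> i. delta_face \<Delta> F \<ge> i}"

definition is_ideal :: "'a::comm_ring_1 set \<Rightarrow> 'a set \<Rightarrow> bool" where
  "is_ideal R J \<longleftrightarrow> J \<subseteq> R \<and> 0 \<in> J \<and> (\<forall>a\<in>J. \<forall>b\<in>J. a + b \<in> J) \<and>
     (\<forall>r\<in>R. \<forall>a\<in>J. r * a \<in> J)"

definition gen_ideal :: "'a::comm_ring_1 set \<Rightarrow> 'a set \<Rightarrow> 'a set" where
  "gen_ideal R S = \<Inter> {J. is_ideal R J \<and> S \<subseteq> J}"

definition is_prime_ideal :: "'a::comm_ring_1 set \<Rightarrow> 'a set \<Rightarrow> bool" where
  "is_prime_ideal R P \<longleftrightarrow> is_ideal R P \<and> P \<noteq> R \<and>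
     (\<forall>a\<in>R. \<forall>b\<in>R. a * b \<in> P \<longrightarrow> a \<in> P \<or> b \<in> P)"

text \<open>An R-module is represented as a subquotient J/J' of R, with J' \<subseteq> J ideals of R.
  Annihilator, Krull dimension (dim R/Ann), regular sequences and depth w.r.t. an ideal m.\<close>

definition ann :: "'a::comm_ring_1 set \<Rightarrow> 'a set \<Rightarrow> 'a set \<Rightarrow> 'a set" where
  "ann R J J' = {r \<in> R. \<forall>a\<in>J. r * a \<in> J'}"

definition mod_dim :: "'a::comm_ring_1 set \<Rightarrow> 'a set \<Rightarrow> 'a set \<Rightarrow> enat" where
  "mod_dim R J J' = Sup {enat n | n. \<exists>P :: nat \<Rightarrow> 'a set.
      (\<forall>i\<le>n. is_prime_ideal R (P i)) \<and> ann R J J' \<subseteq> P 0 \<and> (\<forall>i<n. P i \<subset> P (Suc i))}"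

definition seq_sub :: "'a::comm_ring_1 set \<Rightarrow> 'a set \<Rightarrow> 'a list \<Rightarrow> nat \<Rightarrow> 'a set" where
  "seq_sub J J' xs i = {b + (\<Sum>j<i. xs ! j * a j) | b a. b \<in> J' \<and> (\<forall>j<i. a j \<in> J)}"

definition regular_seq :: "'a::comm_ring_1 set \<Rightarrow> 'a set \<Rightarrow> 'a set \<Rightarrow> 'a set \<Rightarrow> 'a list \<Rightarrow> bool" where
  "regular_seq R m J J' xs \<longleftrightarrow> set xs \<subseteq> m \<and>
     (\<forall>i<length xs. \<forall>a\<in>J. xs ! i * a \<in> seq_sub J J' xs i \<longrightarrow> a \<in> seq_sub J J' xs i) \<and>
     seq_sub J J' xs (length xs) \<noteq> J"

definition depth :: "'a::comm_ring_1 set \<Rightarrow> 'a set \<Rightarrow> 'a set \<Rightarrow> 'a set \<Rightarrow> enat" where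
  "depth R m J J' = Sup {enat (length xs) | xs. regular_seq R m J J' xs}"

definition CM :: "'a::comm_ring_1 set \<Rightarrow> 'a set \<Rightarrow> 'a set \<Rightarrow> 'a set \<Rightarrow> bool" where
  "CM R m J J' \<longleftrightarrow> J' \<subset> J \<and> depth R m J J' = mod_dim R J J'"

text \<open>K[C] inside the group ring K[Z^d] (finitely supported functions Z^d \<rightarrow> K).\<close>
definition semigroup_ring :: "(int^'n) set \<Rightarrow> ((int^'n) \<Rightarrow>\<^sub>0 'k::field) set" where
  "semigroup_ring C = {f. Poly_Mapping.keys f \<subseteq> C}"

definition monom :: "int^'n \<Rightarrow> ((int^'n) \<Rightarrow>\<^sub>0 'k::field)" where
  "monom c = Poly_Mapping.single c 1"

definition max_hom :: "(int^'n) set \<Rightarrow> ((int^'n) \<Rightarrow>\<^sub>0 'k::field) set" where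
  "max_hom C = {f \<in> semigroup_ring C. Poly_Mapping.lookup f 0 = 0}"

definition homogeneous :: "((int^'n) \<Rightarrow>\<^sub>0 'k::field) set \<Rightarrow> bool" where
  "homogeneous J \<longleftrightarrow> (\<forall>f\<in>J. \<forall>c. Poly_Mapping.single c (Poly_Mapping.lookup f c) \<in> J)"

definition I_Delta :: "(int^'n) set \<Rightarrow> (real^'n) set set \<Rightarrow> ((int^'n) \<Rightarrow>\<^sub>0 'k::field) set" where
  "I_Delta C \<Delta> = gen_ideal (semigroup_ring C)
      {monom c | c. c \<in> C \<and> supp_face (cone_of C) (realv c) \<notin> \<Delta>}"

definition CM_face_ring :: "'k::field itself \<Rightarrow> (int^'n) set \<Rightarrow> (real^'n) set set \<Rightarrow> bool" where
  "CM_face_ring TYPE('k) C \<Delta> \<longleftrightarrow>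
     CM (semigroup_ring C) (max_hom C) (semigroup_ring C) (I_Delta C \<Delta> :: ((int^'n) \<Rightarrow>\<^sub>0 'k) set)"

text \<open>Sequentially CM: a chain I_\<Delta> = J_0 \<subseteq> ... \<subseteq> J_r = R of graded ideals (i.e. graded
  submodules M_i = J_i/I_\<Delta> of K[\<Delta>]) with CM quotients J_{i+1}/J_i of strictly
  increasing dimensions.\<close>
definition seqCM_face_ring :: "'k::field itself \<Rightarrow> (int^'n) set \<Rightarrow> (real^'n) set set \<Rightarrow> bool" where
  "seqCM_face_ring TYPE('k) C \<Delta> \<longleftrightarrow>
     (\<exists>r (Js :: nat \<Rightarrow> ((int^'n) \<Rightarrow>\<^sub>0 'k) set).
        Js 0 = I_Delta C \<Delta> \<and> Js r = semigroup_ring C \<and>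
        (\<forall>i\<le>r. is_ideal (semigroup_ring C) (Js i) \<and> homogeneous (Js i)) \<and>
        (\<forall>i<r. Js i \<subseteq> Js (Suc i)) \<and>
        (\<forall>i<r. CM (semigroup_ring C) (max_hom C) (Js (Suc i)) (Js i)) \<and>
        (\<forall>i j. i < j \<and> j < r \<longrightarrow>
           mod_dim (semigroup_ring C) (Js (Suc i)) (Js i)
             < mod_dim (semigroup_ring C) (Js (Suc j)) (Js j)))"

end

(* The layers N_k of the dimension filtration of K[Delta] are spanned by the monomials x^c for which
   the largest face of Delta above the support face of c has dimension k. Any Cohen-Macaulay
   filtration must be this one, since the depth of a module is at most dim R/P for every prime P
   that kills a nonzero element; so K[Delta] is sequentially Cohen-Macaulay iff every N_k has depth k
   or is zero. There are exact sequences
     0 -> N_k -> K[S_k] -> K[T_k] -> 0,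
   where S_k is the pure skeleton of cone dimension k and T_k consists of the faces of S_(k+1) of
   dimension at most k; and truncating a complex by one dimension divides out the interior ideals W_F of its top faces F.
   As depth W_F = dim F, passing to a skeleton loses exactly one unit of depth, and the depth lemma
   turns depth bounds for the N_k into depth bounds for the pure skeleta and back.
   For depth W_F = dim F (due to Hochster), W_F is realised as a conic module, spanned by the lattice
   points of v + F with v generic; dividing by a monomial x^g leaves the points between v + F and
   v + g + F, which are filtered by conic modules over the facets of F. Monomial modules are treated
   as subquotients of the ring, and dimensions are bounded by counting lattice points. *)
theory Submission
  imports Defs "HOL-Library.Set_Algebras"
begin

section \<open>Noetherian subrings\<close>

text \<open>Depth is the supremum of the lengths of regular sequences in \<open>max_hom C\<close>;
  their members need not be homogeneous, and the ring is not local. The usual tools are therefore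
  replaced. The depth lemma is proved without Ext: prime avoidance gives one element regular on all
  relevant modules of an exact sequence, the induction divides by it, and
  \<open>depth_ge_transfer\<close> makes the depth of the quotient independent of the element taken.
  Instead of localising, one works up to factors 1 - y with y in the ideal; for monomial modules a
  degree argument shows that such factors cancel. The genericity of v keeps the filtration over
  facets pure: a lattice point c of v + F with c - g outside v + F leaves the cone, on moving in
  direction -g, through the relative interior of a single facet at some time s, and the pieces
  ordered by s form a filtration. The base point moves to v + s g with s real, so the induction has
  to record the directions in which it was moved; each costs one degree of genericity and is paid
  for by one dimension of the face.\<close>

definition is_subring :: "'a::comm_ring_1 set \<Rightarrow> bool" where
  "is_subring A \<longleftrightarrow> 1 \<in> A \<and> (\<forall>a\<in>A. \<forall>b\<in>A. a + b \<in> A \<and> a * b \<in> A) \<and> (\<forall>a\<in>A. - a \<in> A)"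

definition ideal_acc :: "'a::comm_ring_1 set \<Rightarrow> bool" where
  "ideal_acc A \<longleftrightarrow> (\<forall>I::nat \<Rightarrow> 'a set. (\<forall>n. is_ideal A (I n) \<and> I n \<subseteq> I (Suc n)) \<longrightarrow>
     (\<exists>N. \<forall>n\<ge>N. I n = I N))"

text \<open>The ring A[x], as the set of values at x of polynomials over A. The element x may
  satisfy algebraic relations, so the coefficients of an element are not unique.\<close>

definition adjoin :: "'a::comm_ring_1 set \<Rightarrow> 'a \<Rightarrow> 'a set" where
  "adjoin A x = {f. \<exists>n c. (\<forall>i. c i \<in> A) \<and> f = (\<Sum>i\<le>n. c i * x ^ i)}"

text \<open>As coefficients are not unique, a counts as soon as some expression of degree at most n
  of an element of I has a as its coefficient of x^n. The value a = 0 is allowed, which makes the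
  set an ideal.\<close>

definition lead_coeffs :: "'a::comm_ring_1 set \<Rightarrow> 'a \<Rightarrow> 'a set \<Rightarrow> nat \<Rightarrow> 'a set" where
  "lead_coeffs A x I n =
     {a \<in> A. \<exists>c. (\<forall>i. c i \<in> A) \<and> a * x ^ n + (\<Sum>i<n. c i * x ^ i) \<in> I}"

lemma is_idealD:
  assumes "is_ideal R J"
  shows "J \<subseteq> R" "0 \<in> J" "\<And>a b. a \<in> J \<Longrightarrow> b \<in> J \<Longrightarrow> a + b \<in> J"
    "\<And>r a. r \<in> R \<Longrightarrow> a \<in> J \<Longrightarrow> r * a \<in> J"
  using assms unfolding is_ideal_def by auto

lemma is_subringD:
  assumes "is_subring R"
  shows "1 \<in> R" "0 \<in> R" "\<And>a b. a \<in> R \<Longrightarrow> b \<in> R \<Longrightarrow> a + b \<in> R"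
    "\<And>a b. a \<in> R \<Longrightarrow> b \<in> R \<Longrightarrow> a * b \<in> R" "\<And>a. a \<in> R \<Longrightarrow> - a \<in> R"
    "\<And>a b. a \<in> R \<Longrightarrow> b \<in> R \<Longrightarrow> a - b \<in> R" "\<And>a n. a \<in> R \<Longrightarrow> a ^ n \<in> R"
    "\<And>f S. (\<And>s. s \<in> S \<Longrightarrow> f s \<in> R) \<Longrightarrow> sum f S \<in> R"
    "\<And>f S. (\<And>s. s \<in> S \<Longrightarrow> f s \<in> R) \<Longrightarrow> prod f S \<in> R"
proof -
  show 1: "1 \<in> R" and a: "\<And>a b. a \<in> R \<Longrightarrow> b \<in> R \<Longrightarrow> a + b \<in> R"
    and m: "\<And>a b. a \<in> R \<Longrightarrow> b \<in> R \<Longrightarrow> a * b \<in> R" and u: "\<And>a. a \<in> R \<Longrightarrow> - a \<in> R"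
    using assms unfolding is_subring_def by auto
  show 0: "0 \<in> R" using a[OF 1 u[OF 1]] by simp
  show "a - b \<in> R" if "a \<in> R" "b \<in> R" for a b using a[OF that(1) u[OF that(2)]] by simp
  show "a ^ n \<in> R" if "a \<in> R" for a n by (induction n) (auto simp: that 1 m)
  show "sum f S \<in> R" if "\<And>s. s \<in> S \<Longrightarrow> f s \<in> R" for f :: "'b \<Rightarrow> 'a" and S
    using that by (induction S rule: infinite_finite_induct) (auto simp: 0 a)
  show "prod f S \<in> R" if "\<And>s. s \<in> S \<Longrightarrow> f s \<in> R" for f :: "'c \<Rightarrow> 'a" and S
    using that by (induction S rule: infinite_finite_induct) (auto simp: 1 m)
qed

lemma ideal_uminus: "is_subring R \<Longrightarrow> is_ideal R J \<Longrightarrow> a \<in> J \<Longrightarrow> - a \<in> J"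
  using is_idealD(4)[of R J "-1" a] is_subringD(1,5)[of R] by fastforce

lemma ideal_diff: "is_subring R \<Longrightarrow> is_ideal R J \<Longrightarrow> a \<in> J \<Longrightarrow> b \<in> J \<Longrightarrow> a - b \<in> J"
  using is_idealD(3)[of R J a "- b"] ideal_uminus by fastforce

lemma adjoin_mem:
  assumes "is_subring A" shows "x \<in> adjoin A x" "r \<in> A \<Longrightarrow> r \<in> adjoin A x"
proof -
  note a = is_subringD[OF assms]
  show "x \<in> adjoin A x" unfolding adjoin_def
    by (intro CollectI exI[of _ "1::nat"] exI[of _ "\<lambda>i. if i = 1 then 1 else 0"]) (use a(1,2) in auto)
  show "r \<in> A \<Longrightarrow> r \<in> adjoin A x" unfolding adjoin_def
    by (intro CollectI exI[of _ "0::nat"] exI[of _ "\<lambda>i. r"]) auto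
qed

section \<open>Hilbert's basis theorem\<close>

lemma lead_coeffs_ideal:
  assumes A: "is_subring A" and I: "is_ideal (adjoin A x) I"
  shows "is_ideal A (lead_coeffs A x I n)"
proof -
  note a = is_subringD[OF A]
  note AA = adjoin_mem(2)[OF A]
  show ?thesis unfolding is_ideal_def
  proof (intro conjI ballI)
    show "lead_coeffs A x I n \<subseteq> A" by (auto simp: lead_coeffs_def)
    show "0 \<in> lead_coeffs A x I n" using a(2) is_idealD(2)[OF I]
      by (auto simp: lead_coeffs_def intro!: exI[of _ "\<lambda>i. 0"])
    fix u assume "u \<in> lead_coeffs A x I n"
    then obtain c where u: "u \<in> A" and c: "\<forall>i. c i \<in> A" "u * x ^ n + (\<Sum>i<n. c i * x ^ i) \<in> I"
      by (auto simp: lead_coeffs_def)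
    {
      fix v assume "v \<in> lead_coeffs A x I n"
      then obtain d where v: "v \<in> A" and d: "\<forall>i. d i \<in> A" "v * x ^ n + (\<Sum>i<n. d i * x ^ i) \<in> I"
        by (auto simp: lead_coeffs_def)
      have "(u + v) * x ^ n + (\<Sum>i<n. (c i + d i) * x ^ i) =
        (u * x ^ n + (\<Sum>i<n. c i * x ^ i)) + (v * x ^ n + (\<Sum>i<n. d i * x ^ i))"
        by (simp add: algebra_simps sum.distrib)
      also have "\<dots> \<in> I" using c(2) d(2) is_idealD(3)[OF I] by blast
      finally show "u + v \<in> lead_coeffs A x I n"
        unfolding lead_coeffs_def using u v c(1) d(1) a(3) by (auto intro!: exI[of _ "\<lambda>i. c i + d i"])
    }
    fix r assume r: "r \<in> A"
    have "(r * u) * x ^ n + (\<Sum>i<n. (r * c i) * x ^ i) = r * (u * x ^ n + (\<Sum>i<n. c i * x ^ i))"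
      by (simp add: algebra_simps sum_distrib_left)
    also have "\<dots> \<in> I" using c(2) is_idealD(4)[OF I AA[OF r]] by blast
    finally show "r * u \<in> lead_coeffs A x I n"
      unfolding lead_coeffs_def using u c(1) r a(4) by (auto intro!: exI[of _ "\<lambda>i. r * c i"])
  qed
qed

lemma lead_coeffs_mono: "I \<subseteq> I' \<Longrightarrow> lead_coeffs A x I n \<subseteq> lead_coeffs A x I' n"
  unfolding lead_coeffs_def by blast

lemma lead_coeffs_Suc:
  assumes A: "is_subring A" and I: "is_ideal (adjoin A x) I"
  shows "lead_coeffs A x I n \<subseteq> lead_coeffs A x I (Suc n)"
proof
  note a = is_subringD[OF A]
  note xA = adjoin_mem(1)[OF A, of x]
  fix u assume "u \<in> lead_coeffs A x I n"
  then obtain c where u: "u \<in> A" and c: "\<forall>i. c i \<in> A" "u * x ^ n + (\<Sum>i<n. c i * x ^ i) \<in> I"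
    by (auto simp: lead_coeffs_def)
  have "u * x ^ Suc n + (\<Sum>i<Suc n. (case i of 0 \<Rightarrow> 0 | Suc j \<Rightarrow> c j) * x ^ i)
     = x * (u * x ^ n + (\<Sum>i<n. c i * x ^ i))"
    by (subst sum.lessThan_Suc_shift) (simp add: algebra_simps sum_distrib_left)
  also have "\<dots> \<in> I" using c(2) is_idealD(4)[OF I xA] by blast
  finally show "u \<in> lead_coeffs A x I (Suc n)"
    unfolding lead_coeffs_def using u c(1) a(2)
    by (auto intro!: exI[of _ "\<lambda>i. case i of 0 \<Rightarrow> 0 | Suc j \<Rightarrow> c j"] split: nat.split)
qed

lemma adjoin_subring:
  assumes A: "is_subring A" shows "is_subring (adjoin A x)"
proof -
  note a = is_subringD[OF A]
  have pad: "\<exists>c. (\<forall>i. c i \<in> A) \<and> (\<forall>i>n. c i = 0) \<and> f = (\<Sum>i\<le>k. c i * x ^ i)"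
    if "\<forall>i. d i \<in> A" "f = (\<Sum>i\<le>n. d i * x ^ i)" "n \<le> k" for d f n k
  proof (intro exI conjI)
    show "\<forall>i. (if i \<le> n then d i else 0) \<in> A" using that a by auto
    show "f = (\<Sum>i\<le>k. (if i \<le> n then d i else 0) * x ^ i)"
      unfolding that(2) by (rule sum.mono_neutral_cong_left) (use that in auto)
  qed auto
  have add: "f + g \<in> adjoin A x" if f: "f \<in> adjoin A x" and g: "g \<in> adjoin A x" for f g
  proof -
    obtain n c where 1: "\<forall>i. c i \<in> A" "f = (\<Sum>i\<le>n. c i * x ^ i)" using f by (auto simp: adjoin_def)
    obtain n' c' where 2: "\<forall>i. c' i \<in> A" "g = (\<Sum>i\<le>n'. c' i * x ^ i)" using g by (auto simp: adjoin_def)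
    obtain d where d: "\<forall>i. d i \<in> A" "f = (\<Sum>i\<le>max n n'. d i * x ^ i)" using pad[OF 1, of "max n n'"] by auto
    obtain e where e: "\<forall>i. e i \<in> A" "g = (\<Sum>i\<le>max n n'. e i * x ^ i)" using pad[OF 2, of "max n n'"] by auto
    have "f + g = (\<Sum>i\<le>max n n'. (d i + e i) * x ^ i)"
      by (simp add: d(2) e(2) algebra_simps sum.distrib)
    then show ?thesis unfolding adjoin_def using d(1) e(1) a(3)
      by (auto intro!: exI[of _ "max n n'"] exI[of _ "\<lambda>i. d i + e i"])
  qed
  have 0: "0 \<in> adjoin A x" unfolding adjoin_def using a(2) by (auto intro!: exI[of _ "\<lambda>i. 0"])
  have sumc: "sum f S \<in> adjoin A x" if "\<And>s. s \<in> S \<Longrightarrow> f s \<in> adjoin A x" for f and S :: "nat set"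
    using that by (induction S rule: infinite_finite_induct) (auto simp: 0 add)
  have mon: "r * x ^ k \<in> adjoin A x" if "r \<in> A" for r k
  proof -
    have "r * x ^ k = (\<Sum>i\<le>k. (if i = k then r else 0) * x ^ i)" by (subst sum.remove[of _ k]) auto
    then show ?thesis unfolding adjoin_def using that a(2)
      by (intro CollectI exI[of _ k] exI[of _ "\<lambda>i. if i = k then r else 0"]) auto
  qed
  have mult: "f * g \<in> adjoin A x" if f: "f \<in> adjoin A x" and g: "g \<in> adjoin A x" for f g
  proof -
    obtain n c where 1: "\<forall>i. c i \<in> A" "f = (\<Sum>i\<le>n. c i * x ^ i)" using f by (auto simp: adjoin_def)
    obtain n' c' where 2: "\<forall>i. c' i \<in> A" "g = (\<Sum>i\<le>n'. c' i * x ^ i)" using g by (auto simp: adjoin_def)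
    have "f * g = (\<Sum>i\<le>n. \<Sum>j\<le>n'. (c i * c' j) * x ^ (i + j))"
      unfolding 1 2 sum_product by (simp add: power_add algebra_simps)
    also have "\<dots> \<in> adjoin A x" using 1(1) 2(1) a(4) by (intro sumc mon) auto
    finally show ?thesis .
  qed
  show ?thesis unfolding is_subring_def
  proof (intro conjI ballI)
    show "1 \<in> adjoin A x" using mon[OF a(1), of 0] by simp
    have "- 1 \<in> adjoin A x" using mon[OF a(5)[OF a(1)], of 0] by simp
    then show "- f \<in> adjoin A x" if "f \<in> adjoin A x" for f using mult[OF _ that] by fastforce
  qed (auto intro: add mult)
qed

text \<open>Induction on the number of terms: an element of I' is reduced by an element of I with
  the same top coefficient, and the difference, again in I', has a shorter expression.\<close>

lemma ideal_eq_if_lead_coeffs_eq: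
  assumes A: "is_subring A" and I: "is_ideal (adjoin A x) I" and I': "is_ideal (adjoin A x) I'"
    and sub: "I \<subseteq> I'" and eq: "\<And>n. lead_coeffs A x I n = lead_coeffs A x I' n"
  shows "I = I'"
proof -
  note a = is_subringD[OF A]
  have key: "(\<Sum>i<n. c i * x ^ i) \<in> I" if "\<forall>i. c i \<in> A" "(\<Sum>i<n. c i * x ^ i) \<in> I'" for n c
    using that
  proof (induction n arbitrary: c)
    case 0 then show ?case using is_idealD(2)[OF I] by simp
  next
    case (Suc n)
    have "c n \<in> lead_coeffs A x I' n"
      unfolding lead_coeffs_def using Suc.prems by (auto intro!: exI[of _ c] simp: add.commute)
    then obtain d where d: "\<forall>i. d i \<in> A" "c n * x ^ n + (\<Sum>i<n. d i * x ^ i) \<in> I"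
      unfolding eq[symmetric] by (auto simp: lead_coeffs_def)
    have e: "(\<Sum>i<n. (c i - d i) * x ^ i) =
        (\<Sum>i<Suc n. c i * x ^ i) - (c n * x ^ n + (\<Sum>i<n. d i * x ^ i))"
      by (simp add: algebra_simps sum_subtractf)
    have "(\<Sum>i<n. (c i - d i) * x ^ i) \<in> I'"
      unfolding e using Suc.prems(2) d(2) sub ideal_diff[OF adjoin_subring[OF A] I'] by blast
    then have "(\<Sum>i<n. (c i - d i) * x ^ i) \<in> I"
      by (intro Suc.IH) (use Suc.prems(1) d(1) a(6) in auto)
    moreover have "(\<Sum>i<Suc n. c i * x ^ i) =
        (\<Sum>i<n. (c i - d i) * x ^ i) + (c n * x ^ n + (\<Sum>i<n. d i * x ^ i))"
      unfolding e by simp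
    ultimately show ?case using is_idealD(3)[OF I _ d(2)] by metis
  qed
  have "f \<in> I" if "f \<in> I'" for f
  proof -
    have "f \<in> adjoin A x" using that is_idealD(1)[OF I'] by blast
    then obtain n c where "\<forall>i. c i \<in> A" "f = (\<Sum>i\<le>n. c i * x ^ i)" unfolding adjoin_def by blast
    then show ?thesis using key[of c "Suc n"] that by (simp add: lessThan_Suc_atMost)
  qed
  then show ?thesis using sub by auto
qed

text \<open>The diagonal \<open>L_k(I_k)\<close> of the doubly increasing family of leading
  coefficient ideals stabilises, which settles all but finitely many degrees at once.\<close>

theorem adjoin_acc:
  assumes A: "is_subring A" and acc: "ideal_acc A"
  shows "ideal_acc (adjoin A x)"
  unfolding ideal_acc_def
proof (intro allI impI)
  fix I :: "nat \<Rightarrow> 'a set"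
  assume I: "\<forall>n. is_ideal (adjoin A x) (I n) \<and> I n \<subseteq> I (Suc n)"
  let ?L = "lead_coeffs A x"
  have mono: "I j \<subseteq> I k" if "j \<le> k" for j k using that I lift_Suc_mono_le by metis
  have Lid: "is_ideal A (?L (I k) n)" for k n using lead_coeffs_ideal[OF A] I by blast
  have Lmono: "?L (I j) n \<subseteq> ?L (I k) n'" if "j \<le> k" "n \<le> n'" for j k n n'
  proof -
    have "?L (I k) n \<subseteq> ?L (I k) n'"
      using lift_Suc_mono_le[of "?L (I k)"] lead_coeffs_Suc[OF A] I that(2) by blast
    then show ?thesis using lead_coeffs_mono[OF mono[OF that(1)]] by blast
  qed
  have stab: "\<exists>N. \<forall>n\<ge>N. f n = f N" if "\<forall>n. is_ideal A (f n) \<and> f n \<subseteq> f (Suc n)" for f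
    using acc that unfolding ideal_acc_def by blast
  obtain N where N: "\<forall>k\<ge>N. ?L (I k) k = ?L (I N) N"
    using stab[of "\<lambda>k. ?L (I k) k"] Lid Lmono by (meson le_SucI order_refl)
  have "\<forall>n. \<exists>M. \<forall>k\<ge>M. ?L (I k) n = ?L (I M) n"
    using stab[of "\<lambda>k. ?L (I k) n" for n] Lid Lmono by (meson le_SucI order_refl)
  then obtain M where M: "\<And>n k. k \<ge> M n \<Longrightarrow> ?L (I k) n = ?L (I (M n)) n" by metis
  \<comment> \<open>T bounds N and all the M n with n < N, so that low and high degrees are both
    stable from T on.\<close>
  define T where "T = N + (\<Sum>n<N. M n)"
  have "I k = I T" if "k \<ge> T" for k
  proof -
    have "?L (I T) n = ?L (I k) n" for n
    proof (cases "n < N")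
      case True
      then have "M n \<le> (\<Sum>n<N. M n)" by (intro member_le_sum) auto
      then have "M n \<le> T" by (simp add: T_def)
      then show ?thesis using M[of n T] M[of n k] that by simp
    next
      case False
      \<comment> \<open>For n at least N the ideal in degree n is squeezed between members of the
        diagonal, which all equal the one at N.\<close>
      have "?L (I k) n \<subseteq> ?L (I (k + n)) (k + n)" by (intro Lmono) auto
      also have "\<dots> = ?L (I N) N" using N[rule_format, of "k + n"] False by linarith
      also have "\<dots> \<subseteq> ?L (I T) n" using False by (intro Lmono) (auto simp: T_def)
      finally show ?thesis using Lmono[OF that, of n n] by auto
    qed
    then show ?thesis using ideal_eq_if_lead_coeffs_eq[OF A _ _ mono[OF that]] I by metis
  qed
  then show "\<exists>N. \<forall>n\<ge>N. I n = I N" by blast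
qed

section \<open>Associated primes and regular elements\<close>

definition nzd :: "'a::comm_ring_1 \<Rightarrow> 'a set \<Rightarrow> 'a set \<Rightarrow> bool" where
  "nzd z J J' \<longleftrightarrow> (\<forall>a\<in>J. z * a \<in> J' \<longrightarrow> a \<in> J')"

definition colon :: "'a::comm_ring_1 set \<Rightarrow> 'a set \<Rightarrow> 'a \<Rightarrow> 'a set" where
  "colon R J' b = {r \<in> R. r * b \<in> J'}"

text \<open>Dividing out z enlarges only \<open>J'\<close>, so all quotients stay subquotients of
  the ring. The last quotient may be zero: the zero module satisfies \<open>depth_ge m n\<close> for
  all n, and the depth lemma holds without exceptions. For nonzero monomial modules
  \<open>nakayama\<close> restores the agreement with \<open>regular_seq\<close>.\<close>

fun depth_ge :: "'a::comm_ring_1 set \<Rightarrow> nat \<Rightarrow> 'a set \<Rightarrow> 'a set \<Rightarrow> bool" where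
  "depth_ge m 0 J J' \<longleftrightarrow> True"
| "depth_ge m (Suc n) J J' \<longleftrightarrow> (\<exists>z\<in>m. nzd z J J' \<and> depth_ge m n J (J' + z *o J))"

lemma nzdD: "nzd z J J' \<Longrightarrow> a \<in> J \<Longrightarrow> z * a \<in> J' \<Longrightarrow> a \<in> J'"
  unfolding nzd_def by blast

lemma mem_step: "u \<in> J' + z *o J \<longleftrightarrow> (\<exists>b\<in>J'. \<exists>a\<in>J. u = b + z * a)"
  by (auto simp: set_plus_def elt_set_times_def)

lemma mem_stepI: "b \<in> J' \<Longrightarrow> a \<in> J \<Longrightarrow> u = b + z * a \<Longrightarrow> u \<in> J' + z *o J"
  unfolding mem_step by blast

lemma is_prime_idealD:
  assumes "is_prime_ideal R P"
  shows "is_ideal R P" "P \<noteq> R" "\<And>a b. a \<in> R \<Longrightarrow> b \<in> R \<Longrightarrow> a * b \<in> P \<Longrightarrow> a \<in> P \<or> b \<in> P"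
  using assms unfolding is_prime_ideal_def by auto

locale noetherian_ring_with_ideal =
  fixes R m :: "'a::comm_ring_1 set"
  assumes subring: "is_subring R" and acc: "ideal_acc R" and m: "is_ideal R m"
begin

lemmas R_closed = is_subringD[OF subring]

lemma m_subset: "z \<in> m \<Longrightarrow> z \<in> R"
  using is_idealD(1)[OF m] by blast

lemma maximal_ideal_in:
  assumes "S \<noteq> {}" and "\<And>I. I \<in> S \<Longrightarrow> is_ideal R I"
  shows "\<exists>I\<in>S. \<forall>I'\<in>S. I \<subseteq> I' \<longrightarrow> I' = I"
proof (rule ccontr)
  assume "\<not> ?thesis"
  then have "\<forall>I\<in>S. \<exists>I'\<in>S. I \<subset> I'" by blast
  then obtain f where f: "\<And>I. I \<in> S \<Longrightarrow> f I \<in> S \<and> I \<subset> f I" by metis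
  obtain I0 where I0: "I0 \<in> S" using assms(1) by blast
  define I where "I n = (f ^^ n) I0" for n
  have mem: "I n \<in> S" for n by (induction n) (auto simp: I_def I0 f)
  have step: "I n \<subset> I (Suc n)" for n using f[OF mem[of n]] by (simp add: I_def)
  have "\<exists>N. \<forall>n\<ge>N. I n = I N"
    using acc mem step assms(2) unfolding ideal_acc_def by (meson psubset_imp_subset)
  then show False using step by (metis le_SucI order_refl psubsetE)
qed

lemma colon_ideal:
  assumes "is_ideal R J'" "b \<in> R" shows "is_ideal R (colon R J' b)"
  using is_idealD[OF assms(1)] assms(2) R_closed unfolding is_ideal_def colon_def
  by (auto simp: algebra_simps)

lemma plus_ideal:
  assumes "is_ideal R I" "is_ideal R J" shows "is_ideal R (I + J)"
proof -
  note i = is_idealD[OF assms(1)] and j = is_idealD[OF assms(2)]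
  show ?thesis unfolding is_ideal_def set_plus_def
  proof (intro conjI ballI)
    show "{c. \<exists>a\<in>I. \<exists>b\<in>J. c = a + b} \<subseteq> R" using i(1) j(1) R_closed(3) by blast
    show "0 \<in> {c. \<exists>a\<in>I. \<exists>b\<in>J. c = a + b}" using i(2) j(2) by force
    fix u assume "u \<in> {c. \<exists>a\<in>I. \<exists>b\<in>J. c = a + b}"
    then obtain a b where u: "a \<in> I" "b \<in> J" "u = a + b" by blast
    { fix v assume "v \<in> {c. \<exists>a\<in>I. \<exists>b\<in>J. c = a + b}"
      then obtain a' b' where v: "a' \<in> I" "b' \<in> J" "v = a' + b'" by blast
      have "u + v = (a + a') + (b + b')" using u v by (simp add: algebra_simps)
      then show "u + v \<in> {c. \<exists>a\<in>I. \<exists>b\<in>J. c = a + b}" using i(3) j(3) u v by blast }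
    fix r assume "r \<in> R"
    then show "r * u \<in> {c. \<exists>a\<in>I. \<exists>b\<in>J. c = a + b}"
      using i(4)[of r a] j(4)[of r b] u by (auto simp: distrib_left)
  qed
qed

lemma smult_ideal:
  assumes "z \<in> R" "is_ideal R J" shows "is_ideal R (z *o J)"
proof -
  note j = is_idealD[OF assms(2)]
  show ?thesis unfolding is_ideal_def elt_set_times_def
  proof (intro conjI ballI)
    show "{c. \<exists>b\<in>J. c = z * b} \<subseteq> R" using j(1) assms(1) R_closed(4) by blast
    show "0 \<in> {c. \<exists>b\<in>J. c = z * b}" using j(2) by force
    fix u assume "u \<in> {c. \<exists>b\<in>J. c = z * b}"
    then obtain b where u: "b \<in> J" "u = z * b" by blast
    show "u + v \<in> {c. \<exists>b\<in>J. c = z * b}" if "v \<in> {c. \<exists>b\<in>J. c = z * b}" for v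
      using that u j(3) by (auto simp: distrib_left[symmetric])
    show "r * u \<in> {c. \<exists>b\<in>J. c = z * b}" if "r \<in> R" for r
      using j(4)[OF that u(1)] u(2) mult.left_commute[of r z b] by blast
  qed
qed

lemma principal_ideal: "b \<in> R \<Longrightarrow> is_ideal R (b *o R)"
  by (rule smult_ideal) (use R_closed in \<open>auto simp: is_ideal_def\<close>)

lemma plus_subset:
  assumes "is_ideal R K" "I \<subseteq> K" "J \<subseteq> K" shows "I + J \<subseteq> K"
  using is_idealD(3)[OF assms(1)] assms(2,3) by (auto simp: set_plus_def)

lemma subset_plus: "is_ideal R I \<Longrightarrow> is_ideal R J \<Longrightarrow> I \<subseteq> I + J" "is_ideal R I \<Longrightarrow> is_ideal R J \<Longrightarrow> J \<subseteq> I + J"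
  using set_zero_plus2[of J I] set_zero_plus2[of I J] is_idealD(2) by (auto simp: add.commute)

lemma smult_subset: "is_ideal R J \<Longrightarrow> z \<in> R \<Longrightarrow> z *o J \<subseteq> J"
  using is_idealD(4) by (auto simp: elt_set_times_def)

lemma quotient_step:
  assumes "is_ideal R J" "is_ideal R J'" "J' \<subseteq> J" "z \<in> R"
  shows "is_ideal R (J' + z *o J)" "J' + z *o J \<subseteq> J" "J' \<subseteq> J' + z *o J"
  using assms plus_ideal smult_ideal plus_subset smult_subset subset_plus by auto

text \<open>Among the annihilators of the nonzero multiples of b a maximal one is prime: if u v
  kills r b and v does not, then the annihilator of v r b contains u and equals the old one by
  maximality.\<close>

lemma exists_prime_colon:
  assumes J': "is_ideal R J'" and b: "b \<in> R" "b \<notin> J'"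
  obtains r where "r \<in> R" "r * b \<notin> J'" "is_prime_ideal R (colon R J' (r * b))"
proof -
  let ?S = "{colon R J' (r * b) | r. r \<in> R \<and> r * b \<notin> J'}"
  have "?S \<noteq> {}" using b R_closed(1) by (auto intro!: exI[of _ 1])
  moreover have "is_ideal R I" if "I \<in> ?S" for I
    using that colon_ideal[OF J'] R_closed(4) b(1) by auto
  ultimately obtain I where "I \<in> ?S" and max: "\<forall>I'\<in>?S. I \<subseteq> I' \<longrightarrow> I' = I"
    using maximal_ideal_in[of ?S] by blast
  then obtain r where r: "r \<in> R" "r * b \<notin> J'" and I: "I = colon R J' (r * b)" by blast
  have "is_prime_ideal R I" unfolding is_prime_ideal_def
  proof (intro conjI ballI impI)
    show "is_ideal R I" unfolding I by (intro colon_ideal J' R_closed(4) r b)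
    show "I \<noteq> R" using r(2) R_closed(1) unfolding I colon_def by force
    fix u v assume uv: "u \<in> R" "v \<in> R" "u * v \<in> I"
    show "u \<in> I \<or> v \<in> I"
    proof (cases "v \<in> I")
      case False
      then have v: "(v * r) * b \<notin> J'" using uv(2) unfolding I colon_def by (simp add: mult.assoc)
      then have "colon R J' ((v * r) * b) \<in> ?S" using uv(2) r(1) R_closed(4) by blast
      moreover have "I \<subseteq> colon R J' ((v * r) * b)"
      proof
        fix s assume s: "s \<in> I"
        have e: "s * ((v * r) * b) = v * (s * (r * b))" by (simp add: algebra_simps)
        show "s \<in> colon R J' ((v * r) * b)"
          using s is_idealD(4)[OF J' uv(2)] unfolding I colon_def mem_Collect_eq e by blast
      qed
      ultimately have "colon R J' ((v * r) * b) = I" using max by blast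
      moreover have "u \<in> colon R J' ((v * r) * b)"
        using uv unfolding I colon_def by (simp add: mult.assoc)
      ultimately show ?thesis by simp
    qed simp
  qed
  then show thesis using that r I by blast
qed

definition zero_divisor_primes :: "'a set \<Rightarrow> 'a set \<Rightarrow> 'a set set \<Rightarrow> bool" where
  "zero_divisor_primes J J' Ps \<longleftrightarrow> finite Ps \<and>
     (\<forall>P\<in>Ps. is_prime_ideal R P \<and> (\<exists>a\<in>J. a \<notin> J' \<and> P = colon R J' a)) \<and>
     (\<forall>z\<in>R. \<forall>b\<in>J. b \<notin> J' \<longrightarrow> z * b \<in> J' \<longrightarrow> (\<exists>P\<in>Ps. z \<in> P))"

text \<open>Noetherian induction over submodules \<open>L\<close>: collect primes of cyclic submodules that meet
  \<open>L\<close> trivially, until what has been collected is essential.\<close>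

lemma finite_associated_primes:
  assumes J: "is_ideal R J" and J': "is_ideal R J'" "J' \<subseteq> J"
  shows "\<exists>Ps. zero_divisor_primes J J' Ps"
proof -
  \<comment> \<open>Q L settles those zero divisors z that kill some b with Rb meeting L only in
    zero, all modulo \<open>J'\<close>; for L = \<open>J'\<close> this is the claim. A maximal L at
    which Q fails is led to a contradiction.\<close>
  define Q where "Q L \<longleftrightarrow> (\<exists>Ps. finite Ps \<and>
    (\<forall>P\<in>Ps. is_prime_ideal R P \<and> (\<exists>a\<in>J. a \<notin> J' \<and> P = colon R J' a)) \<and>
    (\<forall>z\<in>R. (\<exists>b\<in>J. b \<notin> J' \<and> z * b \<in> J' \<and> (\<forall>r\<in>R. r * b \<in> L \<longrightarrow> r * b \<in> J')) \<longrightarrow>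
       (\<exists>P\<in>Ps. z \<in> P)))" for L
  have "Q J'"
  proof (rule ccontr)
    assume "\<not> Q J'"
    define S where "S = {L. is_ideal R L \<and> J' \<subseteq> L \<and> \<not> Q L}"
    have "S \<noteq> {}" using J'(1) \<open>\<not> Q J'\<close> by (auto simp: S_def)
    moreover have "\<And>I. I \<in> S \<Longrightarrow> is_ideal R I" by (simp add: S_def)
    ultimately obtain L where LS: "L \<in> S" and max: "\<forall>L'\<in>S. L \<subseteq> L' \<longrightarrow> L' = L"
      using maximal_ideal_in[of S] by blast
    have L: "is_ideal R L" "J' \<subseteq> L" "\<not> Q L" using LS unfolding S_def by blast+
    have "\<exists>b\<in>J. b \<notin> J' \<and> (\<forall>r\<in>R. r * b \<in> L \<longrightarrow> r * b \<in> J')"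
    proof (rule ccontr)
      assume "\<not> ?thesis"
      then have "Q L" unfolding Q_def by (intro exI[of _ "{}"]) blast
      then show False using L(3) by blast
    qed
    then obtain b0 where b0: "b0 \<in> J" "b0 \<notin> J'" "\<forall>r\<in>R. r * b0 \<in> L \<longrightarrow> r * b0 \<in> J'" by blast
    have b0R: "b0 \<in> R" using b0(1) is_idealD(1)[OF J] by blast
    obtain r0 where r0: "r0 \<in> R" "r0 * b0 \<notin> J'" "is_prime_ideal R (colon R J' (r0 * b0))"
      using exists_prime_colon[OF J'(1) b0R b0(2)] by blast
    define b where "b = r0 * b0"
    have b: "b \<in> J" "b \<notin> J'" "is_prime_ideal R (colon R J' b)" "b \<in> R"
      using r0 b0(1) is_idealD(4)[OF J] is_idealD(1)[OF J] by (auto simp: b_def)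
    have bL: "r * b \<in> J'" if "r \<in> R" "r * b \<in> L" for r
      using b0(3)[rule_format, OF R_closed(4)[OF that(1) r0(1)]] that(2) unfolding b_def by (simp only: mult.assoc)
    \<comment> \<open>b has a prime annihilator and generates a submodule meeting L trivially, so L1
      is strictly larger than L and Q holds for it.\<close>
    define L1 where "L1 = L + b *o R"
    have L1: "is_ideal R L1" "L \<subseteq> L1"
      unfolding L1_def using plus_ideal subset_plus principal_ideal[OF b(4)] L(1) by auto
    have "b \<in> L1" unfolding L1_def mem_step
      using is_idealD(2)[OF L(1)] R_closed(1) by (intro bexI[of _ 0] bexI[of _ 1]) auto
    moreover have "b \<notin> L" using bL[OF R_closed(1)] b(2) by auto
    ultimately have "L1 \<notin> S" using max L1(2) by blast
    then have "Q L1" using L1 L(2) unfolding S_def by blast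
    then obtain Ps where Ps: "finite Ps"
      "\<forall>P\<in>Ps. is_prime_ideal R P \<and> (\<exists>a\<in>J. a \<notin> J' \<and> P = colon R J' a)"
      "\<forall>z\<in>R. (\<exists>b\<in>J. b \<notin> J' \<and> z * b \<in> J' \<and> (\<forall>r\<in>R. r * b \<in> L1 \<longrightarrow> r * b \<in> J')) \<longrightarrow> (\<exists>P\<in>Ps. z \<in> P)"
      unfolding Q_def by blast
    have "Q L" unfolding Q_def
    proof (intro exI[of _ "insert (colon R J' b) Ps"] conjI ballI impI)
      fix z assume z: "z \<in> R" "\<exists>b\<in>J. b \<notin> J' \<and> z * b \<in> J' \<and> (\<forall>r\<in>R. r * b \<in> L \<longrightarrow> r * b \<in> J')"
      then obtain c where c: "c \<in> J" "c \<notin> J'" "z * c \<in> J'" "\<forall>r\<in>R. r * c \<in> L \<longrightarrow> r * c \<in> J'" by blast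
      show "\<exists>P\<in>insert (colon R J' b) Ps. z \<in> P"
      proof (cases "\<forall>r\<in>R. r * c \<in> L1 \<longrightarrow> r * c \<in> J'")
        case True then show ?thesis using Ps(3) z(1) c by blast
      next
        case False
        \<comment> \<open>A multiple of c in L1 has the form l + b s. As z kills c, the product z s
          b lies in L and hence vanishes, while s b does not; primality of the annihilator of b
          forces z into it.\<close>
        then obtain r where r: "r \<in> R" "r * c \<in> L1" "r * c \<notin> J'" by blast
        then obtain l s where ls: "l \<in> L" "s \<in> R" "r * c = l + b * s"
          unfolding L1_def set_plus_def elt_set_times_def by blast
        have zs: "z * s \<in> R" using z(1) ls(2) R_closed(4) by blast
        have "(z * s) * b = r * (z * c) - z * l" using ls(3)
          by (metis (no_types, lifting) add_diff_cancel_left' mult.assoc mult.commute right_diff_distrib)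
        moreover have "r * (z * c) \<in> L" "z * l \<in> L"
          using c(3) L(2) r(1) z(1) ls(1) is_idealD(4)[OF L(1)] by auto
        ultimately have "(z * s) * b \<in> L" using ideal_diff[OF subring L(1)] by metis
        then have zsb: "z * s \<in> colon R J' b" using bL[OF zs] zs by (simp add: colon_def)
        have "s * b \<notin> J'"
        proof
          assume "s * b \<in> J'"
          then have "r * c \<in> L" unfolding ls(3) using ls(1) L(2) is_idealD(3)[OF L(1)]
            by (simp add: mult.commute subsetD)
          then show False using c(4) r by blast
        qed
        then have "s \<notin> colon R J' b" by (simp add: colon_def)
        then show ?thesis using is_prime_idealD(3)[OF b(3) z(1) ls(2) zsb] by blast
      qed
    qed (use Ps(1,2) b in auto)
    then show False using L(3) by blast
  qed
  then show ?thesis unfolding Q_def zero_divisor_primes_def by fast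
qed

section \<open>Prime avoidance and common nonzerodivisors\<close>

lemma prime_prod:
  assumes P: "is_prime_ideal R P"
  shows "finite S \<Longrightarrow> (\<And>s. s \<in> S \<Longrightarrow> f s \<in> R) \<Longrightarrow> prod f S \<in> P \<Longrightarrow> \<exists>s\<in>S. f s \<in> P"
proof (induction S rule: finite_induct)
  case empty
  then have "r \<in> P" if "r \<in> R" for r
    using is_idealD(4)[OF is_prime_idealD(1)[OF P] that, of 1] by simp
  then show ?case using is_prime_idealD(1,2)[OF P] is_idealD(1) by blast
next
  case (insert s S)
  have "f s \<in> P \<or> prod f S \<in> P"
    by (rule is_prime_idealD(3)[OF P]) (use insert in \<open>auto intro!: R_closed(9)\<close>)
  then show ?case using insert by blast
qed

text \<open>In the irredundant case choose for each P an element of I lying in P and in no other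
  prime of the family. With at least two primes, the element of one plus the product of the elements
  of all the others lies in none of them.\<close>

lemma prime_avoidance:
  assumes I: "is_ideal R I"
  shows "finite Ps \<Longrightarrow> (\<And>P. P \<in> Ps \<Longrightarrow> is_prime_ideal R P) \<Longrightarrow> I \<subseteq> \<Union>Ps \<Longrightarrow> \<exists>P\<in>Ps. I \<subseteq> P"
proof (induction "card Ps" arbitrary: Ps)
  case 0
  then show ?case using is_idealD(2)[OF I] by auto
next
  case (Suc n)
  show ?case
  proof (cases "\<exists>P\<in>Ps. I \<subseteq> \<Union>(Ps - {P})")
    case True
    then obtain P where P: "P \<in> Ps" "I \<subseteq> \<Union>(Ps - {P})" by blast
    have "\<exists>Q\<in>Ps - {P}. I \<subseteq> Q" by (rule Suc.hyps(1)) (use Suc P in auto)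
    then show ?thesis by blast
  next
    case False
    then have "\<forall>P\<in>Ps. \<exists>x\<in>I. x \<notin> \<Union>(Ps - {P})" by blast
    then obtain x where x: "\<And>P. P \<in> Ps \<Longrightarrow> x P \<in> I" "\<And>P Q. P \<in> Ps \<Longrightarrow> Q \<in> Ps \<Longrightarrow> Q \<noteq> P \<Longrightarrow> x P \<notin> Q"
      by (metis Diff_iff UnionI singletonD)
    have xP: "x P \<in> P" if "P \<in> Ps" for P using x that Suc.prems(3) by blast
    obtain P0 where P0: "P0 \<in> Ps" using Suc.hyps(2) by force
    show ?thesis
    proof (cases "Ps = {P0}")
      case True then show ?thesis using Suc.prems(3) by auto
    next
      case False
      let ?pr = "prod x (Ps - {P0})"
      have xR: "x P \<in> R" if "P \<in> Ps" for P using x(1)[OF that] is_idealD(1)[OF I] by blast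
      obtain P1 where P1: "P1 \<in> Ps - {P0}" using False P0 by blast
      have rest: "prod x (Ps - {P0} - {Q}) \<in> R" for Q using xR R_closed(9)[of "Ps - {P0} - {Q}" x] by blast
      have split: "?pr = prod x (Ps - {P0} - {Q}) * x Q" if "Q \<in> Ps - {P0}" for Q
        using prod.remove[OF _ that, of x] Suc.prems(1) by (simp add: mult.commute)
      have prI: "?pr \<in> I" using split[OF P1] is_idealD(4)[OF I rest x(1)] P1 by auto
      have "x P0 + ?pr \<in> I" using is_idealD(3)[OF I x(1)[OF P0] prI] .
      then obtain Q where Q: "Q \<in> Ps" "x P0 + ?pr \<in> Q" using Suc.prems(3) by blast
      have Qi: "is_ideal R Q" using Suc.prems(2)[OF Q(1)] is_prime_idealD(1) by blast
      show ?thesis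
      proof (cases "Q = P0")
        case True
        have "?pr \<in> P0" using ideal_diff[OF subring Qi Q(2), of "x P0"] xP[OF P0] True by simp
        then obtain P where "P \<in> Ps - {P0}" "x P \<in> P0"
          using prime_prod[OF Suc.prems(2)[OF P0], of "Ps - {P0}" x] Suc.prems(1) xR by auto
        then show ?thesis using x(2)[of P P0] P0 by auto
      next
        case False
        then have "?pr \<in> Q" using split[of Q] Q(1) is_idealD(4)[OF Qi rest xP[OF Q(1)]] by auto
        then have "x P0 \<in> Q" using ideal_diff[OF subring Qi Q(2)] by fastforce
        then show ?thesis using x(2)[OF P0 Q(1)] False by blast
      qed
    qed
  qed
qed

text \<open>No nonzero element of J/J' is killed by m, that is, Hom(R/m, J/J') = 0. By
  \<open>nzd_socle_free\<close> and \<open>common_nzd\<close> this is equivalent to m containing a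
  nonzerodivisor on the module.\<close>

definition socle_free :: "'a set \<Rightarrow> 'a set \<Rightarrow> bool" where
  "socle_free J J' \<longleftrightarrow> (\<forall>a\<in>J. (\<forall>r\<in>m. r * a \<in> J') \<longrightarrow> a \<in> J')"

definition subquotient :: "'a set \<Rightarrow> 'a set \<Rightarrow> bool" where
  "subquotient J J' \<longleftrightarrow> is_ideal R J \<and> is_ideal R J' \<and> J' \<subseteq> J"

lemma nzd_socle_free: "z \<in> m \<Longrightarrow> nzd z J J' \<Longrightarrow> socle_free J J'"
  unfolding nzd_def socle_free_def by blast

text \<open>Associated primes are annihilators of nonzero elements, so in the absence of a socle
  none of them contains m. Avoiding the associated primes of all the modules together yields a
  single z for all of them.\<close>

lemma common_nzd:
  assumes "finite M" and "\<And>J J'. (J, J') \<in> M \<Longrightarrow> subquotient J J' \<and> socle_free J J'"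
  obtains z where "z \<in> m" "\<And>J J'. (J, J') \<in> M \<Longrightarrow> nzd z J J'"
proof -
  have "\<exists>Ps. zero_divisor_primes (fst x) (snd x) Ps" if "x \<in> M" for x
    using that assms(2)[of "fst x" "snd x"] finite_associated_primes unfolding subquotient_def by simp
  then obtain Ps where ass: "\<And>x. x \<in> M \<Longrightarrow> zero_divisor_primes (fst x) (snd x) (Ps x)" by metis
  have Ps: "finite (Ps x)" "\<And>P. P \<in> Ps x \<Longrightarrow> is_prime_ideal R P"
    "\<And>P. P \<in> Ps x \<Longrightarrow> \<exists>a\<in>fst x. a \<notin> snd x \<and> P = colon R (snd x) a"
    "\<And>z b. z \<in> R \<Longrightarrow> b \<in> fst x \<Longrightarrow> b \<notin> snd x \<Longrightarrow> z * b \<in> snd x \<Longrightarrow> \<exists>P\<in>Ps x. z \<in> P"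
    if "x \<in> M" for x
    using ass[OF that] unfolding zero_divisor_primes_def by simp_all
  have "\<not> m \<subseteq> \<Union>(\<Union>x\<in>M. Ps x)"
  proof
    assume sub: "m \<subseteq> \<Union>(\<Union>x\<in>M. Ps x)"
    have "\<exists>P\<in>(\<Union>x\<in>M. Ps x). m \<subseteq> P"
      by (rule prime_avoidance[OF m]) (use assms(1) Ps(1,2) sub in auto)
    then obtain x P where x: "x \<in> M" "P \<in> Ps x" "m \<subseteq> P" by blast
    obtain a where a: "a \<in> fst x" "a \<notin> snd x" "P = colon R (snd x) a" using Ps(3)[OF x(1,2)] by blast
    have "r * a \<in> snd x" if "r \<in> m" for r using that x(3) a(3) by (auto simp: colon_def)
    moreover have "socle_free (fst x) (snd x)" using assms(2)[of "fst x" "snd x"] x(1) by simp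
    ultimately show False using a(1,2) unfolding socle_free_def by blast
  qed
  then obtain z where z: "z \<in> m" "z \<notin> \<Union>(\<Union>x\<in>M. Ps x)" by blast
  show thesis
  proof (rule that[OF z(1)])
    fix J J' assume "(J, J') \<in> M"
    then show "nzd z J J'" unfolding nzd_def using Ps(4)[of "(J, J')" z] m_subset[OF z(1)] z(2) by fastforce
  qed
qed

section \<open>Depth\<close>


lemma subquotient_step:
  "subquotient J J' \<Longrightarrow> z \<in> m \<Longrightarrow> subquotient J (J' + z *o J)"
  unfolding subquotient_def using quotient_step m_subset by auto

lemma common_nzd_of:
  assumes "subquotient J1 K1" "socle_free J1 K1" "subquotient J2 K2" "socle_free J2 K2"
    "subquotient J3 K3" "socle_free J3 K3"
  obtains z where "z \<in> m" "nzd z J1 K1" "nzd z J2 K2" "nzd z J3 K3"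
proof -
  obtain z where "z \<in> m" "\<And>J J'. (J, J') \<in> {(J1,K1),(J2,K2),(J3,K3)} \<Longrightarrow> nzd z J J'"
    by (rule common_nzd[of "{(J1,K1),(J2,K2),(J3,K3)}"]) (use assms in auto)
  then show thesis using that by simp
qed

section \<open>Independence of the depth from the first regular element\<close>

lemma step_commute: "(J' + x *o J) + y *o J = (J' + y *o J) + x *o (J :: 'a set)"
  by (simp add: ac_simps)

text \<open>The half of exchanging a regular sequence x, z that holds over any ring: x a = z c makes
  c a multiple x e modulo \<open>J'\<close>, and cancelling x leaves a = z e.\<close>

lemma nzd_swap:
  assumes sub: "subquotient J J'" and x: "x \<in> R" "nzd x J J'" and z: "z \<in> R" "nzd z J J'"
    and zx: "nzd z J (J' + x *o J)"
  shows "nzd x J (J' + z *o J)"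
  unfolding nzd_def
proof (intro ballI impI)
  have J: "is_ideal R J" and J': "is_ideal R J'" "J' \<subseteq> J" using sub by (auto simp: subquotient_def)
  fix a assume a: "a \<in> J" "x * a \<in> J' + z *o J"
  then obtain b c where bc: "b \<in> J'" "c \<in> J" "x * a = b + z * c" unfolding mem_step by blast
  have "z * c = - b + x * a" using bc(3) by simp
  then have "z * c \<in> J' + x *o J" unfolding mem_step using ideal_uminus[OF subring J'(1) bc(1)] a(1) by blast
  then have "c \<in> J' + x *o J" using nzdD[OF zx bc(2)] by blast
  then obtain b' e where e: "b' \<in> J'" "e \<in> J" "c = b' + x * e" unfolding mem_step by blast
  have ae: "a - z * e \<in> J" using ideal_diff[OF subring J a(1)] is_idealD(4)[OF J z(1) e(2)] by blast
  have "x * (a - z * e) = b + z * b'" using bc(3) e(3) by (simp add: algebra_simps)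
  also have "\<dots> \<in> J'" using is_idealD(3,4)[OF J'(1)] bc(1) e(1) z(1) by blast
  finally have "a - z * e \<in> J'" using nzdD[OF x(2) ae] by blast
  then show "a \<in> J' + z *o J" using e(2) by (intro mem_stepI[of "a - z * e" _ e]) auto
qed

text \<open>Behind this stands Hom(R/m, M/xM) = Ext^1(R/m, M), which does not involve x. Concretely,
  an element b killed by m modulo yM satisfies x b = y b', and b' is killed by m modulo xM.\<close>

lemma socle_free_transfer:
  assumes sub: "subquotient J J'" and x: "x \<in> m" "nzd x J J'" and y: "y \<in> m" "nzd y J J'"
    and sf: "socle_free J (J' + x *o J)"
  shows "socle_free J (J' + y *o J)"
  unfolding socle_free_def
proof (intro ballI impI)
  have J: "is_ideal R J" and J': "is_ideal R J'" "J' \<subseteq> J" using sub by (auto simp: subquotient_def)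
  have xR: "x \<in> R" and yR: "y \<in> R" using m_subset x y by auto
  fix b assume b: "b \<in> J" "\<forall>r\<in>m. r * b \<in> J' + y *o J"
  then obtain j b' where b': "j \<in> J'" "b' \<in> J" "x * b = j + y * b'" using x(1) unfolding mem_step by blast
  have "b' \<in> J' + x *o J"
  proof (rule sf[unfolded socle_free_def, rule_format, OF b'(2)])
    fix r assume r: "r \<in> m"
    then have rR: "r \<in> R" by (rule m_subset)
    obtain k a where a: "k \<in> J'" "a \<in> J" "r * b = k + y * a" using b(2) r unfolding mem_step by blast
    have mem: "r * b' - x * a \<in> J"
      using ideal_diff[OF subring J] is_idealD(4)[OF J] rR xR b'(2) a(2) by blast
    have "y * (r * b' - x * a) = r * (y * b') - x * (y * a)" by (simp add: algebra_simps)
    also have "\<dots> = x * k - r * j" using arg_cong[OF b'(3), of "\<lambda>t. r * t"] arg_cong[OF a(3), of "\<lambda>t. x * t"]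
      by (simp add: algebra_simps)
    also have "\<dots> \<in> J'" using ideal_diff[OF subring J'(1)] is_idealD(4)[OF J'(1)] rR xR b'(1) a(1) by blast
    finally have "r * b' - x * a \<in> J'" using nzdD[OF y(2) mem] by blast
    then show "r * b' \<in> J' + x *o J" using a(2)
      by (intro mem_stepI[of "r * b' - x * a" _ a]) auto
  qed
  then obtain k e where e: "k \<in> J'" "e \<in> J" "b' = k + x * e" unfolding mem_step by blast
  have mem: "b - y * e \<in> J" using ideal_diff[OF subring J b(1)] is_idealD(4)[OF J yR e(2)] by blast
  have "x * (b - y * e) = j + y * k" using b'(3) e(3) by (simp add: algebra_simps)
  also have "\<dots> \<in> J'" using is_idealD(3,4)[OF J'(1)] b'(1) e(1) yR by blast
  finally have "b - y * e \<in> J'" using nzdD[OF x(2) mem] by blast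
  then show "b \<in> J' + y *o J" using e(2) by (intro mem_stepI[of "b - y * e" _ e]) auto
qed

text \<open>An element z regular on M, M/xM and M/yM links x to y: the induction hypothesis on M/xM
  trades the next element for z, the one on M/zM trades x for y, and the order of dividing out is
  immaterial.\<close>

lemma depth_ge_transfer:
  assumes "subquotient J J'" "x \<in> m" "nzd x J J'" "y \<in> m" "nzd y J J'" "depth_ge m n J (J' + x *o J)"
  shows "depth_ge m n J (J' + y *o J)"
  using assms
proof (induction n arbitrary: J' x y)
  case (Suc n)
  note sub = Suc.prems(1) and x = Suc.prems(2,3) and y = Suc.prems(4,5)
  have subx: "subquotient J (J' + x *o J)" and suby: "subquotient J (J' + y *o J)"
    using subquotient_step sub x y by auto
  obtain w where w: "w \<in> m" "nzd w J (J' + x *o J)" "depth_ge m n J (J' + x *o J + w *o J)"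
    using Suc.prems(6) by auto
  have sfx: "socle_free J (J' + x *o J)" using nzd_socle_free w by blast
  obtain z where z: "z \<in> m" "nzd z J J'" "nzd z J (J' + x *o J)" "nzd z J (J' + y *o J)"
    using common_nzd_of[OF sub nzd_socle_free[OF x] subx sfx suby socle_free_transfer[OF sub x y sfx]]
    by blast
  have subz: "subquotient J (J' + z *o J)" using subquotient_step sub z by auto
  have "depth_ge m n J (J' + z *o J + x *o J)"
    using Suc.IH[OF subx w(1,2) z(1,3) w(3)] by (simp only: step_commute)
  then have "depth_ge m n J (J' + z *o J + y *o J)"
    using Suc.IH[OF subz x(1) _ y(1)] nzd_swap[OF sub _ _ _ z(2)] x y z m_subset by blast
  then have "depth_ge m n J (J' + y *o J + z *o J)" by (simp only: step_commute)
  then show ?case using z by auto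
qed simp

lemma depth_ge_quotient:
  assumes "subquotient J J'" "z \<in> m" "nzd z J J'" "depth_ge m (Suc n) J J'"
  shows "depth_ge m n J (J' + z *o J)"
proof -
  obtain x where "x \<in> m" "nzd x J J'" "depth_ge m n J (J' + x *o J)" using assms(4) by auto
  then show ?thesis using depth_ge_transfer[OF assms(1) _ _ assms(2,3)] by blast
qed

lemma depth_ge_socle_free: "depth_ge m (Suc n) J J' \<Longrightarrow> socle_free J J'"
  using nzd_socle_free by auto

lemma depth_ge_Suc_D:
  assumes "subquotient J J'" "depth_ge m (Suc n) J J'" shows "depth_ge m n J J'"
  using assms
proof (induction n arbitrary: J')
  case (Suc n)
  obtain z where z: "z \<in> m" "nzd z J J'" "depth_ge m (Suc n) J (J' + z *o J)"
    using Suc.prems(2) by auto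
  have "depth_ge m n J (J' + z *o J)" by (rule Suc.IH[OF subquotient_step[OF Suc.prems(1) z(1)] z(3)])
  then show ?case using z by auto
qed simp

lemma depth_ge_mono:
  assumes "subquotient J J'" "depth_ge m n J J'" "k \<le> n" shows "depth_ge m k J J'"
  using assms(3)
proof (induction k rule: inc_induct)
  case base show ?case by (rule assms(2))
next
  case (step k) then show ?case using depth_ge_Suc_D[OF assms(1)] by blast
qed

text \<open>Modules are concrete subquotients, so depth has to be carried along isomorphisms by
  hand; the later transfers are derived from this one isomorphism theorem.\<close>

lemma depth_ge_second_iso:
  assumes "is_ideal R U" "is_ideal R V"
  shows "depth_ge m n (U + V) V \<longleftrightarrow> depth_ge m n U (U \<inter> V)"
  using assms(2)
proof (induction n arbitrary: V)
  case (Suc n)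
  note U = assms(1) and V = Suc.prems
  have nz: "nzd z (U + V) V \<longleftrightarrow> nzd z U (U \<inter> V)" if z: "z \<in> m" for z
  proof
    assume *: "nzd z (U + V) V"
    show "nzd z U (U \<inter> V)" unfolding nzd_def
      using nzdD[OF *] subset_plus(1)[OF U V] by blast
  next
    assume *: "nzd z U (U \<inter> V)"
    show "nzd z (U + V) V" unfolding nzd_def
    proof (intro ballI impI)
      fix a assume a: "a \<in> U + V" "z * a \<in> V"
      then obtain u v where uv: "u \<in> U" "v \<in> V" "a = u + v" by (auto simp: set_plus_def)
      have "z * u = z * a - z * v" by (simp add: uv(3) algebra_simps)
      then have "z * u \<in> V" using ideal_diff[OF subring V a(2)] is_idealD(4)[OF V m_subset[OF z] uv(2)] by simp
      then have "u \<in> V" using nzdD[OF * uv(1)] is_idealD(4)[OF U m_subset[OF z] uv(1)] by blast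
      then show "a \<in> V" using uv is_idealD(3)[OF V] by blast
    qed
  qed
  have st: "depth_ge m n (U + V) (V + z *o (U + V)) \<longleftrightarrow> depth_ge m n U (U \<inter> V + z *o U)" if z: "z \<in> m" for z
  proof -
    have zR: "z \<in> R" using z by (rule m_subset)
    \<comment> \<open>With V enlarged to V + zU, the quotients by z of both sides are again the two
      sides of the same isomorphism.\<close>
    let ?V = "V + z *o U"
    have V1: "is_ideal R ?V" using plus_ideal[OF V smult_ideal[OF zR U]] .
    have a: "V + z *o (U + V) = ?V"
    proof
      show "V + z *o (U + V) \<subseteq> ?V"
      proof
        fix t assume "t \<in> V + z *o (U + V)"
        then obtain v w where "v \<in> V" "w \<in> U + V" "t = v + z * w" unfolding mem_step by blast
        moreover then obtain u v' where "u \<in> U" "v' \<in> V" "w = u + v'" by (auto simp: set_plus_def)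
        moreover have "v + z * v' \<in> V" by (rule is_idealD(3)[OF V \<open>v \<in> V\<close> is_idealD(4)[OF V zR \<open>v' \<in> V\<close>]])
        ultimately show "t \<in> ?V" by (intro mem_stepI[of "v + z * v'" _ u]) (simp_all add: distrib_left add.assoc add.commute[of "z * u"])
      qed
      show "?V \<subseteq> V + z *o (U + V)"
        by (intro set_plus_mono2 set_times_mono subset_plus(1)[OF U V] order_refl)
    qed
    have b: "U + V = U + ?V"
    proof
      show "U + V \<subseteq> U + ?V"
        by (intro set_plus_mono2 order_refl subset_plus(1)[OF V smult_ideal[OF zR U]])
      have 1: "z *o U \<subseteq> U + V" using smult_subset[OF U zR] subset_plus(1)[OF U V] by (rule order_trans)
      show "U + ?V \<subseteq> U + V"
        by (intro plus_subset[OF plus_ideal[OF U V]] subset_plus[OF U V] 1)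
    qed
    have c: "U \<inter> V + z *o U = U \<inter> ?V"
    proof
      show "U \<inter> V + z *o U \<subseteq> U \<inter> ?V"
      proof
        fix t assume "t \<in> U \<inter> V + z *o U"
        then obtain b a where ba: "b \<in> U \<inter> V" "a \<in> U" "t = b + z * a" unfolding mem_step by blast
        have "t \<in> U" unfolding ba(3)
          using is_idealD(3)[OF U] is_idealD(4)[OF U zR ba(2)] ba(1) by blast
        moreover have "t \<in> ?V" using mem_stepI[OF _ ba(2,3)] ba(1) by blast
        ultimately show "t \<in> U \<inter> ?V" by blast
      qed
      show "U \<inter> ?V \<subseteq> U \<inter> V + z *o U"
      proof
        fix t assume t: "t \<in> U \<inter> ?V"
        then obtain v u where vu: "v \<in> V" "u \<in> U" "t = v + z * u" by (auto simp: mem_step)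
        have "v = t - z * u" using vu by simp
        then have "v \<in> U" using ideal_diff[OF subring U] is_idealD(4)[OF U zR vu(2)] t by simp
        then show "t \<in> U \<inter> V + z *o U" unfolding mem_step using vu by blast
      qed
    qed
    show ?thesis using Suc.IH[OF V1] unfolding a b[symmetric] c .
  qed
  show ?case using nz st by auto
qed simp

text \<open>If \<open>z\<close> is regular on \<open>J2/J1\<close>, then reducing \<open>0 \<rightarrow> J1/J0 \<rightarrow> J2/J0 \<rightarrow> J2/J1 \<rightarrow> 0\<close> modulo \<open>z\<close> keeps
  it exact, up to the isomorphism of this lemma.\<close>

lemma depth_ge_ses_step:
  assumes J: "is_ideal R J0" "is_ideal R J1" "is_ideal R J2" "J0 \<subseteq> J1" "J1 \<subseteq> J2"
    and z: "z \<in> m" "nzd z J2 J1"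
  shows "depth_ge m n (J1 + z *o J2) (J0 + z *o J2) \<longleftrightarrow> depth_ge m n J1 (J0 + z *o J1)"
proof -
  have zR: "z \<in> R" using m_subset z(1) .
  let ?V = "J0 + z *o J2"
  have V: "is_ideal R ?V" using plus_ideal[OF J(1) smult_ideal[OF zR J(3)]] .
  have a: "J1 + z *o J2 = J1 + ?V"
  proof
    show "J1 + z *o J2 \<subseteq> J1 + ?V"
      by (intro set_plus_mono2 subset_plus(2)[OF J(1) smult_ideal[OF zR J(3)]]) auto
    have 1: "is_ideal R (J1 + z *o J2)" using plus_ideal[OF J(2) smult_ideal[OF zR J(3)]] .
    have 2: "J1 \<subseteq> J1 + z *o J2" "z *o J2 \<subseteq> J1 + z *o J2"
      using subset_plus[OF J(2) smult_ideal[OF zR J(3)]] by auto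
    show "J1 + ?V \<subseteq> J1 + z *o J2"
      by (intro plus_subset[OF 1] 2 subset_trans[OF J(4)])
  qed
  have b: "J0 + z *o J1 = J1 \<inter> ?V"
  proof
    show "J0 + z *o J1 \<subseteq> J1 \<inter> ?V"
    proof
      fix t assume "t \<in> J0 + z *o J1"
      then obtain b a where ba: "b \<in> J0" "a \<in> J1" "t = b + z * a" unfolding mem_step by blast
      have "t \<in> J1" unfolding ba(3)
        using is_idealD(3)[OF J(2)] is_idealD(4)[OF J(2) zR ba(2)] ba(1) J(4) by blast
      moreover have "t \<in> ?V" using mem_stepI[OF ba(1) _ ba(3)] ba(2) J(5) by blast
      ultimately show "t \<in> J1 \<inter> ?V" by blast
    qed
    show "J1 \<inter> ?V \<subseteq> J0 + z *o J1"
    proof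
      fix t assume t: "t \<in> J1 \<inter> ?V"
      then obtain v u where vu: "v \<in> J0" "u \<in> J2" "t = v + z * u" by (auto simp: mem_step)
      have "z * u = t - v" using vu by simp
      then have "z * u \<in> J1" using ideal_diff[OF subring J(2)] t vu(1) J(4) by auto
      then have "u \<in> J1" using nzdD[OF z(2) vu(2)] by blast
      then show "t \<in> J0 + z *o J1" unfolding mem_step using vu by blast
    qed
  qed
  show ?thesis unfolding a b by (rule depth_ge_second_iso[OF J(2) V])
qed

section \<open>The depth lemma for short exact sequences\<close>

lemma nzd_trans:
  assumes "J1 \<subseteq> J2" "nzd z J1 J0" "nzd z J2 J1" "J0 \<subseteq> J1" shows "nzd z J2 J0"
  unfolding nzd_def using nzdD[OF assms(2)] nzdD[OF assms(3)] assms(4) by (meson subsetD)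

lemma nzd_sub: "J1 \<subseteq> J2 \<Longrightarrow> nzd z J2 J0 \<Longrightarrow> nzd z J1 J0"
  unfolding nzd_def by blast

lemma ses_step_ideals:
  assumes "is_ideal R J0" "is_ideal R J1" "is_ideal R J2" "J0 \<subseteq> J1" "J1 \<subseteq> J2" "z \<in> m"
  shows "is_ideal R (J0 + z *o J2)" "is_ideal R (J1 + z *o J2)" "J0 + z *o J2 \<subseteq> J1 + z *o J2"
    "J1 + z *o J2 \<subseteq> J2"
proof -
  have J: "is_ideal R (z *o J2)" "z *o J2 \<subseteq> J2"
    using smult_ideal smult_subset assms m_subset by auto
  show "is_ideal R (J0 + z *o J2)" "is_ideal R (J1 + z *o J2)" using plus_ideal assms J by auto
  show "J0 + z *o J2 \<subseteq> J1 + z *o J2" using assms(4) by (auto simp: set_plus_def)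
  show "J1 + z *o J2 \<subseteq> J2" using plus_subset assms J by auto
qed

text \<open>An element regular on both ends is regular in the middle, and dividing by it keeps the
  sequence exact.\<close>

lemma depth_ge_middle:
  assumes "is_ideal R J0" "is_ideal R J1" "is_ideal R J2" "J0 \<subseteq> J1" "J1 \<subseteq> J2"
    "depth_ge m n J1 J0" "depth_ge m n J2 J1"
  shows "depth_ge m n J2 J0"
  using assms
proof (induction n arbitrary: J0 J1)
  case (Suc n)
  note I = Suc.prems(1-5)
  have sub: "subquotient J1 J0" "subquotient J2 J1" using I by (auto simp: subquotient_def)
  note sf = depth_ge_socle_free[OF Suc.prems(6)] depth_ge_socle_free[OF Suc.prems(7)]
  obtain z where z: "z \<in> m" "nzd z J1 J0" "nzd z J2 J1"
    using common_nzd_of[OF sub(1) sf(1) sub(2) sf(2) sub(2) sf(2)] by blast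
  have "depth_ge m n J2 (J0 + z *o J2)"
  proof (rule Suc.IH[OF ses_step_ideals(1,2)[OF I z(1)] I(3) ses_step_ideals(3,4)[OF I z(1)]])
    show "depth_ge m n (J1 + z *o J2) (J0 + z *o J2)"
      unfolding depth_ge_ses_step[OF I z(1,3)] using depth_ge_quotient[OF sub(1) z(1,2) Suc.prems(6)] .
    show "depth_ge m n J2 (J1 + z *o J2)" using depth_ge_quotient[OF sub(2) z(1,3) Suc.prems(7)] .
  qed
  then show ?case using z(1) nzd_trans[OF I(5) z(2,3) I(4)] by auto
qed simp

text \<open>The submodule may gain one over the quotient: its first regular element is inherited
  from J2/J0, which is the base case.\<close>

lemma depth_ge_left:
  assumes "is_ideal R J0" "is_ideal R J1" "is_ideal R J2" "J0 \<subseteq> J1" "J1 \<subseteq> J2"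
    "depth_ge m (Suc n) J2 J0" "depth_ge m n J2 J1"
  shows "depth_ge m (Suc n) J1 J0"
  using assms
proof (induction n arbitrary: J0 J1)
  case 0
  then obtain z where z: "z \<in> m" "nzd z J2 J0" by auto
  then show ?case using nzd_sub[OF 0(5)] by auto
next
  case (Suc n)
  note I = Suc.prems(1-5)
  have sub: "subquotient J2 J0" "subquotient J2 J1" "subquotient J1 J0" using I by (auto simp: subquotient_def)
  note sf = depth_ge_socle_free[OF Suc.prems(6)] depth_ge_socle_free[OF Suc.prems(7)]
  obtain z where z: "z \<in> m" "nzd z J2 J0" "nzd z J2 J1"
    using common_nzd_of[OF sub(1) sf(1) sub(2) sf(2) sub(2) sf(2)] by blast
  have "depth_ge m (Suc n) (J1 + z *o J2) (J0 + z *o J2)"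
  proof (rule Suc.IH[OF ses_step_ideals(1,2)[OF I z(1)] I(3) ses_step_ideals(3,4)[OF I z(1)]])
    show "depth_ge m (Suc n) J2 (J0 + z *o J2)" using depth_ge_quotient[OF sub(1) z(1,2) Suc.prems(6)] .
    show "depth_ge m n J2 (J1 + z *o J2)" using depth_ge_quotient[OF sub(2) z(1,3) Suc.prems(7)] .
  qed
  then have "depth_ge m (Suc n) J1 (J0 + z *o J1)" unfolding depth_ge_ses_step[OF I z(1,3)] .
  then show ?case using z(1) nzd_sub[OF I(5) z(2)] depth_ge.simps(2) by blast
qed

lemma depth_ge_right:
  assumes "is_ideal R J0" "is_ideal R J1" "is_ideal R J2" "J0 \<subseteq> J1" "J1 \<subseteq> J2"
    "depth_ge m (Suc n) J1 J0" "depth_ge m n J2 J0"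
  shows "depth_ge m n J2 J1"
  using assms
proof (induction n arbitrary: J0 J1)
  case (Suc n)
  note I = Suc.prems(1-5)
  have sub: "subquotient J2 J0" "subquotient J2 J1" "subquotient J1 J0" using I by (auto simp: subquotient_def)
  note sf = depth_ge_socle_free[OF Suc.prems(6)] depth_ge_socle_free[OF Suc.prems(7)]
  obtain x where x: "x \<in> m" "nzd x J1 J0" "nzd x J2 J0"
    using common_nzd_of[OF sub(3) sf(1) sub(1) sf(2) sub(1) sf(2)] by blast
  have xR: "x \<in> R" using m_subset x(1) .
  have sfx: "socle_free J1 (J0 + x *o J1)"
    using depth_ge_socle_free[OF depth_ge_quotient[OF sub(3) x(1,2) Suc.prems(6)]] .
  \<comment> \<open>Regularity on J2/J1 is extracted from the depth of J1/J0, which is at least two: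
    if m kills c modulo J1, then x c is a socle element of J1/(J0 + x J1), hence zero there, and
    cancelling x puts c into J1.\<close>
  have sf1: "socle_free J2 J1" unfolding socle_free_def
  proof (intro ballI impI)
    fix c assume c: "c \<in> J2" "\<forall>r\<in>m. r * c \<in> J1"
    have xc: "x * c \<in> J1" using c x(1) by blast
    have "x * c \<in> J0 + x *o J1"
    proof (rule sfx[unfolded socle_free_def, rule_format, OF xc])
      fix r assume "r \<in> m"
      then show "r * (x * c) \<in> J0 + x *o J1" using c(2) is_idealD(2)[OF I(1)]
        by (intro mem_stepI[of 0 _ "r * c"]) (auto simp: algebra_simps)
    qed
    then obtain j a where ja: "j \<in> J0" "a \<in> J1" "x * c = j + x * a" unfolding mem_step by blast
    have "x * (c - a) \<in> J0" using ja by (simp add: algebra_simps)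
    moreover have "c - a \<in> J2" using ideal_diff[OF subring I(3) c(1)] ja(2) I(5) by blast
    ultimately have "c - a \<in> J1" using nzdD[OF x(3)] I(4) by blast
    then show "c \<in> J1" using is_idealD(3)[OF I(2) _ ja(2)] by fastforce
  qed
  obtain z where z: "z \<in> m" "nzd z J1 J0" "nzd z J2 J0" "nzd z J2 J1"
    using common_nzd_of[OF sub(3) sf(1) sub(1) sf(2) sub(2) sf1] by blast
  have "depth_ge m n J2 (J1 + z *o J2)"
  proof (rule Suc.IH[OF ses_step_ideals(1,2)[OF I z(1)] I(3) ses_step_ideals(3,4)[OF I z(1)]])
    show "depth_ge m (Suc n) (J1 + z *o J2) (J0 + z *o J2)"
      unfolding depth_ge_ses_step[OF I z(1,4)] using depth_ge_quotient[OF sub(3) z(1,2) Suc.prems(6)] .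
    show "depth_ge m n J2 (J0 + z *o J2)" using depth_ge_quotient[OF sub(1) z(1,3) Suc.prems(7)] .
  qed
  then show ?case using z by auto
qed simp

text \<open>The kernel of the localisation at the multiplicative set \<open>1 + m\<close>, modulo \<open>J\<close>; it replaces the
  passage to the local ring.\<close>

definition sat :: "'a set \<Rightarrow> 'a set" where
  "sat J = {a \<in> R. \<exists>y\<in>m. (1 - y) * a \<in> J}"

lemma one_minus_mult: "y \<in> m \<Longrightarrow> y' \<in> m \<Longrightarrow> \<exists>w\<in>m. (1 - y) * (1 - y') = 1 - w"
proof -
  assume y: "y \<in> m" "y' \<in> m"
  have "y + y' - y * y' \<in> m"
    using ideal_diff[OF subring m is_idealD(3)[OF m y] is_idealD(4)[OF m m_subset[OF y(1)] y(2)]] .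
  then show ?thesis by (intro bexI[of _ "y + y' - y * y'"]) (auto simp: algebra_simps)
qed

lemma one_minus_closed: "y \<in> m \<Longrightarrow> 1 - y \<in> R"
  using R_closed(1,6) m_subset by blast

lemma sat_ideal: assumes "is_ideal R J" shows "is_ideal R (sat J)"
  unfolding is_ideal_def
proof (intro conjI ballI)
  show "sat J \<subseteq> R" by (auto simp: sat_def)
  show "0 \<in> sat J" using is_idealD(2)[OF m] is_idealD(2)[OF assms] R_closed(2) by (auto simp: sat_def)
  fix a assume "a \<in> sat J"
  then obtain y where a: "a \<in> R" "y \<in> m" "(1 - y) * a \<in> J" by (auto simp: sat_def)
  { fix b assume "b \<in> sat J"
    then obtain y' where b: "b \<in> R" "y' \<in> m" "(1 - y') * b \<in> J" by (auto simp: sat_def)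
    obtain w where w: "w \<in> m" "(1 - y) * (1 - y') = 1 - w" using one_minus_mult[OF a(2) b(2)] by blast
    have "(1 - w) * (a + b) = (1 - y') * ((1 - y) * a) + (1 - y) * ((1 - y') * b)"
      unfolding w(2)[symmetric] by (simp add: algebra_simps)
    also have "\<dots> \<in> J" using is_idealD(3,4)[OF assms] a b one_minus_closed by blast
    finally show "a + b \<in> sat J" using w(1) a(1) b(1) R_closed(3) by (auto simp: sat_def) }
  fix r assume r: "r \<in> R"
  have "(1 - y) * (r * a) \<in> J" using is_idealD(4)[OF assms r a(3)] by (simp add: algebra_simps)
  then show "r * a \<in> sat J" using a r R_closed(4) by (auto simp: sat_def)
qed

lemma sat_superset: assumes "is_ideal R J" shows "J \<subseteq> sat J"
  unfolding sat_def using is_idealD(1)[OF assms] is_idealD(2)[OF m] by force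

lemma sat_sat: assumes "a \<in> R" "y \<in> m" "(1 - y) * a \<in> sat J" shows "a \<in> sat J"
proof -
  obtain y' where y': "y' \<in> m" "(1 - y') * ((1 - y) * a) \<in> J" using assms(3) by (auto simp: sat_def)
  obtain w where w: "w \<in> m" "(1 - y') * (1 - y) = 1 - w" using one_minus_mult[OF y'(1) assms(2)] by blast
  show ?thesis using y'(2) w assms(1) by (auto simp: sat_def mult.assoc[symmetric])
qed

lemma sat_subset_sat:
  assumes "I \<subseteq> sat K" shows "sat I \<subseteq> sat K"
proof
  fix a assume "a \<in> sat I"
  then obtain y where "a \<in> R" "y \<in> m" "(1 - y) * a \<in> I" unfolding sat_def by blast
  then show "a \<in> sat K" using sat_sat assms by blast
qed

lemma nzd_sat:
  assumes "nzd x J J'" "is_ideal R J" "a \<in> J" "x * a \<in> sat J'" shows "a \<in> sat J'"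
proof -
  obtain y where y: "y \<in> m" "(1 - y) * (x * a) \<in> J'" using assms(4) by (auto simp: sat_def)
  have "(1 - y) * a \<in> J" using is_idealD(4)[OF assms(2) one_minus_closed[OF y(1)] assms(3)] .
  then have "(1 - y) * a \<in> J'" using nzdD[OF assms(1)] y(2) by (simp add: algebra_simps)
  then show ?thesis using y(1) assms(3) is_idealD(1)[OF assms(2)] by (auto simp: sat_def)
qed

text \<open>The classical bound depth M <= dim R/P for a prime P killing a nonzero element: each
  member x of a regular sequence gives a prime annihilator in M/xM that contains P and x, while x
  lies outside P. Working modulo \<open>sat\<close> plays the part of localising.\<close>

theorem prime_chain_of_depth:
  assumes "depth_ge m n J J'" "subquotient J J'" "is_prime_ideal R P"
    "a \<in> J" "a \<notin> sat J'" "\<And>p. p \<in> P \<Longrightarrow> p * a \<in> sat J'"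
  shows "\<exists>Q. Q 0 = P \<and> (\<forall>i\<le>n. is_prime_ideal R (Q i)) \<and> (\<forall>i<n. Q i \<subset> Q (Suc i))"
  using assms
proof (induction n arbitrary: J' P a)
  case 0
  then show ?case by (intro exI[of _ "\<lambda>i. P"]) auto
next
  case (Suc n)
  have J: "is_ideal R J" and J': "is_ideal R J'" "J' \<subseteq> J"
    using Suc.prems(2) by (auto simp: subquotient_def)
  have JR: "u \<in> R" if "u \<in> J" for u using that is_idealD(1)[OF J] by blast
  have PR: "p \<in> R" if "p \<in> P" for p using that is_idealD(1)[OF is_prime_idealD(1)[OF Suc.prems(3)]] by blast
  obtain x where x: "x \<in> m" "nzd x J J'" and d: "depth_ge m n J (J' + x *o J)"
    using Suc.prems(1) by auto
  have xR: "x \<in> R" using m_subset x(1) .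
  \<comment> \<open>The nonzero elements killed by P. One generating a maximal submodule is not
    divisible by x and so survives in M/xM.\<close>
  define N where "N = {b \<in> J. b \<notin> sat J' \<and> (\<forall>p\<in>P. p * b \<in> sat J')}"
  define S where "S = (\<lambda>b. sat (J' + b *o R)) ` N"
  have id: "is_ideal R (J' + b *o R)" if "b \<in> N" for b
    using that plus_ideal[OF J'(1) principal_ideal] JR by (auto simp: N_def)
  have "S \<noteq> {}" using Suc.prems(4-6) by (auto simp: S_def N_def)
  moreover have "is_ideal R I" if "I \<in> S" for I
    using that sat_ideal[OF id] by (auto simp: S_def)
  ultimately obtain I where "I \<in> S" and max: "\<forall>I'\<in>S. I \<subseteq> I' \<longrightarrow> I' = I"
    using maximal_ideal_in[of S] by blast
  then obtain b where b: "b \<in> N" and I: "I = sat (J' + b *o R)" by (auto simp: S_def)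
  have bJ: "b \<in> J" "b \<notin> sat J'" and Pb: "\<And>p. p \<in> P \<Longrightarrow> p * b \<in> sat J'" using b by (auto simp: N_def)
  define K where "K = J' + x *o J"
  have subK: "subquotient J K" unfolding K_def by (rule subquotient_step[OF Suc.prems(2) x(1)])
  have K: "is_ideal R K" "J' \<subseteq> K" using subK quotient_step(3)[OF J J' xR] by (auto simp: subquotient_def K_def)
  have satJK: "sat J' \<subseteq> sat K" using K(2) unfolding sat_def by blast
  \<comment> \<open>If b were x b1 up to a factor 1 - y, then b1 would be killed by P as well and,
    by maximality, be a multiple of b up to such a factor.\<close>
  have "b \<notin> sat K"
  proof
    assume "b \<in> sat K"
    then obtain y where y: "y \<in> m" "(1 - y) * b \<in> K" by (auto simp: sat_def)
    then obtain j b1 where j: "j \<in> J'" "b1 \<in> J" "(1 - y) * b = j + x * b1" unfolding K_def mem_step by blast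
    have yR: "1 - y \<in> R" using one_minus_closed y(1) .
    have b1s: "b1 \<notin> sat J'"
    proof
      assume "b1 \<in> sat J'"
      then have "x * b1 \<in> sat J'" using is_idealD(4)[OF sat_ideal[OF J'(1)] xR] by blast
      then have "(1 - y) * b \<in> sat J'" unfolding j(3)
        using j(1) sat_superset[OF J'(1)] is_idealD(3)[OF sat_ideal[OF J'(1)]] by blast
      then show False using sat_sat[OF JR[OF bJ(1)] y(1)] bJ(2) by blast
    qed
    moreover have "p * b1 \<in> sat J'" if p: "p \<in> P" for p
    proof (rule nzd_sat[OF x(2) J])
      show "p * b1 \<in> J" using is_idealD(4)[OF J PR[OF p] j(2)] .
      have "x * (p * b1) = p * ((1 - y) * b) - p * j" unfolding j(3) by (simp add: algebra_simps)
      also have "\<dots> = (1 - y) * (p * b) - p * j" by (simp add: algebra_simps)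
      also have "\<dots> \<in> sat J'"
        using ideal_diff[OF subring sat_ideal[OF J'(1)]] is_idealD(4)[OF sat_ideal[OF J'(1)]]
          yR Pb[OF p] PR[OF p] j(1) sat_superset[OF J'(1)] by blast
      finally show "x * (p * b1) \<in> sat J'" .
    qed
    ultimately have b1: "b1 \<in> N" using j(2) by (auto simp: N_def)
    have "J' + b *o R \<subseteq> sat (J' + b1 *o R)"
    proof (rule plus_subset[OF sat_ideal[OF id[OF b1]]])
      have sup: "J' + b1 *o R \<subseteq> sat (J' + b1 *o R)" using sat_superset[OF id[OF b1]] .
      then show "J' \<subseteq> sat (J' + b1 *o R)"
        using subset_plus(1)[OF J'(1) principal_ideal[OF JR[OF j(2)]]] by blast
      have "(1 - y) * b \<in> J' + b1 *o R" unfolding j(3) using j(1) xR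
        by (intro mem_stepI[of j _ x]) (auto simp: mult.commute)
      then have "b \<in> sat (J' + b1 *o R)" using y(1) JR[OF bJ(1)] by (auto simp: sat_def)
      then show "b *o R \<subseteq> sat (J' + b1 *o R)"
        using is_idealD(4)[OF sat_ideal[OF id[OF b1]]] by (auto simp: elt_set_times_def mult.commute)
    qed
    then have "I \<subseteq> sat (J' + b1 *o R)" unfolding I by (rule sat_subset_sat)
    then have eq: "sat (J' + b1 *o R) = I" using max b1 by (auto simp: S_def)
    have "b1 \<in> J' + b1 *o R" using is_idealD(2)[OF J'(1)] R_closed(1)
      by (intro mem_stepI[of 0 _ 1]) auto
    then have "b1 \<in> sat (J' + b *o R)" using sat_superset[OF id[OF b1]] eq unfolding I by blast
    then obtain y2 where y2: "y2 \<in> m" "(1 - y2) * b1 \<in> J' + b *o R" by (auto simp: sat_def)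
    then obtain j2 r where r: "j2 \<in> J'" "r \<in> R" "(1 - y2) * b1 = j2 + b * r" unfolding mem_step by blast
    obtain w where w: "w \<in> m" "(1 - y) * (1 - y2) = 1 - w" using one_minus_mult[OF y(1) y2(1)] by blast
    \<comment> \<open>Nakayama's lemma by hand: up to a factor b1 is a multiple of x b1, so some 1 -
      y with y in m kills it.\<close>
    have "(1 - (w + r * x)) * b1 = (1 - y) * ((1 - y2) * b1) - r * (x * b1)"
      unfolding mult.assoc[symmetric] w(2) by (simp add: algebra_simps)
    also have "\<dots> = (1 - y) * j2 + r * ((1 - y) * b - x * b1)" unfolding r(3) by (simp add: algebra_simps)
    also have "\<dots> = (1 - y) * j2 + r * j" unfolding j(3) by simp
    also have "\<dots> \<in> J'" using is_idealD(3,4)[OF J'(1)] yR r(1,2) j(1) by blast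
    finally have "(1 - (w + r * x)) * b1 \<in> J'" .
    moreover have "w + r * x \<in> m" using is_idealD(3)[OF m w(1) is_idealD(4)[OF m r(2) x(1)]] .
    ultimately have "b1 \<in> sat J'" using JR[OF j(2)] by (auto simp: sat_def)
    then show False using b1s by blast
  qed
  then obtain r where r: "r \<in> R" "r * b \<notin> sat K" and prime: "is_prime_ideal R (colon R (sat K) (r * b))"
    using exists_prime_colon[OF sat_ideal[OF K(1)] JR[OF bJ(1)]] by blast
  let ?P = "colon R (sat K) (r * b)"
  have rb: "r * b \<in> J" using is_idealD(4)[OF J r(1) bJ(1)] .
  obtain Q where Q: "Q 0 = ?P" "\<forall>i\<le>n. is_prime_ideal R (Q i)" "\<forall>i<n. Q i \<subset> Q (Suc i)"
    using Suc.IH[OF d[folded K_def] subK prime rb r(2)] by (auto simp: colon_def)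
  have "P \<subseteq> ?P"
  proof
    fix p assume p: "p \<in> P"
    have "p * (r * b) = r * (p * b)" by (simp add: algebra_simps)
    also have "\<dots> \<in> sat K" using is_idealD(4)[OF sat_ideal[OF K(1)] r(1)] Pb[OF p] satJK by blast
    finally show "p \<in> ?P" using PR[OF p] by (simp add: colon_def)
  qed
  moreover have "x \<in> ?P"
  proof -
    have "x * (r * b) \<in> K" unfolding K_def using is_idealD(2)[OF J'(1)] rb
      by (intro mem_stepI[of 0 _ "r * b"]) auto
    then show ?thesis using xR sat_superset[OF K(1)] by (auto simp: colon_def)
  qed
  moreover have "x \<notin> P" using nzd_sat[OF x(2) J Suc.prems(4)] Suc.prems(5,6) by blast
  ultimately have "P \<subset> ?P" by blast
  then have "\<forall>i<Suc n. (case i of 0 \<Rightarrow> P | Suc k \<Rightarrow> Q k) \<subset> Q i"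
    using Q(1,3) by (auto split: nat.split)
  then show ?case using Q(2) Suc.prems(3)
    by (intro exI[of _ "\<lambda>i. case i of 0 \<Rightarrow> P | Suc k \<Rightarrow> Q k"]) (auto split: nat.split)
qed

end

section \<open>Monomial ideals in affine semigroup rings\<close>

lemma realv_add: "realv (a + b) = realv a + realv b"
  and realv_diff: "realv (a - b) = realv a - realv b"
  and realv_zero [simp]: "realv 0 = 0"
  and realv_smult: "realv (k *s a) = real_of_int k *\<^sub>R realv a"
  and realv_inj: "realv a = realv b \<longleftrightarrow> a = b"
  by (auto simp: realv_def vec_eq_iff)

section \<open>Coefficients and spans of monomials in the group ring\<close>

lemma sum_singles: "(\<Sum>a\<in>Poly_Mapping.keys f. Poly_Mapping.single a (Poly_Mapping.lookup f a)) = f"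
proof (rule poly_mapping_eqI)
  fix k
  have "(\<Sum>a\<in>Poly_Mapping.keys f. Poly_Mapping.lookup (Poly_Mapping.single a (Poly_Mapping.lookup f a)) k)
    = (\<Sum>a\<in>Poly_Mapping.keys f. if a = k then Poly_Mapping.lookup f k else 0)"
    by (intro sum.cong) (auto simp: lookup_single when_def)
  then show "Poly_Mapping.lookup (\<Sum>a\<in>Poly_Mapping.keys f. Poly_Mapping.single a (Poly_Mapping.lookup f a)) k
    = Poly_Mapping.lookup f k"
    by (simp add: lookup_sum sum.delta in_keys_iff)
qed

lemma zero_if_keys_empty: "Poly_Mapping.keys (f :: 'a \<Rightarrow>\<^sub>0 'b::comm_monoid_add) = {} \<Longrightarrow> f = 0"
  using sum_singles[of f] by simp

lemma lookup_single_times: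
  fixes g :: "('a::ab_group_add) \<Rightarrow>\<^sub>0 ('b::comm_ring_1)"
  shows "Poly_Mapping.lookup (Poly_Mapping.single a v * g) s = v * Poly_Mapping.lookup g (s - a)"
proof -
  have "Poly_Mapping.single a v * g =
      (\<Sum>b\<in>Poly_Mapping.keys g. Poly_Mapping.single (a + b) (v * Poly_Mapping.lookup g b))"
    by (subst (1) sum_singles[symmetric]) (simp add: sum_distrib_left mult_single)
  then have "Poly_Mapping.lookup (Poly_Mapping.single a v * g) s =
     (\<Sum>b\<in>Poly_Mapping.keys g. Poly_Mapping.lookup (Poly_Mapping.single (a + b) (v * Poly_Mapping.lookup g b)) s)"
    by (simp add: lookup_sum)
  also have "\<dots> = (\<Sum>b\<in>Poly_Mapping.keys g. if b = s - a then v * Poly_Mapping.lookup g (s - a) else 0)"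
  proof (intro sum.cong refl)
    fix b
    have "a + b = s \<longleftrightarrow> b = s - a" by (auto simp: algebra_simps)
    then show "Poly_Mapping.lookup (Poly_Mapping.single (a + b) (v * Poly_Mapping.lookup g b)) s
      = (if b = s - a then v * Poly_Mapping.lookup g (s - a) else 0)"
      by (simp add: lookup_single when_def)
  qed
  finally show ?thesis by (simp add: in_keys_iff)
qed

lemma lookup_times:
  fixes f g :: "('a::ab_group_add) \<Rightarrow>\<^sub>0 ('b::comm_ring_1)"
  shows "Poly_Mapping.lookup (f * g) s =
    (\<Sum>a\<in>Poly_Mapping.keys f. Poly_Mapping.lookup f a * Poly_Mapping.lookup g (s - a))"
proof -
  have "(\<Sum>a\<in>Poly_Mapping.keys f. Poly_Mapping.single a (Poly_Mapping.lookup f a) * g) = f * g"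
    unfolding sum_distrib_right[symmetric] sum_singles ..
  then have "Poly_Mapping.lookup (f * g) s = (\<Sum>a\<in>Poly_Mapping.keys f.
      Poly_Mapping.lookup (Poly_Mapping.single a (Poly_Mapping.lookup f a) * g) s)"
    by (metis lookup_sum)
  then show ?thesis by (simp only: lookup_single_times)
qed

lemma monom_times_single: "monom c * Poly_Mapping.single d v = Poly_Mapping.single (c + d) (v::'k::field)"
  by (simp add: monom_def mult_single)

text \<open>From here on \<open>semigroup_ring U\<close> serves for every set U of exponents, where
  it is the K-span of the monomials x^u with u in U.\<close>

lemma mem_semigroup_ring: "f \<in> semigroup_ring U \<longleftrightarrow> Poly_Mapping.keys f \<subseteq> U"
  by (simp add: semigroup_ring_def)

lemma single_mem: "Poly_Mapping.single c v \<in> semigroup_ring U \<longleftrightarrow> c \<in> U \<or> (v::'k::field) = 0"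
  by (simp add: mem_semigroup_ring)

lemma monom_mem: "(monom c :: _ \<Rightarrow>\<^sub>0 'k::field) \<in> semigroup_ring U \<longleftrightarrow> c \<in> U"
  by (simp add: monom_def single_mem)

lemma semigroup_ring_mono: "U \<subseteq> V \<Longrightarrow> semigroup_ring U \<subseteq> semigroup_ring V"
  by (auto simp: mem_semigroup_ring)

lemma semigroup_ring_subset_iff:
  "(semigroup_ring U :: (_ \<Rightarrow>\<^sub>0 'k::field) set) \<subseteq> semigroup_ring V \<longleftrightarrow> U \<subseteq> V"
proof
  assume sub: "(semigroup_ring U :: (_ \<Rightarrow>\<^sub>0 'k::field) set) \<subseteq> semigroup_ring V"
  show "U \<subseteq> V"
  proof
    fix c assume "c \<in> U"
    then have "(monom c :: _ \<Rightarrow>\<^sub>0 'k) \<in> semigroup_ring U" by (simp only: monom_mem)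
    then have "(monom c :: _ \<Rightarrow>\<^sub>0 'k) \<in> semigroup_ring V" using sub by blast
    then show "c \<in> V" by (simp add: monom_mem)
  qed
qed (rule semigroup_ring_mono)

lemma semigroup_ring_psubset_iff:
  "(semigroup_ring U :: (_ \<Rightarrow>\<^sub>0 'k::field) set) \<subset> semigroup_ring V \<longleftrightarrow> U \<subset> V"
  by (simp add: less_le_not_le semigroup_ring_subset_iff)

lemma semigroup_ring_add: "f \<in> semigroup_ring U \<Longrightarrow> g \<in> semigroup_ring U \<Longrightarrow> f + g \<in> semigroup_ring U"
  using keys_add[of f g] by (auto simp: mem_semigroup_ring)

lemma semigroup_ring_0: "0 \<in> semigroup_ring U"
  by (simp add: mem_semigroup_ring)

lemma semigroup_ring_sum: "(\<And>x. x \<in> A \<Longrightarrow> f x \<in> semigroup_ring U) \<Longrightarrow> sum f A \<in> semigroup_ring U"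
  by (induction A rule: infinite_finite_induct) (auto simp: semigroup_ring_0 semigroup_ring_add)

lemma semigroup_ring_mult:
  assumes "f \<in> semigroup_ring U" "g \<in> semigroup_ring V" "\<And>u v. u \<in> U \<Longrightarrow> v \<in> V \<Longrightarrow> u + v \<in> W"
  shows "f * g \<in> semigroup_ring W"
  using keys_mult[of f g] assms by (fastforce simp: mem_semigroup_ring)

lemma semigroup_ring_plus:
  "semigroup_ring U + semigroup_ring V = (semigroup_ring (U \<union> V) :: (_ \<Rightarrow>\<^sub>0 'k::field) set)"
proof
  show "semigroup_ring U + semigroup_ring V \<subseteq> (semigroup_ring (U \<union> V) :: (_ \<Rightarrow>\<^sub>0 'k::field) set)"
    using semigroup_ring_mono[of U "U \<union> V"] semigroup_ring_mono[of V "U \<union> V"]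
    by (auto simp: set_plus_def intro!: semigroup_ring_add)
  show "semigroup_ring (U \<union> V) \<subseteq> semigroup_ring U + (semigroup_ring V :: (_ \<Rightarrow>\<^sub>0 'k::field) set)"
  proof
    fix f :: "_ \<Rightarrow>\<^sub>0 'k" assume f: "f \<in> semigroup_ring (U \<union> V)"
    let ?s = "\<lambda>a. Poly_Mapping.single a (Poly_Mapping.lookup f a)"
    have "f = (\<Sum>a\<in>Poly_Mapping.keys f \<inter> U. ?s a) + (\<Sum>a\<in>Poly_Mapping.keys f - U. ?s a)"
      using sum.Int_Diff[of "Poly_Mapping.keys f" ?s U] sum_singles[of f] by simp
    moreover have "(\<Sum>a\<in>Poly_Mapping.keys f \<inter> U. ?s a) \<in> semigroup_ring U"
      by (rule semigroup_ring_sum) (simp add: single_mem)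
    moreover have "(\<Sum>a\<in>Poly_Mapping.keys f - U. ?s a) \<in> semigroup_ring V"
      using f by (intro semigroup_ring_sum) (auto simp: single_mem mem_semigroup_ring)
    ultimately show "f \<in> semigroup_ring U + semigroup_ring V" by (auto simp: set_plus_def)
  qed
qed

lemma semigroup_ring_Int: "semigroup_ring U \<inter> semigroup_ring V = semigroup_ring (U \<inter> V)"
  by (auto simp: mem_semigroup_ring)

lemma monom_smult:
  "monom g *o (semigroup_ring U) = (semigroup_ring ((+) g ` U) :: (_ \<Rightarrow>\<^sub>0 'k::field) set)"
proof
  show "monom g *o (semigroup_ring U) \<subseteq> (semigroup_ring ((+) g ` U) :: (_ \<Rightarrow>\<^sub>0 'k::field) set)"
    by (auto simp: elt_set_times_def intro!: semigroup_ring_mult[of _ "{g}"] simp: monom_mem)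
  show "semigroup_ring ((+) g ` U) \<subseteq> monom g *o (semigroup_ring U :: (_ \<Rightarrow>\<^sub>0 'k::field) set)"
  proof
    fix f :: "_ \<Rightarrow>\<^sub>0 'k" assume f: "f \<in> semigroup_ring ((+) g ` U)"
    let ?h = "\<Sum>a\<in>Poly_Mapping.keys f. Poly_Mapping.single (a - g) (Poly_Mapping.lookup f a)"
    have "?h \<in> semigroup_ring U"
      using f by (intro semigroup_ring_sum) (auto simp: single_mem mem_semigroup_ring)
    then have "monom g * ?h \<in> monom g *o semigroup_ring U" by (rule set_times_intro2)
    then show "f \<in> monom g *o semigroup_ring U"
      by (simp add: sum_distrib_left monom_times_single sum_singles)
  qed
qed

section \<open>Affine semigroup rings are Noetherian\<close>

lemma adjoin_least:
  assumes "is_subring S" "A \<subseteq> S" "x \<in> S" shows "adjoin A x \<subseteq> S"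
proof
  fix f assume "f \<in> adjoin A x"
  then obtain n c where c: "\<forall>i. c i \<in> A" "f = (\<Sum>i\<le>n. c i * x ^ i)" by (auto simp: adjoin_def)
  show "f \<in> S" unfolding c(2)
    by (intro is_subringD(8)[OF assms(1)] is_subringD(4)[OF assms(1)] is_subringD(7)[OF assms(1)])
      (use assms c in auto)
qed

lemma subring_semigroup_ring:
  assumes "0 \<in> C" "\<And>a b. a \<in> C \<Longrightarrow> b \<in> C \<Longrightarrow> a + b \<in> C"
  shows "is_subring (semigroup_ring C :: (_ \<Rightarrow>\<^sub>0 'k::field) set)"
  unfolding is_subring_def
proof (intro conjI ballI)
  show "1 \<in> (semigroup_ring C :: (_ \<Rightarrow>\<^sub>0 'k::field) set)" using assms(1) by (simp add: mem_semigroup_ring)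
  fix f g :: "_ \<Rightarrow>\<^sub>0 'k::field" assume f: "f \<in> semigroup_ring C"
  then show "- f \<in> semigroup_ring C" by (simp add: mem_semigroup_ring in_keys_iff subset_iff)
  assume g: "g \<in> semigroup_ring C"
  show "f + g \<in> semigroup_ring C" using semigroup_ring_add f g .
  show "f * g \<in> semigroup_ring C" using semigroup_ring_mult[OF f g] assms(2) by blast
qed

definition sg_gen :: "(int^'n) set \<Rightarrow> (int^'n) set" where
  "sg_gen G = {(\<Sum>g\<in>G. int (k g) *s g) | k. True}"

lemma sg_gen_0: "0 \<in> sg_gen G"
  unfolding sg_gen_def by (auto intro!: exI[of _ "\<lambda>_. 0"])

lemma sg_gen_mem:
  assumes "finite G" "g \<in> G" shows "g \<in> sg_gen G"
proof -
  have "g = (\<Sum>g'\<in>G. int (if g' = g then 1 else 0) *s g')"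
    by (subst sum.remove[OF assms]) (auto intro!: sum.neutral)
  then show ?thesis unfolding sg_gen_def mem_Collect_eq
    by (intro exI[of _ "\<lambda>g'. if g' = g then 1 else 0"]) simp
qed

lemma sg_gen_add: assumes "a \<in> sg_gen G" "b \<in> sg_gen G" shows "a + b \<in> sg_gen G"
proof -
  obtain k l where "a = (\<Sum>g\<in>G. int (k g) *s g)" "b = (\<Sum>g\<in>G. int (l g) *s g)"
    using assms by (auto simp: sg_gen_def)
  then have "a + b = (\<Sum>g\<in>G. int (k g + l g) *s g)"
    by (simp add: sum.distrib[symmetric] vector_sadd_rdistrib)
  then show ?thesis unfolding sg_gen_def by (auto intro!: exI[of _ "\<lambda>g. k g + l g"])
qed

lemma sg_gen_insert:
  assumes "finite G" "x \<notin> G"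
  shows "sg_gen (insert x G) = {c + int n *s x | c n. c \<in> sg_gen G}"
proof
  show "sg_gen (insert x G) \<subseteq> {c + int n *s x | c n. c \<in> sg_gen G}"
  proof
    fix u assume "u \<in> sg_gen (insert x G)"
    then obtain k where "u = (\<Sum>g\<in>insert x G. int (k g) *s g)" by (auto simp: sg_gen_def)
    then have "u = (\<Sum>g\<in>G. int (k g) *s g) + int (k x) *s x" using assms by (simp add: add.commute)
    moreover have "(\<Sum>g\<in>G. int (k g) *s g) \<in> sg_gen G" by (auto simp: sg_gen_def)
    ultimately show "u \<in> {c + int n *s x | c n. c \<in> sg_gen G}" by blast
  qed
  show "{c + int n *s x | c n. c \<in> sg_gen G} \<subseteq> sg_gen (insert x G)"
  proof
    fix u assume "u \<in> {c + int n *s x | c n. c \<in> sg_gen G}"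
    then obtain k n where u: "u = (\<Sum>g\<in>G. int (k g) *s g) + int n *s x" by (auto simp: sg_gen_def)
    have "(\<Sum>g\<in>insert x G. int ((k(x := n)) g) *s g) = u"
      unfolding u using assms by (simp add: add.commute) (intro sum.cong, auto)
    then show "u \<in> sg_gen (insert x G)" unfolding sg_gen_def by blast
  qed
qed

lemma monom_power: "(monom x :: _ \<Rightarrow>\<^sub>0 'k::field) ^ n = monom (int n *s x)"
proof (induction n)
  case (Suc n)
  have "x + int n *s x = int (Suc n) *s x" by (simp add: vec_eq_iff algebra_simps)
  moreover have "(monom x :: _ \<Rightarrow>\<^sub>0 'k::field) ^ Suc n = monom x * monom (int n *s x)" by (simp add: Suc)
  moreover have "(monom x :: _ \<Rightarrow>\<^sub>0 'k::field) * monom (int n *s x) = monom (x + int n *s x)"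
    by (simp add: monom_def mult_single)
  ultimately show ?case by simp
qed (simp add: monom_def)

text \<open>\<open>semigroup_ring {0}\<close> is a copy of the field, whose only ideals are zero and
  the whole ring.\<close>

lemma acc_constants: "ideal_acc (semigroup_ring {0} :: (_ \<Rightarrow>\<^sub>0 'k::field) set)"
  unfolding ideal_acc_def
proof (intro allI impI)
  fix I :: "nat \<Rightarrow> (int^'n \<Rightarrow>\<^sub>0 'k) set"
  assume I: "\<forall>n. is_ideal (semigroup_ring {0}) (I n) \<and> I n \<subseteq> I (Suc n)"
  have mono: "I j \<subseteq> I k" if "j \<le> k" for j k using that I lift_Suc_mono_le by metis
  have full: "I n = semigroup_ring {0}" if "f \<in> I n" "f \<noteq> 0" for n f
  proof -
    have n: "is_ideal (semigroup_ring {0}) (I n)" using I by blast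
    have "f \<in> semigroup_ring {0}" using is_idealD(1)[OF n] that by blast
    then have keys: "Poly_Mapping.keys f = {0}"
      using that(2) zero_if_keys_empty[of f] unfolding mem_semigroup_ring by (metis subset_singletonD)
    then have f: "f = Poly_Mapping.single 0 (Poly_Mapping.lookup f 0)" using sum_singles[of f] by simp
    have nz: "Poly_Mapping.lookup f 0 \<noteq> 0" using keys by (simp add: in_keys_iff[symmetric])
    have "Poly_Mapping.single 0 (inverse (Poly_Mapping.lookup f 0)) * f \<in> I n"
      using is_idealD(4)[OF n _ that(1)] by (simp add: single_mem)
    then have "1 \<in> I n" by (subst (asm) (2) f) (simp add: mult_single nz)
    then have "r \<in> I n" if "r \<in> semigroup_ring {0}" for r using is_idealD(4)[OF n that] by fastforce
    then show ?thesis using is_idealD(1)[OF n] by blast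
  qed
  show "\<exists>N. \<forall>n\<ge>N. I n = I N"
  proof (cases "\<exists>N. \<exists>f\<in>I N. f \<noteq> 0")
    case True
    then obtain N f where f: "f \<in> I N" "f \<noteq> 0" by blast
    then have "I n = I N" if "n \<ge> N" for n using full[OF f] full[of f n] mono[OF that] f by blast
    then show ?thesis by blast
  next
    case False
    then have "I n = {0}" for n using is_idealD(2) I by blast
    then show ?thesis by blast
  qed
qed

text \<open>Each further generator of the semigroup adjoins one monomial, in general with relations;
  \<open>adjoin_acc\<close> covers that case.\<close>

lemma acc_semigroup_ring:
  assumes "finite G"
  shows "ideal_acc (semigroup_ring (sg_gen G) :: ((int^'n) \<Rightarrow>\<^sub>0 'k::field) set)"
  using assms
proof (induction G rule: finite_induct)
  case empty
  have "sg_gen {} = {0 :: int^'n}" by (auto simp: sg_gen_def)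
  then show ?case using acc_constants by simp
next
  case (insert x G)
  let ?A = "semigroup_ring (sg_gen G) :: ((int^'n) \<Rightarrow>\<^sub>0 'k) set"
  let ?B = "semigroup_ring (sg_gen (insert x G)) :: ((int^'n) \<Rightarrow>\<^sub>0 'k) set"
  have A: "is_subring ?A" by (rule subring_semigroup_ring) (auto intro: sg_gen_0 sg_gen_add)
  have B: "is_subring ?B" by (rule subring_semigroup_ring) (auto intro: sg_gen_0 sg_gen_add)
  note eq = sg_gen_insert[OF insert.hyps(1,2)]
  have 1: "c + int n *s x \<in> sg_gen (insert x G)" if "c \<in> sg_gen G" for c n using eq that by blast
  have "adjoin ?A (monom x) \<subseteq> ?B"
  proof (rule adjoin_least[OF B])
    show "?A \<subseteq> ?B" using 1[of _ 0] by (intro semigroup_ring_mono) auto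
    show "monom x \<in> ?B" using 1[OF sg_gen_0, of 1] by (simp add: monom_mem)
  qed
  moreover have "?B \<subseteq> adjoin ?A (monom x)"
  proof
    fix f assume f: "f \<in> ?B"
    note adj = is_subringD[OF adjoin_subring[OF A, of "monom x"]]
    have "Poly_Mapping.single c v \<in> adjoin ?A (monom x)" if c: "c \<in> sg_gen (insert x G)" for c v
    proof -
      obtain d n where d: "c = d + int n *s x" "d \<in> sg_gen G" using c eq by blast
      have "Poly_Mapping.single c v = Poly_Mapping.single d v * monom x ^ n"
        unfolding monom_power by (simp add: d(1) monom_def mult_single)
      moreover have "Poly_Mapping.single d v \<in> ?A" using d(2) by (simp add: single_mem)
      ultimately show ?thesis using adj(4,7) adjoin_mem[OF A] by simp
    qed
    then have "(\<Sum>a\<in>Poly_Mapping.keys f. Poly_Mapping.single a (Poly_Mapping.lookup f a)) \<in> adjoin ?A (monom x)"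
      using f by (intro adj(8)) (auto simp: mem_semigroup_ring)
    then show "f \<in> adjoin ?A (monom x)" by (simp add: sum_singles)
  qed
  ultimately have "?B = adjoin ?A (monom x)" by blast
  then show ?case using adjoin_acc[OF A insert.IH] by simp
qed

text \<open>The parameter \<open>K\<close> only fixes the type of the coefficients.\<close>

locale positive_semigroup =
  fixes C :: "(int^'n) set" and deg :: "int^'n \<Rightarrow> real" and K :: "'k::field itself"
  assumes affine: "affine_semigroup C"
    and deg_add: "deg (a + b) = deg a + deg b"
    and deg_pos: "c \<in> C \<Longrightarrow> c \<noteq> 0 \<Longrightarrow> 0 < deg c"
begin

abbreviation R :: "((int^'n) \<Rightarrow>\<^sub>0 'k) set" where "R \<equiv> semigroup_ring C"
abbreviation m :: "((int^'n) \<Rightarrow>\<^sub>0 'k) set" where "m \<equiv> max_hom C"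
abbreviation mspan :: "(int^'n) set \<Rightarrow> ((int^'n) \<Rightarrow>\<^sub>0 'k) set" where "mspan \<equiv> semigroup_ring"

text \<open>The exponent sets of the graded ideals, as \<open>upset_ideal\<close> and
  \<open>homogeneous_ideal_upset\<close> show.\<close>

definition upset :: "(int^'n) set \<Rightarrow> bool" where
  "upset U \<longleftrightarrow> U \<subseteq> C \<and> (\<forall>u\<in>U. \<forall>c\<in>C. u + c \<in> U)"

lemma C_gen: obtains G where "finite G" "C = sg_gen G"
  using affine unfolding affine_semigroup_def sg_gen_def by blast

lemma C_0: "0 \<in> C" and C_add: "a \<in> C \<Longrightarrow> b \<in> C \<Longrightarrow> a + b \<in> C"
  using C_gen sg_gen_0 sg_gen_add by metis+

lemma C_sum: "(\<And>x. x \<in> B \<Longrightarrow> f x \<in> C) \<Longrightarrow> sum f B \<in> C"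
  by (induction B rule: infinite_finite_induct) (auto simp: C_0 C_add)

lemma int_smult_closed:
  assumes "0 \<in> A" "\<And>a b. a \<in> A \<Longrightarrow> b \<in> A \<Longrightarrow> a + b \<in> A" "c \<in> A"
  shows "int n *s c \<in> (A :: (int^'n) set)"
proof (induction n)
  case (Suc n)
  have "int (Suc n) *s c = c + int n *s c" by (simp add: vec_eq_iff algebra_simps)
  then show ?case using assms(2)[OF assms(3) Suc] by simp
qed (simp add: assms(1))

lemma deg_0: "deg 0 = 0"
  using deg_add[of 0 0] by simp

lemma deg_nonneg: "c \<in> C \<Longrightarrow> 0 \<le> deg c"
  using deg_pos deg_0 by (cases "c = 0") (auto simp: less_imp_le)

lemma C_sum_0: "a \<in> C \<Longrightarrow> b \<in> C \<Longrightarrow> a + b = 0 \<Longrightarrow> a = 0"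
  using deg_add[of a b] deg_0 deg_nonneg deg_pos by fastforce

lemma upset_ideal: assumes "upset U" shows "is_ideal R (mspan U)"
  unfolding is_ideal_def
proof (intro conjI ballI)
  show "mspan U \<subseteq> R" using assms by (auto simp: upset_def semigroup_ring_subset_iff)
  show "r * a \<in> mspan U" if "r \<in> R" "a \<in> mspan U" for r a
    by (rule semigroup_ring_mult[OF that]) (use assms in \<open>metis add.commute upset_def\<close>)
qed (auto simp: semigroup_ring_0 semigroup_ring_add)

lemma max_hom_eq: "m = mspan (C - {0})"
  by (auto simp: max_hom_def mem_semigroup_ring in_keys_iff subset_iff)

lemma upset_max: "upset (C - {0})"
  unfolding upset_def using C_add C_sum_0 by auto

lemma upset_C: "upset C"
  unfolding upset_def using C_add by auto

lemma upset_Un: "upset U \<Longrightarrow> upset V \<Longrightarrow> upset (U \<union> V)"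
  and upset_Int: "upset U \<Longrightarrow> upset V \<Longrightarrow> upset (U \<inter> V)"
  by (auto simp: upset_def)

lemma upset_translate: "upset U \<Longrightarrow> g \<in> C \<Longrightarrow> upset ((+) g ` U)"
  by (auto simp: upset_def C_add add.assoc)

end

sublocale positive_semigroup \<subseteq> noetherian_ring_with_ideal "semigroup_ring C :: ((int^'n) \<Rightarrow>\<^sub>0 'k) set" "max_hom C"
proof
  show "is_subring R" using subring_semigroup_ring C_0 C_add by metis
  show "ideal_acc R" using C_gen acc_semigroup_ring by metis
  show "is_ideal R m" using upset_ideal[OF upset_max] by (simp add: max_hom_eq)
qed

context positive_semigroup
begin

lemma monom_in_m: "c \<in> C \<Longrightarrow> c \<noteq> 0 \<Longrightarrow> monom c \<in> m"
  by (simp add: max_hom_eq monom_mem)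

lemma mspan_subset_ideal:
  assumes J: "is_ideal R J" and U: "\<And>c. c \<in> U \<Longrightarrow> monom c \<in> J"
  shows "mspan U \<subseteq> J"
proof
  fix f assume f: "f \<in> mspan U"
  have sumJ: "sum h A \<in> J" if "\<And>a. a \<in> A \<Longrightarrow> h a \<in> J" for h :: "(int^'n) \<Rightarrow> _" and A
    using that is_idealD(2,3)[OF J] by (induction A rule: infinite_finite_induct) auto
  have "Poly_Mapping.single c v \<in> J" if "c \<in> U" for c v
    using is_idealD(4)[OF J _ U[OF that], of "Poly_Mapping.single 0 v"] C_0
    by (simp add: single_mem monom_def mult_single)
  then have "(\<Sum>a\<in>Poly_Mapping.keys f. Poly_Mapping.single a (Poly_Mapping.lookup f a)) \<in> J"
    using f by (intro sumJ) (auto simp: mem_semigroup_ring)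
  then show "f \<in> J" by (simp add: sum_singles)
qed

text \<open>Every graded piece of the group ring is one-dimensional, so the nonzero components of an
  element are invertible scalars times monomials.\<close>

lemma homogeneous_ideal_upset:
  assumes "is_ideal R J" "homogeneous J"
  obtains U where "upset U" "J = mspan U"
proof -
  define U where "U = {c. monom c \<in> J}"
  have U: "upset U" unfolding upset_def
  proof (intro conjI ballI)
    show "U \<subseteq> C" 
    proof
      fix c assume "c \<in> U"
      then have "(monom c :: _ \<Rightarrow>\<^sub>0 'k) \<in> R" using is_idealD(1)[OF assms(1)] by (auto simp: U_def)
      then show "c \<in> C" by (simp add: monom_mem)
    qed
    fix u c assume "u \<in> U" "c \<in> C"
    then have "monom c * monom u \<in> J" using is_idealD(4)[OF assms(1)] by (auto simp: U_def monom_mem)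
    then show "u + c \<in> U" by (simp add: U_def monom_def mult_single add.commute)
  qed
  have "mspan U \<subseteq> J" by (rule mspan_subset_ideal[OF assms(1)]) (simp add: U_def)
  moreover have "J \<subseteq> mspan U"
  proof
    fix f assume f: "f \<in> J"
    have "c \<in> U" if "c \<in> Poly_Mapping.keys f" for c
    proof -
      have nz: "Poly_Mapping.lookup f c \<noteq> 0" using that by (simp add: in_keys_iff)
      have "Poly_Mapping.single c (Poly_Mapping.lookup f c) \<in> J"
        using f assms(2) unfolding homogeneous_def by blast
      then have "Poly_Mapping.single 0 (inverse (Poly_Mapping.lookup f c)) *
          Poly_Mapping.single c (Poly_Mapping.lookup f c) \<in> J"
        using is_idealD(4)[OF assms(1)] C_0 by (auto simp: single_mem)
      then show "c \<in> U" using nz by (simp add: U_def monom_def mult_single)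
    qed
    then show "f \<in> mspan U" by (auto simp: mem_semigroup_ring)
  qed
  ultimately show thesis using that U by blast
qed

lemma homogeneous_mspan: "homogeneous (mspan U)"
  by (auto simp: homogeneous_def single_mem mem_semigroup_ring in_keys_iff subset_iff)

text \<open>Both quotients are isomorphic to the one formed inside the intersection of U and V. This
  makes it possible to speak of the depth of a set of lattice points.\<close>

lemma depth_ge_independent:
  assumes "upset U" "upset U'" "U' \<subseteq> U" "upset V" "upset V'" "V' \<subseteq> V" "U - U' = V - V'"
  shows "depth_ge m n (mspan U) (mspan U') \<longleftrightarrow> depth_ge m n (mspan V) (mspan V')"
proof -
  have *: "depth_ge m n (mspan U) (mspan U') \<longleftrightarrow> depth_ge m n (mspan (U \<inter> V)) (mspan (U \<inter> V \<inter> U'))"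
    if "upset U" "upset U'" "U' \<subseteq> U" "upset V" "U - U' \<subseteq> V" for U U' V
  proof -
    have "mspan U = mspan (U \<inter> V) + mspan U'" unfolding semigroup_ring_plus
      by (rule arg_cong[of _ _ semigroup_ring]) (use that in blast)
    then show ?thesis
      using depth_ge_second_iso[OF upset_ideal[OF upset_Int[OF that(1,4)]] upset_ideal[OF that(2)]]
      by (simp add: semigroup_ring_Int)
  qed
  have "depth_ge m n (mspan U) (mspan U') \<longleftrightarrow> depth_ge m n (mspan (U \<inter> V)) (mspan (U \<inter> V \<inter> U'))"
    by (rule *) (use assms in auto)
  also have "U \<inter> V \<inter> U' = V \<inter> U \<inter> V'" using assms by blast
  also have "U \<inter> V = V \<inter> U" by blast
  also have "depth_ge m n (mspan (V \<inter> U)) (mspan (V \<inter> U \<inter> V')) \<longleftrightarrow> depth_ge m n (mspan V) (mspan V')"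
    by (rule *[symmetric]) (use assms in auto)
  finally show ?thesis .
qed

lemma min_degree_element:
  assumes "finite A" "A \<noteq> {}"
  obtains c where "c \<in> A" "\<And>d. d \<in> A \<Longrightarrow> deg c \<le> deg d"
  using ex_min_if_finite[of "deg ` A"] assms by (metis arg_min_least arg_min_if_finite(1))

text \<open>Multiplication by y raises degrees, so the factor 1 - y does not alter the coefficient
  of a at an exponent outside U of least degree.\<close>

lemma sat_mspan:
  assumes U: "upset U" shows "sat (mspan U) \<subseteq> mspan U"
proof
  fix a assume "a \<in> sat (mspan U)"
  then obtain y where a: "a \<in> R" and y: "y \<in> m" "(1 - y) * a \<in> mspan U" by (auto simp: sat_def)
  show "a \<in> mspan U"
  proof (rule ccontr)
    assume "a \<notin> mspan U"
    then have "Poly_Mapping.keys a - U \<noteq> {}" by (auto simp: mem_semigroup_ring)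
    then obtain c where c: "c \<in> Poly_Mapping.keys a - U"
      and min: "\<And>d. d \<in> Poly_Mapping.keys a - U \<Longrightarrow> deg c \<le> deg d"
      using min_degree_element[of "Poly_Mapping.keys a - U"] by auto
    have "c \<notin> Poly_Mapping.keys (y * a)"
    proof
      assume "c \<in> Poly_Mapping.keys (y * a)"
      then obtain h k where hk: "h \<in> Poly_Mapping.keys y" "k \<in> Poly_Mapping.keys a" "c = h + k"
        using keys_mult by blast
      have h: "h \<in> C" "h \<noteq> 0" using hk(1) y(1) by (auto simp: max_hom_eq mem_semigroup_ring)
      then have "deg k < deg c" using hk(3) deg_add deg_pos by simp
      then have "k \<in> U" using min[of k] hk(2) by fastforce
      then have "c \<in> U" using U h hk(3) by (auto simp: upset_def add.commute)
      then show False using c by blast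
    qed
    then have "Poly_Mapping.lookup ((1 - y) * a) c = Poly_Mapping.lookup a c"
      by (simp add: left_diff_distrib lookup_minus in_keys_iff)
    then have "c \<in> Poly_Mapping.keys ((1 - y) * a)" using c by (simp add: in_keys_iff)
    then show False using y(2) c by (auto simp: mem_semigroup_ring)
  qed
qed

text \<open>If the sequence generated everything, each exponent in U - U' would be a nonzero element
  of C plus another exponent in U - U', an infinite descent in degree.\<close>

lemma nakayama:
  assumes U: "upset U" and U': "upset U'" "U' \<subset> U" and xs: "set xs \<subseteq> m"
  shows "seq_sub (mspan U) (mspan U') xs (length xs) \<noteq> mspan U"
proof
  assume eq: "seq_sub (mspan U) (mspan U') xs (length xs) = mspan U"
  obtain c0 where c0: "c0 \<in> U - U'" using U' by blast
  have step: "\<exists>d\<in>U - U'. \<exists>h\<in>C - {0}. c = h + d" if c: "c \<in> U - U'" for c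
  proof -
    have "monom c \<in> seq_sub (mspan U) (mspan U') xs (length xs)" unfolding eq using c by (simp add: monom_mem)
    then obtain b a where ba: "monom c = b + (\<Sum>j<length xs. xs ! j * a j)" "b \<in> mspan U'"
      "\<forall>j<length xs. a j \<in> mspan U" by (auto simp: seq_sub_def)
    have "c \<notin> Poly_Mapping.keys b" using ba(2) c by (auto simp: mem_semigroup_ring)
    moreover have "c \<in> Poly_Mapping.keys (b + (\<Sum>j<length xs. xs ! j * a j))"
      unfolding ba(1)[symmetric] by (simp add: monom_def)
    ultimately have "c \<in> Poly_Mapping.keys (\<Sum>j<length xs. xs ! j * a j)"
      using keys_add[of b "\<Sum>j<length xs. xs ! j * a j"] by blast
    then have "(\<Sum>j<length xs. Poly_Mapping.lookup (xs ! j * a j) c) \<noteq> 0"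
      by (simp add: in_keys_iff lookup_sum)
    then obtain j where j: "j < length xs" "Poly_Mapping.lookup (xs ! j * a j) c \<noteq> 0"
      by (meson lessThan_iff sum.neutral)
    then obtain h k where hk: "h \<in> Poly_Mapping.keys (xs ! j)" "k \<in> Poly_Mapping.keys (a j)" "c = h + k"
      using keys_mult[of "xs ! j" "a j"] by (auto simp: in_keys_iff)
    have "xs ! j \<in> m" using xs j(1) by auto
    then have h: "h \<in> C - {0}" using hk(1) by (auto simp: max_hom_eq mem_semigroup_ring)
    have "k \<in> U" using hk(2) ba(3) j(1) by (auto simp: mem_semigroup_ring)
    moreover have "k \<notin> U'" using U'(1) h hk(3) c by (auto simp: upset_def add.commute)
    ultimately show ?thesis using h hk(3) by blast
  qed
  text \<open>Each step lowers the degree by at least the least degree of a nonzero generator.\<close>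
  obtain G where G: "finite G" "C = sg_gen G" using C_gen .
  have GC: "g \<in> C" if "g \<in> G" for g using sg_gen_mem[OF G(1) that] G(2) by simp
  have deg_sum: "deg (\<Sum>g\<in>A. int (k g) *s g) = (\<Sum>g\<in>A. real (k g) * deg g)" for A k
  proof -
    have 1: "deg (int n *s g) = real n * deg g" for n g
    proof (induction n)
      case (Suc n)
      have "int (Suc n) *s g = g + int n *s g" by (simp add: vec_eq_iff algebra_simps)
      then show ?case by (simp add: deg_add Suc algebra_simps)
    qed (simp add: deg_0)
    show ?thesis by (induction A rule: infinite_finite_induct) (auto simp: deg_0 deg_add 1)
  qed
  \<comment> \<open>The inserted 1 keeps \<open>Min\<close> meaningful when C has no nonzero
    generator.\<close>
  define e where "e = Min (insert 1 (deg ` (G - {0})))"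
  have e0: "e > 0" unfolding e_def using G(1) GC deg_pos by (subst Min_gr_iff) auto
  have e: "deg h \<ge> e" if h: "h \<in> C - {0}" for h
  proof -
    obtain k where k: "h = (\<Sum>g\<in>G. int (k g) *s g)" using h G(2) by (auto simp: sg_gen_def)
    have "\<exists>g\<in>G. g \<noteq> 0 \<and> k g \<noteq> 0"
    proof (rule ccontr)
      assume "\<not> ?thesis"
      then have "h = 0" unfolding k by (intro sum.neutral) auto
      then show False using h by blast
    qed
    then obtain g where g: "g \<in> G" "g \<noteq> 0" "k g \<noteq> 0" by blast
    have "e \<le> deg g" unfolding e_def using g G(1) by (intro Min_le) auto
    also have "\<dots> \<le> real (k g) * deg g" using g(3) deg_nonneg[OF GC[OF g(1)]]
      by (simp add: mult_le_cancel_right1)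
    also have "\<dots> \<le> (\<Sum>g\<in>G. real (k g) * deg g)"
      using G(1) g(1) deg_nonneg GC by (intro member_le_sum) auto
    finally show ?thesis unfolding k deg_sum .
  qed
  have "\<exists>d\<in>U - U'. deg d \<le> deg c0 - real n * e" for n
  proof (induction n)
    case (Suc n)
    then obtain d where d: "d \<in> U - U'" "deg d \<le> deg c0 - real n * e" by blast
    obtain d' h where "d' \<in> U - U'" "h \<in> C - {0}" "d = h + d'" using step[OF d(1)] by blast
    then show ?case using d(2) e[of h] by (intro bexI[of _ d']) (auto simp: deg_add algebra_simps)
  qed (use c0 in auto)
  moreover obtain n where "real n * e > deg c0" using reals_Archimedean3[OF e0] by blast
  ultimately obtain d where "d \<in> U" "deg d < 0" by (smt (verit) DiffD1)
  then show False using U deg_nonneg[of d] by (auto simp: upset_def)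
qed

end

section \<open>Regular sequences and the recursive form of depth\<close>

lemma seq_sub_0 [simp]: "seq_sub J J' xs 0 = J'"
  by (auto simp: seq_sub_def)

lemma seq_sub_Cons: "seq_sub J J' (z # xs) (Suc i) = seq_sub J (J' + z *o J) xs i"
proof
  show "seq_sub J J' (z # xs) (Suc i) \<subseteq> seq_sub J (J' + z *o J) xs i"
  proof
    fix u assume "u \<in> seq_sub J J' (z # xs) (Suc i)"
    then obtain b a where ba: "u = b + (\<Sum>j<Suc i. (z # xs) ! j * a j)" "b \<in> J'" "\<forall>j<Suc i. a j \<in> J"
      unfolding seq_sub_def by blast
    have "u = (b + z * a 0) + (\<Sum>j<i. xs ! j * a (Suc j))"
      unfolding ba(1) by (subst sum.lessThan_Suc_shift) (simp add: add.assoc)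
    moreover have "b + z * a 0 \<in> J' + z *o J" using ba by (intro mem_stepI[of b _ "a 0"]) auto
    ultimately show "u \<in> seq_sub J (J' + z *o J) xs i" unfolding seq_sub_def using ba(3)
      by (intro CollectI exI[of _ "b + z * a 0"] exI[of _ "\<lambda>j. a (Suc j)"]) auto
  qed
  show "seq_sub J (J' + z *o J) xs i \<subseteq> seq_sub J J' (z # xs) (Suc i)"
  proof
    fix u assume "u \<in> seq_sub J (J' + z *o J) xs i"
    then obtain b a where ba: "u = b + (\<Sum>j<i. xs ! j * a j)" "b \<in> J' + z *o J" "\<forall>j<i. a j \<in> J"
      unfolding seq_sub_def by blast
    obtain b' a0 where b': "b' \<in> J'" "a0 \<in> J" "b = b' + z * a0" using ba(2) unfolding mem_step by blast
    let ?a = "\<lambda>j. case j of 0 \<Rightarrow> a0 | Suc k \<Rightarrow> a k"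
    have "u = b' + (\<Sum>j<Suc i. (z # xs) ! j * ?a j)"
      unfolding ba(1) b'(3) by (subst sum.lessThan_Suc_shift) (simp add: add.assoc)
    moreover have "\<forall>j<Suc i. ?a j \<in> J" using b'(2) ba(3) by (auto split: nat.split)
    ultimately show "u \<in> seq_sub J J' (z # xs) (Suc i)" unfolding seq_sub_def using b'(1)
      by (intro CollectI exI[of _ b'] exI[of _ ?a]) blast
  qed
qed

lemma depth_ge_iff_sequence:
  "depth_ge m n J J' \<longleftrightarrow>
    (\<exists>xs. length xs = n \<and> set xs \<subseteq> m \<and> (\<forall>i<n. nzd (xs ! i) J (seq_sub J J' xs i)))"
proof (induction n arbitrary: J')
  case (Suc n)
  show ?case
  proof
    assume "depth_ge m (Suc n) J J'"
    then obtain z where z: "z \<in> m" "nzd z J J'" "depth_ge m n J (J' + z *o J)" by auto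
    then obtain xs where xs: "length xs = n" "set xs \<subseteq> m"
      "\<forall>i<n. nzd (xs ! i) J (seq_sub J (J' + z *o J) xs i)" using Suc.IH by blast
    have "nzd ((z # xs) ! i) J (seq_sub J J' (z # xs) i)" if "i < Suc n" for i
      using that z xs(3) by (cases i) (auto simp: seq_sub_Cons)
    then show "\<exists>xs. length xs = Suc n \<and> set xs \<subseteq> m \<and> (\<forall>i<Suc n. nzd (xs ! i) J (seq_sub J J' xs i))"
      using xs z by (intro exI[of _ "z # xs"]) auto
  next
    assume "\<exists>xs. length xs = Suc n \<and> set xs \<subseteq> m \<and> (\<forall>i<Suc n. nzd (xs ! i) J (seq_sub J J' xs i))"
    then obtain ys where ys: "length ys = Suc n" "set ys \<subseteq> m" "\<forall>i<Suc n. nzd (ys ! i) J (seq_sub J J' ys i)"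
      by blast
    then obtain z xs where zx: "ys = z # xs" by (cases ys) auto
    have "nzd (xs ! i) J (seq_sub J (J' + z *o J) xs i)" if "i < n" for i
      using ys(3)[rule_format, of "Suc i"] that by (simp add: zx seq_sub_Cons)
    then have "depth_ge m n J (J' + z *o J)" unfolding Suc.IH using ys(1,2) zx by (intro exI[of _ xs]) auto
    then show "depth_ge m (Suc n) J J'" using ys(2) ys(3)[rule_format, of 0] by (auto simp: zx)
  qed
qed simp

lemma Sup_enat_eq_iff:
  assumes "\<And>n. n \<in> A \<Longrightarrow> n \<le> k" "0 \<in> A"
  shows "Sup (enat ` A) = enat k \<longleftrightarrow> k \<in> A"
proof -
  have fin: "finite A" using assms(1) by (meson finite_nat_set_iff_bounded_le)
  have "Sup (enat ` A) = Max (enat ` A)" using fin assms(2) by (auto simp: Sup_enat_def)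
  also have "\<dots> = enat (Max A)" using fin assms(2)
    by (subst mono_Max_commute[of enat]) (auto simp: mono_def)
  finally have "Sup (enat ` A) = enat (Max A)" .
  moreover have "Max A \<in> A" using Max_in[OF fin] assms(2) by blast
  moreover have "Max A = k" if "k \<in> A" using fin that assms(1) by (intro Max_eqI) auto
  ultimately show ?thesis by auto
qed

context positive_semigroup
begin

text \<open>The nonvanishing demanded by \<open>regular_seq\<close> is supplied by
  \<open>nakayama\<close>.\<close>

lemma depth_ge_iff_regular:
  assumes "upset U" "upset U'" "U' \<subset> U"
  shows "depth_ge m n (mspan U) (mspan U') \<longleftrightarrow>
    (\<exists>xs. length xs = n \<and> regular_seq R m (mspan U) (mspan U') xs)"
  unfolding depth_ge_iff_sequence regular_seq_def nzd_def using nakayama[OF assms] by blast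

lemma depth_eq_iff:
  assumes "upset U" "upset U'" "U' \<subset> U"
    and "\<And>n. depth_ge m n (mspan U) (mspan U') \<Longrightarrow> n \<le> k"
  shows "depth R m (mspan U) (mspan U') = enat k \<longleftrightarrow> depth_ge m k (mspan U) (mspan U')"
proof -
  let ?A = "{n. depth_ge m n (mspan U) (mspan U')}"
  have "{enat (length xs) | xs. regular_seq R m (mspan U) (mspan U') xs} = enat ` ?A"
    unfolding depth_ge_iff_regular[OF assms(1-3)] by auto
  then show ?thesis unfolding depth_def using Sup_enat_eq_iff[of ?A k] assms(4) by simp
qed

section \<open>Faces of the semigroup and monomial primes\<close>

definition prime_face :: "(int^'n) set \<Rightarrow> bool" where
  "prime_face F \<longleftrightarrow> F \<subseteq> C \<and> 0 \<in> F \<and> (\<forall>c\<in>C. \<forall>h\<in>C. c + h \<in> F \<longleftrightarrow> c \<in> F \<and> h \<in> F)"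

lemma upset_prime_face: "prime_face F \<Longrightarrow> upset (C - F)"
  unfolding prime_face_def upset_def by (auto simp: C_add)

text \<open>A point \<open>s\<close> of maximal norm in \<open>A + B\<close> has a unique decomposition, since
  \<open>|s + d|\<^sup>2 + |s - d|\<^sup>2 = 2|s|\<^sup>2 + 2|d|\<^sup>2\<close>.\<close>

lemma unique_sum:
  fixes A B :: "(int^'n) set"
  assumes "finite A" "finite B" "A \<noteq> {}" "B \<noteq> {}"
  obtains a b where "a \<in> A" "b \<in> B" "\<And>a' b'. a' \<in> A \<Longrightarrow> b' \<in> B \<Longrightarrow> a' + b' = a + b \<Longrightarrow> a' = a"
proof -
  define N where "N p = (norm (realv (fst p + snd p)))\<^sup>2" for p :: "(int^'n) \<times> (int^'n)"
  have "finite (N ` (A \<times> B))" "N ` (A \<times> B) \<noteq> {}" using assms by auto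
  then have "Max (N ` (A \<times> B)) \<in> N ` (A \<times> B)" by (rule Max_in)
  then obtain a b where ab: "a \<in> A" "b \<in> B" "N (a, b) = Max (N ` (A \<times> B))" by auto
  have max: "N p \<le> N (a, b)" if "p \<in> A \<times> B" for p
    unfolding ab(3) using that assms by (intro Max_ge) auto
  have "a' = a" if a': "a' \<in> A" "b' \<in> B" "a' + b' = a + b" for a' b'
  proof (rule ccontr)
    assume ne: "a' \<noteq> a"
    define s where "s = realv (a + b)"
    define d where "d = realv (a' - a)"
    have d0: "d \<noteq> 0" using ne realv_inj[of a' a] by (simp add: d_def realv_diff)
    have 1: "realv (a' + b) = s + d" by (simp add: s_def d_def realv_add realv_diff)
    have e: "a + b' = (a + b) - (a' - a)" using a'(3) by (simp add: algebra_simps)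
    have 2: "realv (a + b') = s - d" unfolding e s_def d_def by (rule realv_diff)
    have "N (a', b) \<le> N (a, b)" "N (a, b') \<le> N (a, b)" using max ab a' by auto
    then have "(norm (s + d))\<^sup>2 \<le> (norm s)\<^sup>2" "(norm (s - d))\<^sup>2 \<le> (norm s)\<^sup>2"
      unfolding N_def fst_conv snd_conv 1 2 s_def[symmetric] .
    moreover have "(norm (s + d))\<^sup>2 + (norm (s - d))\<^sup>2 = 2 * (norm s)\<^sup>2 + 2 * (norm d)\<^sup>2"
      by (simp add: power2_norm_eq_inner algebra_simps)
    moreover have "(norm d)\<^sup>2 > 0" using d0 by simp
    ultimately show False by linarith
  qed
  then show thesis using that ab by blast
qed

text \<open>If f and g both have exponents in F, take a + b with a unique decomposition among these.
  It cannot cancel in f g, because by the face property all its decompositions within C have both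
  parts in F.\<close>

lemma prime_face_prime:
  assumes F: "prime_face F" shows "is_prime_ideal R (mspan (C - F))"
  unfolding is_prime_ideal_def
proof (intro conjI ballI impI)
  show "is_ideal R (mspan (C - F))" using upset_ideal upset_prime_face F by blast
  have "0 \<in> C" "0 \<notin> C - F" using F C_0 by (auto simp: prime_face_def)
  then show "mspan (C - F) \<noteq> R" using monom_mem by metis
  fix f g assume f: "f \<in> R" and g: "g \<in> R" and fg: "f * g \<in> mspan (C - F)"
  show "f \<in> mspan (C - F) \<or> g \<in> mspan (C - F)"
  proof (rule ccontr)
    assume "\<not> ?thesis"
    then have ne: "Poly_Mapping.keys f \<inter> F \<noteq> {}" "Poly_Mapping.keys g \<inter> F \<noteq> {}"
      using f g by (auto simp: mem_semigroup_ring)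
    obtain a b where ab: "a \<in> Poly_Mapping.keys f \<inter> F" "b \<in> Poly_Mapping.keys g \<inter> F"
      and uniq: "\<And>a' b'. a' \<in> Poly_Mapping.keys f \<inter> F \<Longrightarrow> b' \<in> Poly_Mapping.keys g \<inter> F \<Longrightarrow>
        a' + b' = a + b \<Longrightarrow> a' = a"
      by (rule unique_sum[OF _ _ ne]) auto
    have FC: "c \<in> F \<and> h \<in> F" if "c \<in> C" "h \<in> C" "c + h \<in> F" for c h
      using that F by (auto simp: prime_face_def)
    have abF: "a + b \<in> F" using ab F by (auto simp: prime_face_def)
    have "Poly_Mapping.lookup f c * Poly_Mapping.lookup g (a + b - c) = 0"
      if "c \<in> Poly_Mapping.keys f - {a}" for c
    proof (rule ccontr)
      assume "\<not> ?thesis"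
      then have k: "a + b - c \<in> Poly_Mapping.keys g" by (auto simp: in_keys_iff)
      have "c \<in> C" "a + b - c \<in> C" using that k f g by (auto simp: mem_semigroup_ring)
      then have "c \<in> F \<and> a + b - c \<in> F" using FC[of c "a + b - c"] abF by simp
      then show False using uniq[of c "a + b - c"] that k by auto
    qed
    then have "(\<Sum>c\<in>Poly_Mapping.keys f - {a}. Poly_Mapping.lookup f c * Poly_Mapping.lookup g (a + b - c)) = 0"
      by (rule sum.neutral[OF ballI])
    then have "Poly_Mapping.lookup (f * g) (a + b) = Poly_Mapping.lookup f a * Poly_Mapping.lookup g b"
      unfolding lookup_times using ab(1) by (subst sum.remove[of _ a]) auto
    then have "a + b \<in> Poly_Mapping.keys (f * g)" using ab by (simp add: in_keys_iff)
    then show False using fg abF by (auto simp: mem_semigroup_ring)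
  qed
qed

text \<open>The witness \<open>c0\<close> is the sum of the generators of \<open>C\<close> whose monomials avoid \<open>P\<close>.\<close>

lemma prime_ideal_face:
  assumes P: "is_prime_ideal R P"
  obtains c0 where "c0 \<in> C" "monom c0 \<notin> P"
    "\<And>F. prime_face F \<Longrightarrow> c0 \<in> F \<Longrightarrow> mspan (C - F) \<subseteq> P"
proof -
  have Pi: "is_ideal R P" using is_prime_idealD(1)[OF P] .
  have P1: "1 \<notin> P"
  proof
    assume "1 \<in> P"
    then have "r \<in> P" if "r \<in> R" for r using is_idealD(4)[OF Pi that, of 1] by simp
    then show False using is_prime_idealD(2)[OF P] is_idealD(1)[OF Pi] by blast
  qed
  obtain G where G: "finite G" "C = sg_gen G" using C_gen .
  define A where "A = {g \<in> G. monom g \<notin> P}"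
  have fin: "finite A" using G(1) by (simp add: A_def)
  have GC: "g \<in> C" if "g \<in> G" for g using sg_gen_mem[OF G(1) that] G(2) by simp
  have AC: "B \<subseteq> A \<Longrightarrow> sum id B \<in> C" for B using GC by (intro C_sum) (auto simp: A_def)
  have "finite B \<Longrightarrow> B \<subseteq> A \<Longrightarrow> monom (sum id B) \<notin> P" for B
  proof (induction B rule: finite_induct)
    case empty
    then show ?case using P1 by (simp add: monom_def)
  next
    case (insert g B)
    have "monom (sum id (insert g B)) = (monom g :: _ \<Rightarrow>\<^sub>0 'k) * monom (sum id B)"
      using insert by (simp add: monom_def mult_single)
    moreover have "monom g \<notin> P" "monom g \<in> R" "monom (sum id B) \<in> R"
      using insert.prems AC[of B] GC by (auto simp: A_def monom_mem)
    ultimately show ?case using is_prime_idealD(3)[OF P, of "monom g" "monom (sum id B)"] insert by auto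
  qed
  then have c0: "monom (sum id A) \<notin> P" using fin by blast
  show thesis
  proof (rule that[OF AC[OF order_refl] c0])
    fix F assume F: "prime_face F" "sum id A \<in> F"
    have FC: "c \<in> F \<and> h \<in> F" if "c \<in> C" "h \<in> C" "c + h \<in> F" for c h
      using that F by (auto simp: prime_face_def)
    have AF: "g \<in> F" if "g \<in> A" for g
    proof -
      have "sum id A = g + sum id (A - {g})" using fin that by (simp add: sum.remove)
      then show ?thesis using FC[of g "sum id (A - {g})"] F(2) AC[of "A - {g}"] GC that by (auto simp: A_def)
    qed
    have F_add: "c + h \<in> F" if "c \<in> F" "h \<in> F" for c h
      using that F(1) unfolding prime_face_def by blast
    have F_sum: "sum f B \<in> F" if "\<And>x. x \<in> B \<Longrightarrow> f x \<in> F" for f :: "int^'n \<Rightarrow> _" and B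
      using that F(1) by (induction B rule: infinite_finite_induct) (auto intro: F_add simp: prime_face_def)
    have F_mult: "int n *s c \<in> F" if "c \<in> F" for n c
      using int_smult_closed[OF _ F_add that] F(1) by (simp add: prime_face_def)
    have mon: "monom c \<in> P" if c: "c \<in> C - F" for c
    proof -
      obtain k where k: "c = (\<Sum>g\<in>G. int (k g) *s g)" using c G(2) by (auto simp: sg_gen_def)
      have "\<exists>g\<in>G. g \<notin> F \<and> k g \<noteq> 0"
      proof (rule ccontr)
        assume "\<not> ?thesis"
        then have "c \<in> F" unfolding k using F_mult F(1) by (intro F_sum) (auto simp: prime_face_def)
        then show False using c by blast
      qed
      then obtain g where g: "g \<in> G" "g \<notin> F" "k g \<noteq> 0" by blast
      \<comment> \<open>A generator g of c outside F has its monomial in P, since otherwise g would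
        be a summand of the witness, which lies in F. So c is split as d + g.\<close>
      define d where "d = int (k g - 1) *s g + (\<Sum>g\<in>G - {g}. int (k g) *s g)"
      have "int (k g) *s g = g + int (k g - 1) *s g" using g(3) by (simp add: vec_eq_iff of_nat_diff algebra_simps)
      then have "c = d + g" unfolding k d_def using G(1) g(1) by (simp add: sum.remove[of G g])
      then have "monom c = (monom d :: _ \<Rightarrow>\<^sub>0 'k) * monom g" by (simp add: monom_def mult_single)
      moreover have "d \<in> C" unfolding d_def using GC g(1) by (intro C_add int_smult_closed[OF C_0 C_add] C_sum) auto
      moreover have "monom g \<in> P" using g AF by (auto simp: A_def)
      ultimately show ?thesis using is_idealD(4)[OF Pi, of "monom d" "monom g"] by (simp add: monom_mem)
    qed
    show "mspan (C - F) \<subseteq> P" by (rule mspan_subset_ideal[OF Pi mon])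
  qed
qed

end

section \<open>Rational cones and their faces\<close>

lemma realv_sum: "realv (sum f A) = (\<Sum>x\<in>A. realv (f x))"
  by (induction A rule: infinite_finite_induct) (auto simp: realv_add)

lemma realv_uminus: "realv (- a) = - realv a"
  by (simp add: realv_def vec_eq_iff)

lemma cone_ofI:
  assumes "finite S" "S \<subseteq> C" "\<And>s. s \<in> S \<Longrightarrow> u s \<ge> 0"
  shows "(\<Sum>s\<in>S. u s *\<^sub>R realv s) \<in> cone_of C"
  unfolding cone_of_def using assms by (intro CollectI exI[of _ S] exI[of _ u]) auto

locale normal_cone =
  fixes C :: "(int^'n) set" and K :: "'k::field itself"
  assumes affine: "affine_semigroup C" and pointed: "pointed C" and normal: "normal_sg C"
begin

abbreviation P :: "(real^'n) set" where "P \<equiv> cone_of C"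

lemma C_iff: "c \<in> C \<longleftrightarrow> realv c \<in> P"
  using normal unfolding normal_sg_def by blast

lemma P_convex_cone: "convex_cone P"
  unfolding convex_cone_iff
proof (intro conjI ballI allI impI)
  show "0 \<in> P" unfolding cone_of_def by (auto intro!: exI[of _ "{}"])
  fix x assume "x \<in> P"
  then obtain S u where x: "finite S" "S \<subseteq> C" "\<forall>s\<in>S. u s \<ge> 0" "x = (\<Sum>s\<in>S. u s *\<^sub>R realv s)"
    unfolding cone_of_def by blast
  { fix y assume "y \<in> P"
    then obtain T v where y: "finite T" "T \<subseteq> C" "\<forall>s\<in>T. v s \<ge> 0" "y = (\<Sum>s\<in>T. v s *\<^sub>R realv s)"
      unfolding cone_of_def by blast
    let ?u = "\<lambda>s. if s \<in> S then u s else 0" and ?v = "\<lambda>s. if s \<in> T then v s else 0"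
    have "x = (\<Sum>s\<in>S \<union> T. ?u s *\<^sub>R realv s)"
      unfolding x(4) by (rule sum.mono_neutral_cong_left) (use x(1) y(1) in auto)
    moreover have "y = (\<Sum>s\<in>S \<union> T. ?v s *\<^sub>R realv s)"
      unfolding y(4) by (rule sum.mono_neutral_cong_left) (use x(1) y(1) in auto)
    ultimately have "x + y = (\<Sum>s\<in>S \<union> T. (?u s + ?v s) *\<^sub>R realv s)"
      by (simp only: scaleR_left_distrib sum.distrib)
    also have "\<dots> \<in> P" by (rule cone_ofI) (use x y in auto)
    finally show "x + y \<in> P" . }
  fix c :: real assume c: "0 \<le> c"
  have "c *\<^sub>R x = (\<Sum>s\<in>S. (c * u s) *\<^sub>R realv s)" unfolding x(4) by (simp add: scaleR_sum_right)
  also have "\<dots> \<in> P" by (rule cone_ofI) (use x c in auto)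
  finally show "c *\<^sub>R x \<in> P" .
qed

lemma P_0: "0 \<in> P" and P_add: "x \<in> P \<Longrightarrow> y \<in> P \<Longrightarrow> x + y \<in> P"
  and P_scale: "x \<in> P \<Longrightarrow> 0 \<le> t \<Longrightarrow> t *\<^sub>R x \<in> P"
  using P_convex_cone unfolding convex_cone_iff by blast+

lemma convex_cone_sum:
  assumes "convex_cone W" "\<And>s. s \<in> S \<Longrightarrow> u s \<ge> 0" "\<And>s. s \<in> S \<Longrightarrow> f s \<in> W"
  shows "(\<Sum>s\<in>S. u s *\<^sub>R f s) \<in> W"
  using assms(2,3)
  by (induction S rule: infinite_finite_induct) (use assms(1) in \<open>auto simp: convex_cone_iff\<close>)

text \<open>The finitely many generators of C already span the cone, so the facts on faces of
  polyhedra apply.\<close>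

lemma P_polyhedron: "polyhedron P"
proof -
  obtain G where G: "finite G" "C = sg_gen G"
    using affine unfolding affine_semigroup_def sg_gen_def by blast
  let ?W = "convex_cone hull (realv ` G)"
  have W: "convex_cone ?W" by (rule convex_cone_convex_cone_hull)
  have GW: "realv g \<in> ?W" if "g \<in> G" for g using that by (simp add: hull_inc)
  have GC: "g \<in> C" if "g \<in> G" for g using sg_gen_mem[OF G(1) that] G(2) by simp
  have CW: "realv c \<in> ?W" if c: "c \<in> C" for c
  proof -
    obtain k where "c = (\<Sum>g\<in>G. int (k g) *s g)" using c G(2) by (auto simp: sg_gen_def)
    then have "realv c = (\<Sum>g\<in>G. real (k g) *\<^sub>R realv g)" by (simp add: realv_sum realv_smult)
    then show ?thesis using convex_cone_sum[OF W, of G "\<lambda>g. real (k g)" realv] GW by auto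
  qed
  have "P \<subseteq> ?W"
  proof
    fix x assume "x \<in> P"
    then obtain S u where x: "finite S" "S \<subseteq> C" "\<forall>s\<in>S. u s \<ge> 0" "x = (\<Sum>s\<in>S. u s *\<^sub>R realv s)"
      unfolding cone_of_def by blast
    then show "x \<in> ?W" using convex_cone_sum[OF W, of S u realv] CW by auto
  qed
  moreover have "?W \<subseteq> P" using GC C_iff by (intro hull_minimal P_convex_cone) auto
  ultimately have "P = ?W" by blast
  then show ?thesis using polyhedron_convex_cone_hull[of "realv ` G"] G(1) by simp
qed

lemma P_convex: "convex P"
  using P_polyhedron polyhedron_imp_convex by blast

text \<open>If x is nonzero and both x and -x lie in P, some nonzero s in C occurring in x has -s in
  P; by normality -s lies in C, against the pointedness of C.\<close>

lemma P_pointed: assumes "x \<in> P" "- x \<in> P" shows "x = 0"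
proof (rule ccontr)
  assume "x \<noteq> 0"
  obtain S u where x: "finite S" "S \<subseteq> C" "\<forall>s\<in>S. u s \<ge> 0" "x = (\<Sum>s\<in>S. u s *\<^sub>R realv s)"
    using assms(1) unfolding cone_of_def by blast
  have "\<exists>s\<in>S. u s *\<^sub>R realv s \<noteq> 0"
  proof (rule ccontr)
    assume "\<not> ?thesis"
    then have "x = 0" unfolding x(4) by (intro sum.neutral) blast
    then show False using \<open>x \<noteq> 0\<close> by blast
  qed
  then obtain s where s: "s \<in> S" "u s \<noteq> 0" "realv s \<noteq> 0" by auto
  let ?r = "\<Sum>s\<in>S - {s}. u s *\<^sub>R realv s"
  have rP: "?r \<in> P" using x C_iff by (intro convex_cone_sum[OF P_convex_cone]) auto
  have "x = u s *\<^sub>R realv s + ?r" unfolding x(4) by (rule sum.remove[OF x(1) s(1)])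
  then have "- (u s *\<^sub>R realv s) = ?r + (- x)" by simp
  then have "- (u s *\<^sub>R realv s) \<in> P" using P_add[OF rP assms(2)] by simp
  then have "(1 / u s) *\<^sub>R (- (u s *\<^sub>R realv s)) \<in> P" using x(3) s by (intro P_scale) auto
  then have "realv (- s) \<in> P" using s(2) by (simp add: realv_uminus)
  then have "- s \<in> C" by (simp add: C_iff)
  then have "s \<in> C \<inter> uminus ` C" using s(1) x(2) by (auto intro!: image_eqI[of _ _ "- s"])
  then have "s = 0" using pointed unfolding pointed_def by simp
  then show False using s(3) by simp
qed

lemma zero_face: "{0} face_of P"
  unfolding face_of_def
proof (intro conjI ballI impI)
  fix a b x assume ab: "a \<in> P" "b \<in> P" "x \<in> {0::real^'n}" "x \<in> open_segment a b"
  then obtain t where t: "0 < t" "t < 1" "0 = (1 - t) *\<^sub>R a + t *\<^sub>R b" "a \<noteq> b"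
    by (auto simp: in_segment)
  have "t *\<^sub>R b = - ((1 - t) *\<^sub>R a)" using t(3) by (simp add: eq_neg_iff_add_eq_0 add.commute)
  moreover have "(1 - t) *\<^sub>R a \<in> P" "t *\<^sub>R b \<in> P" using ab t by (auto intro!: P_scale)
  ultimately have "(1 - t) *\<^sub>R a = 0" using P_pointed by metis
  then have "a = 0" using t by simp
  moreover have "b = 0" using t \<open>a = 0\<close> by simp
  ultimately show "a \<in> {0}" "b \<in> {0}" by auto
qed (use P_0 in auto)

text \<open>Faces of a polyhedron are exposed; a functional exposing the face {0} is, up to sign,
  positive on the rest of P and yields the degree.\<close>

lemma exists_degree: "\<exists>a. \<forall>x\<in>P. x \<noteq> 0 \<longrightarrow> 0 < a \<bullet> x"
proof -
  have "{0} exposed_face_of P" using exposed_face_of_polyhedron[OF P_polyhedron] zero_face by blast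
  then obtain a b where ab: "P \<subseteq> {x. a \<bullet> x \<le> b}" "{0} = P \<inter> {x. a \<bullet> x = b}"
    unfolding exposed_face_of_def by blast
  have "0 \<in> P \<inter> {x. a \<bullet> x = b}" using ab(2) by blast
  then have b: "b = 0" by simp
  have "0 < (- a) \<bullet> x" if "x \<in> P" "x \<noteq> 0" for x
  proof -
    have "a \<bullet> x \<le> 0" using ab(1) that(1) b by blast
    moreover have "a \<bullet> x \<noteq> 0" using ab(2) that b by blast
    ultimately show ?thesis by simp
  qed
  then show ?thesis by blast
qed

definition deg :: "int^'n \<Rightarrow> real" where
  "deg c = (SOME a. \<forall>x\<in>P. x \<noteq> 0 \<longrightarrow> 0 < a \<bullet> x) \<bullet> realv c"

end

sublocale normal_cone \<subseteq> positive_semigroup C deg K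
proof
  show "affine_semigroup C" by (rule affine)
  show "deg (a + b) = deg a + deg b" for a b by (simp add: deg_def realv_add inner_right_distrib)
  show "0 < deg c" if "c \<in> C" "c \<noteq> 0" for c
    using someI_ex[OF exists_degree] that realv_inj[of c 0] by (auto simp: deg_def C_iff)
qed

context normal_cone
begin

section \<open>Faces of the cone and their lattice points\<close>

definition lat :: "(real^'n) set \<Rightarrow> (int^'n) set" where
  "lat F = {c. realv c \<in> F}"

lemma faces_iff: "F \<in> faces P \<longleftrightarrow> F face_of P \<and> F \<noteq> {}"
  by (simp add: faces_def)

lemma face_cone:
  assumes "F \<in> faces P" shows "convex_cone F"
proof -
  have F: "F face_of P" "F \<noteq> {}" using assms by (auto simp: faces_iff)
  then show ?thesis using face_of_conic[of P F] P_convex_cone face_of_imp_convex[of F P]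
    by (auto simp: convex_cone_def)
qed

lemma faceD:
  assumes "F \<in> faces P"
  shows "F face_of P" "F \<subseteq> P" "0 \<in> F" "\<And>x y. x \<in> F \<Longrightarrow> y \<in> F \<Longrightarrow> x + y \<in> F"
    "\<And>x t. x \<in> F \<Longrightarrow> 0 \<le> t \<Longrightarrow> t *\<^sub>R x \<in> F" "polyhedron F" "convex F"
proof -
  show F: "F face_of P" using assms by (simp add: faces_iff)
  then show "F \<subseteq> P" by (rule face_of_imp_subset)
  show "polyhedron F" using face_of_polyhedron_polyhedron[OF P_polyhedron F] .
  then show "convex F" by (rule polyhedron_imp_convex)
qed (use face_cone[OF assms] in \<open>auto simp: convex_cone_iff\<close>)

text \<open>The face axiom for the midpoint of x and y, which lies in the cone F along with x +
  y.\<close>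

lemma face_sumD:
  assumes F: "F \<in> faces P" and xy: "x \<in> P" "y \<in> P" "x + y \<in> F"
  shows "x \<in> F" "y \<in> F"
proof -
  have half: "(1/2) *\<^sub>R (x + y) \<in> F" using faceD(5)[OF F xy(3), of "1/2"] by simp
  have "x \<in> F \<and> y \<in> F"
  proof (cases "x = y")
    case True
    have "(1/2) *\<^sub>R (y + y) = y" by (simp add: scaleR_add_right[symmetric] flip: scaleR_2)
    then show ?thesis using half True by simp
  next
    case False
    have "(1/2) *\<^sub>R (x + y) \<in> open_segment x y"
      unfolding in_segment using False by (intro conjI exI[of _ "1/2"]) (auto simp: scaleR_add_right)
    then show ?thesis using face_ofD[OF faceD(1)[OF F]] half xy by blast
  qed
  then show "x \<in> F" "y \<in> F" by auto
qed

lemma P_face: "P \<in> faces P"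
  using P_0 P_convex by (auto simp: faces_iff face_of_refl)

lemma finite_faces: "finite (faces P)"
  using finite_polyhedron_faces[OF P_polyhedron] by (rule finite_subset[rotated]) (auto simp: faces_def)

lemma lat_subset: "F \<in> faces P \<Longrightarrow> lat F \<subseteq> C"
  using faceD(2)[of F] by (auto simp: lat_def C_iff)

lemma lat_prime_face: "F \<in> faces P \<Longrightarrow> prime_face (lat F)"
  unfolding prime_face_def
proof (intro conjI ballI)
  assume F: "F \<in> faces P"
  show "lat F \<subseteq> C" by (rule lat_subset[OF F])
  show "0 \<in> lat F" using faceD(3)[OF F] by (simp add: lat_def)
  fix c h assume "c \<in> C" "h \<in> C"
  then show "c + h \<in> lat F \<longleftrightarrow> c \<in> lat F \<and> h \<in> lat F"
    using faceD(4)[OF F, of "realv c" "realv h"] face_sumD[OF F, of "realv c" "realv h"]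
    by (auto simp: lat_def C_iff realv_add)
qed

text \<open>Faces are rational: a point of F is a nonnegative combination of elements of C, and
  those with positive coefficient lie in F.\<close>

lemma span_lat:
  assumes F: "F \<in> faces P" shows "span (realv ` lat F) = span F"
proof
  show "span (realv ` lat F) \<subseteq> span F" by (intro span_mono) (auto simp: lat_def)
  have "F \<subseteq> span (realv ` lat F)"
  proof
    fix x assume xF: "x \<in> F"
    then have "x \<in> P" using faceD(2)[OF F] by blast
    then obtain S u where x: "finite S" "S \<subseteq> C" "\<forall>s\<in>S. u s \<ge> 0" "x = (\<Sum>s\<in>S. u s *\<^sub>R realv s)"
      unfolding cone_of_def by blast
    have "u s *\<^sub>R realv s \<in> span (realv ` lat F)" if s: "s \<in> S" for s
    proof (cases "u s = 0")
      case False
      let ?r = "\<Sum>s\<in>S - {s}. u s *\<^sub>R realv s"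
      have "?r \<in> P" using x C_iff by (intro convex_cone_sum[OF P_convex_cone]) auto
      moreover have "x = u s *\<^sub>R realv s + ?r" unfolding x(4) by (rule sum.remove[OF x(1) s])
      moreover have "u s *\<^sub>R realv s \<in> P" using x s C_iff by (intro P_scale) auto
      ultimately have "u s *\<^sub>R realv s \<in> F" using face_sumD(1)[OF F] xF by metis
      then have "(1 / u s) *\<^sub>R (u s *\<^sub>R realv s) \<in> F" by (rule faceD(5)[OF F]) (use x(3) s in auto)
      then have "s \<in> lat F" using False by (simp add: lat_def)
      then show ?thesis by (intro span_scale span_base) auto
    qed (simp add: span_zero)
    then show "x \<in> span (realv ` lat F)" unfolding x(4) by (rule span_sum)
  qed
  then show "span F \<subseteq> span (realv ` lat F)" by (simp add: span_minimal)
qed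

lemma affine_hull_face: "F \<in> faces P \<Longrightarrow> affine hull F = span F"
  using affine_hull_span_0[of F] faceD(3) hull_inc by metis

lemma face_eq_span: assumes "F \<in> faces P" shows "F = P \<inter> span F"
  using face_of_imp_eq_affine_Int[OF P_convex faceD(1)[OF assms]] affine_hull_face[OF assms] by blast

lemma aff_dim_face: "F \<in> faces P \<Longrightarrow> aff_dim F = int (dim F)"
  using aff_dim_zero[of F] faceD(3) hull_inc by metis

lemma dimbar_face: "F \<in> faces P \<Longrightarrow> dimbar F = int (dim F) - 1"
  by (simp add: dimbar_def aff_dim_face)

lemma face_psubset_dim:
  assumes "F \<in> faces P" "H \<in> faces P" "H \<subset> F" shows "dim H < dim F"
proof -
  have "H face_of F" using face_of_subset[OF faceD(1)[OF assms(2)]] assms(3) faceD(2)[OF assms(1)] by blast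
  then have "aff_dim H < aff_dim F" using face_of_aff_dim_lt[OF faceD(7)[OF assms(1)]] assms(3) by blast
  then show ?thesis using aff_dim_face assms by simp
qed

lemma face_of_face_P: "F \<in> faces P \<Longrightarrow> H face_of F \<Longrightarrow> H \<noteq> {} \<Longrightarrow> H \<in> faces P"
  using face_of_trans faceD(1) by (auto simp: faces_iff)

lemma exists_facet:
  assumes F: "F \<in> faces P" "F \<noteq> {0}"
  obtains H where "H \<in> faces P" "H \<subset> F" "Suc (dim H) = dim F"
proof -
  have "{0} face_of F" using face_of_subset[OF zero_face, of F] faceD[OF F(1)] by auto
  then obtain H where H: "H facet_of F"
    using face_of_polyhedron_subset_facet[OF faceD(6)[OF F(1)], of "{0}"] F(2) by blast
  then have HF: "H face_of F" "H \<noteq> {}" "aff_dim H = aff_dim F - 1" by (auto simp: facet_of_def)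
  have HP: "H \<in> faces P" using face_of_face_P[OF F(1) HF(1,2)] .
  then have "Suc (dim H) = dim F" using HF(3) aff_dim_face F(1) by simp
  moreover have "H \<subset> F" using face_of_imp_subset[OF HF(1)] calculation by auto
  ultimately show thesis using that HP by blast
qed

lemma dim_zero_face: "F \<in> faces P \<Longrightarrow> dim F = 0 \<longleftrightarrow> F = {0}"
  using faceD(3) by (auto simp: dim_eq_0)

lemma supp_face_exists:
  assumes "u \<in> P" shows "\<exists>F\<in>faces P. u \<in> rel_interior F"
proof -
  define S where "S = {F \<in> faces P. u \<in> F}"
  have "P \<in> S" using P_face assms by (simp add: S_def)
  then obtain F where F: "F \<in> S" and min: "\<And>H. H \<in> S \<Longrightarrow> dim F \<le> dim H"
    using ex_has_least_nat[of "\<lambda>F. F \<in> S" P dim] by blast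
  have FP: "F \<in> faces P" "u \<in> F" using F by (auto simp: S_def)
  have "u \<in> rel_interior F"
  proof (rule ccontr)
    assume "u \<notin> rel_interior F"
    then have "u \<in> rel_frontier F" unfolding rel_frontier_def using FP closure_subset by blast
    then obtain H where H: "H face_of F" "H \<noteq> F" "u \<in> H"
      using rel_frontier_of_polyhedron_alt[OF faceD(6)[OF FP(1)]] by blast
    then have "H \<in> S" using face_of_face_P[OF FP(1) H(1)] by (auto simp: S_def)
    moreover have "H \<subset> F" using face_of_imp_subset[OF H(1)] H(2) by blast
    ultimately show False using min[of H] face_psubset_dim[OF FP(1)] by (force simp: S_def)
  qed
  then show ?thesis using FP by blast
qed

lemma supp_face_eq:
  assumes "F \<in> faces P" "u \<in> rel_interior F" shows "supp_face P u = F"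
  unfolding supp_face_def
proof (rule the_equality)
  show "F face_of P \<and> u \<in> rel_interior F" using assms faceD(1) by blast
  show "H = F" if "H face_of P \<and> u \<in> rel_interior H" for H
    using face_of_eq[of H P F] that assms faceD(1) by blast
qed

lemma supp_face:
  assumes "u \<in> P"
  shows "supp_face P u \<in> faces P" "u \<in> rel_interior (supp_face P u)" "u \<in> supp_face P u"
  using supp_face_exists[OF assms] supp_face_eq rel_interior_subset by (metis, metis, blast)

lemma supp_face_subset_iff:
  assumes "u \<in> P" "F \<in> faces P" shows "supp_face P u \<subseteq> F \<longleftrightarrow> u \<in> F"
proof
  show "supp_face P u \<subseteq> F" if "u \<in> F"
    by (rule subset_of_face_of[OF faceD(1)[OF assms(2)]])
      (use supp_face[OF assms(1)] faceD(2) that in auto)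
qed (use supp_face[OF assms(1)] in blast)

definition sf :: "int^'n \<Rightarrow> (real^'n) set" where
  "sf c = supp_face P (realv c)"

lemma sf_face: "c \<in> C \<Longrightarrow> sf c \<in> faces P" and sf_mem: "c \<in> C \<Longrightarrow> realv c \<in> sf c"
  and sf_rel_interior: "c \<in> C \<Longrightarrow> realv c \<in> rel_interior (sf c)"
  using supp_face by (auto simp: sf_def C_iff)

lemma sf_subset_iff: "c \<in> C \<Longrightarrow> F \<in> faces P \<Longrightarrow> sf c \<subseteq> F \<longleftrightarrow> c \<in> lat F"
  using supp_face_subset_iff by (auto simp: sf_def C_iff lat_def)

lemma sf_add: assumes "c \<in> C" "h \<in> C" shows "sf c \<subseteq> sf (c + h)" "sf h \<subseteq> sf (c + h)"
proof -
  have "realv c + realv h \<in> sf (c + h)" using sf_mem[of "c + h"] assms C_add by (simp add: realv_add)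
  then have "realv c \<in> sf (c + h)" "realv h \<in> sf (c + h)"
    using face_sumD[OF sf_face] assms C_add C_iff by auto
  then show "sf c \<subseteq> sf (c + h)" "sf h \<subseteq> sf (c + h)"
    using sf_subset_iff sf_face assms C_add by (auto simp: lat_def)
qed

text \<open>Take the sum of lattice points of F forming a basis of its span: a face containing the
  sum contains every summand and hence all of F.\<close>

lemma exists_sf:
  assumes F: "F \<in> faces P" obtains c where "c \<in> C" "sf c = F"
proof -
  obtain B where B: "B \<subseteq> realv ` lat F" "independent B" "realv ` lat F \<subseteq> span B"
    using maximal_independent_subset by blast
  then have "finite B" using independent_imp_finite by blast
  then obtain B' where B': "finite B'" "B' \<subseteq> lat F" "B = realv ` B'" using B(1) finite_subset_image by metis
  have BC: "sum id A \<in> C" if "A \<subseteq> B'" for A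
    using that B'(2) lat_subset[OF F] by (intro C_sum) auto
  define c where "c = sum id B'"
  have cC: "c \<in> C" unfolding c_def using BC by blast
  have "realv c \<in> F" unfolding c_def realv_sum
  proof -
    have "(\<Sum>x\<in>B'. 1 *\<^sub>R realv (id x)) \<in> F"
      by (rule convex_cone_sum[OF face_cone[OF F]]) (use B'(2) in \<open>auto simp: lat_def\<close>)
    then show "(\<Sum>x\<in>B'. realv (id x)) \<in> F" by simp
  qed
  then have 1: "sf c \<subseteq> F" using sf_subset_iff[OF cC F] by (simp add: lat_def)
  have "B \<subseteq> sf c"
  proof
    fix x assume "x \<in> B"
    then obtain b where b: "b \<in> B'" "x = realv b" using B'(3) by blast
    have "c = b + sum id (B' - {b})" unfolding c_def using B'(1) b(1) by (simp add: sum.remove)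
    then have "sf b \<subseteq> sf c" using sf_add(1)[of b "sum id (B' - {b})"] BC[of "B' - {b}"] b(1) B'(2) lat_subset[OF F] by auto
    then show "x \<in> sf c" using sf_mem[of b] b B'(2) lat_subset[OF F] by auto
  qed
  then have "span F \<subseteq> span (sf c)" using B(3) span_lat[OF F] by (metis span_mono span_minimal subspace_span order_trans)
  then have "F \<subseteq> sf c" using face_eq_span[OF F] face_eq_span[OF sf_face[OF cC]] by blast
  then show thesis using that cC 1 by blast
qed

end

section \<open>Conic modules\<close>

lemma finite_lattice_ball: "finite {c :: int^'n. norm (realv c) \<le> M}"
proof -
  define N where "N = \<lceil>M\<rceil>"
  have "vec_nth ` {c :: int^'n. norm (realv c) \<le> M} \<subseteq> (UNIV \<rightarrow>\<^sub>E {-N..N})"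
  proof
    fix f assume "f \<in> vec_nth ` {c :: int^'n. norm (realv c) \<le> M}"
    then obtain c where c: "f = vec_nth c" "norm (realv c) \<le> M" by blast
    have "\<bar>real_of_int (c $ i)\<bar> \<le> M" for i
      using component_le_norm_cart[of "realv c" i] c(2) by (simp add: realv_def)
    then have "\<bar>c $ i\<bar> \<le> N" for i unfolding N_def
      by (metis ceiling_mono ceiling_of_int of_int_abs)
    then show "f \<in> UNIV \<rightarrow>\<^sub>E {-N..N}" by (auto simp: c(1) abs_le_iff minus_le_iff)
  qed
  moreover have "finite ((UNIV :: 'n set) \<rightarrow>\<^sub>E {-N..N})" by (intro finite_PiE) auto
  ultimately have "finite (vec_nth ` {c :: int^'n. norm (realv c) \<le> M})" by (rule finite_subset)
  then show ?thesis by (rule finite_imageD) (auto simp: inj_on_def vec_eq_iff)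
qed

context normal_cone
begin

lemma depth_ge_refl: "is_ideal R J \<Longrightarrow> depth_ge m n J J"
proof (induction n)
  case (Suc n)
  have "0 \<in> m" using is_idealD(2)[OF m] .
  moreover have "J + 0 *o J = J"
    using Suc.prems is_idealD(2)[of R J] by (auto simp: set_plus_def elt_set_times_def)
  ultimately show ?case using Suc by (auto simp: nzd_def intro!: bexI[of _ 0])
qed simp

text \<open>Depth at least n for the module with monomial basis E, demanded of every presentation of
  E as a difference of exponent sets of ideals. By \<open>depth_ge_independent\<close> a single
  presentation decides; if there is none, the condition is vacuous.\<close>

definition sq_depth :: "nat \<Rightarrow> (int^'n) set \<Rightarrow> bool" where
  "sq_depth n E \<longleftrightarrow> (\<forall>U U'. upset U \<longrightarrow> upset U' \<longrightarrow> U' \<subseteq> U \<longrightarrow> U - U' = E \<longrightarrow>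
     depth_ge m n (mspan U) (mspan U'))"

lemma sq_depthD:
  "sq_depth n E \<Longrightarrow> upset U \<Longrightarrow> upset U' \<Longrightarrow> U' \<subseteq> U \<Longrightarrow> U - U' = E \<Longrightarrow>
    depth_ge m n (mspan U) (mspan U')"
  unfolding sq_depth_def by blast

text \<open>By \<open>mono\<close> a monomial carries a piece only into itself, into zero, or into
  pieces with larger \<tau>. Hence the pieces other than one of least \<tau> span a submodule, and
  the depth lemma adds the pieces one at a time.\<close>

lemma sq_depth_filtration:
  assumes "finite I" and E: "\<And>i. i \<in> I \<Longrightarrow> sq_depth n (E i)"
    and mono: "\<And>i j c h. i \<in> I \<Longrightarrow> j \<in> I \<Longrightarrow> c \<in> E i \<Longrightarrow> h \<in> C \<Longrightarrow> c + h \<in> E j \<Longrightarrow>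
      i = j \<or> \<tau> i < (\<tau> j :: real)"
  shows "sq_depth n (\<Union>i\<in>I. E i)"
  using assms
proof (induction "card I" arbitrary: I)
  case 0
  then have I: "I = {}" by simp
  show ?case unfolding sq_depth_def I
  proof (intro allI impI)
    fix U U' assume U: "upset U" "U' \<subseteq> U" "U - U' = (\<Union>i\<in>{}. E i)"
    then have "U = U'" by blast
    then show "depth_ge m n (mspan U) (mspan U')" using depth_ge_refl[OF upset_ideal[OF U(1)]] by simp
  qed
next
  case (Suc k)
  then have "I \<noteq> {}" by auto
  then obtain i where i: "i \<in> I" and min: "\<And>j. j \<in> I \<Longrightarrow> \<tau> i \<le> \<tau> j"
    using ex_min_if_finite[of "\<tau> ` I"] Suc.prems(1) by (metis arg_min_if_finite(1) arg_min_least)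
  let ?E' = "\<Union>j\<in>I - {i}. E j"
  have IH: "sq_depth n ?E'"
  proof (rule Suc.hyps(1))
    show "k = card (I - {i})" using Suc.hyps(2) Suc.prems(1) i by simp
    show "finite (I - {i})" using Suc.prems(1) by simp
    show "sq_depth n (E j)" if "j \<in> I - {i}" for j using that Suc.prems(2) by blast
    show "a = b \<or> \<tau> a < \<tau> b"
      if "a \<in> I - {i}" "b \<in> I - {i}" "c \<in> E a" "h \<in> C" "c + h \<in> E b" for a b c h
      using that Suc.prems(3)[of a b c h] by blast
  qed
  \<comment> \<open>The case h = 0 of \<open>mono\<close> makes E i disjoint from the other
    pieces.\<close>
  have disj: "a = i" if "c \<in> E a" "c \<in> E i" "a \<in> I" for a c
    using Suc.prems(3)[of a i c 0] min[OF that(3)] that i C_0 by force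
  show ?case unfolding sq_depth_def
  proof (intro allI impI)
    fix U U' assume U: "upset U" "upset U'" "U' \<subseteq> U" "U - U' = (\<Union>i\<in>I. E i)"
    define V where "V = U' \<union> ?E'"
    have V: "upset V" unfolding upset_def
    proof (intro conjI ballI)
      show "V \<subseteq> C" using U by (auto simp: V_def upset_def)
      fix c h assume c: "c \<in> V" and h: "h \<in> C"
      show "c + h \<in> V"
      proof (cases "c + h \<in> U'")
        case False
        then have "c \<notin> U'" using U(2) h by (auto simp: upset_def)
        then obtain a where a: "a \<in> I - {i}" "c \<in> E a" using c by (auto simp: V_def)
        have "c + h \<in> U" using U(1,4) a h by (auto simp: upset_def)
        then have "c + h \<in> (\<Union>i\<in>I. E i)" using U(4) False by blast
        then obtain b where b: "b \<in> I" "c + h \<in> E b" by blast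
        have "b \<noteq> i" using Suc.prems(3)[of a b c h] a b h min[of a] by force
        then show ?thesis using b by (auto simp: V_def)
      qed (simp add: V_def)
    qed
    have "U' \<subseteq> V" "V \<subseteq> U" using U by (auto simp: V_def)
    moreover have "V - U' = ?E'" using U(4) by (auto simp: V_def)
    moreover have "U - V = E i"
    proof
      show "U - V \<subseteq> E i" using U(4) by (auto simp: V_def)
      show "E i \<subseteq> U - V" using U(4) i disj by (auto simp: V_def)
    qed
    ultimately show "depth_ge m n (mspan U) (mspan U')"
      using depth_ge_middle[OF upset_ideal upset_ideal upset_ideal, OF U(2) V U(1)]
        sq_depthD[OF IH V U(2)] sq_depthD[OF Suc.prems(2)[OF i] U(1) V]
      by (simp add: semigroup_ring_mono)
  qed
qed

lemma face_basis:
  assumes F: "F \<in> faces P"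
  obtains B where "finite B" "B \<subseteq> lat F" "card B = dim F" "span (realv ` B) = span F"
proof -
  obtain B where B: "B \<subseteq> realv ` lat F" "independent B" "realv ` lat F \<subseteq> span B" "card B = dim (realv ` lat F)"
    using basis_exists[of "realv ` lat F"] by blast
  have "finite B" using B(2) independent_imp_finite by blast
  then obtain B' where B': "finite B'" "B' \<subseteq> lat F" "B = realv ` B'" using B(1) finite_subset_image by metis
  have "card B' = card B" unfolding B'(3) by (rule card_image[symmetric]) (auto simp: inj_on_def realv_inj)
  also have "\<dots> = dim F" using B(4) span_lat[OF F] by (metis dim_span)
  finally have "card B' = dim F" .
  moreover have "span (realv ` B') = span F"
    using B(1,3) span_lat[OF F] unfolding B'(3)[symmetric]
    by (metis span_mono span_minimal subspace_span subset_antisym)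
  ultimately show thesis using that B' by blast
qed

lemma face_of_positive_combination:
  assumes F: "F \<in> faces P" and G: "G \<in> faces P"
    and B: "finite B" "B \<subseteq> lat F" "span (realv ` B) = span F"
    and u: "\<And>b. b \<in> B \<Longrightarrow> 0 < u b" and mem: "(\<Sum>b\<in>B. u b *\<^sub>R realv b) \<in> G"
  shows "F \<subseteq> G"
proof -
  have BP: "u b *\<^sub>R realv b \<in> P" if "b \<in> B" for b
    using that B(2) u[OF that] lat_subset[OF F] C_iff by (intro P_scale) auto
  have "realv b \<in> G" if b: "b \<in> B" for b
  proof -
    let ?r = "\<Sum>b\<in>B - {b}. u b *\<^sub>R realv b"
    have "?r \<in> P" using B(2) u lat_subset[OF F] C_iff
      by (intro convex_cone_sum[OF P_convex_cone]) (auto simp: less_imp_le)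
    moreover have "(\<Sum>b\<in>B. u b *\<^sub>R realv b) = u b *\<^sub>R realv b + ?r" by (rule sum.remove[OF B(1) b])
    ultimately have "u b *\<^sub>R realv b \<in> G" using face_sumD(1)[OF G BP[OF b]] mem by simp
    then have "(1 / u b) *\<^sub>R (u b *\<^sub>R realv b) \<in> G" by (rule faceD(5)[OF G]) (use u[OF b] in simp)
    then show ?thesis using u[OF b] by simp
  qed
  then have "span (realv ` B) \<subseteq> span G" by (intro span_mono) auto
  then show ?thesis using B(3) face_eq_span[OF F] face_eq_span[OF G] by blast
qed

section \<open>Generic translates of a face\<close>

definition conicset :: "(real^'n) set \<Rightarrow> real^'n \<Rightarrow> (int^'n) set" where
  "conicset G u = {c. realv c - u \<in> G}"

text \<open>v avoids all lattice translates of subspaces spanned by fewer than dim F lattice vectors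
  of span F. These translates form a countable family.\<close>

definition generic :: "(real^'n) set \<Rightarrow> real^'n \<Rightarrow> bool" where
  "generic F v \<longleftrightarrow> (\<forall>S c. finite S \<longrightarrow> realv ` S \<subseteq> span F \<longrightarrow> card S < dim F \<longrightarrow>
     v - realv c \<notin> span (realv ` S))"

text \<open>Every proper rational affine subspace of \<open>span F\<close> meets the moment curve in finitely many
  points.\<close>

lemma moment_curve_generic:
  assumes F: "F \<in> faces P" and h: "span (realv ` h ` {..<k}) = span F" and k: "k = dim F" and "0 < \<delta>"
  obtains t where "0 < t" "t < \<delta>" "generic F (\<Sum>j<k. t ^ Suc j *\<^sub>R realv (h j))"
proof -
  let ?v = "\<lambda>t::real. \<Sum>j<k. t ^ Suc j *\<^sub>R realv (h j)"
  define bad where "bad = (\<lambda>(S, c). {t. finite S \<and> realv ` S \<subseteq> span F \<and> card S < dim F \<and>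
    ?v t - realv c \<in> span (realv ` S)})"
  have fin: "finite (bad (S, c))" for S c
  proof (cases "finite S \<and> realv ` S \<subseteq> span F \<and> card S < dim F")
    case True
    have "span (realv ` S) \<subseteq> span F" using True by (simp add: span_minimal)
    moreover have "dim (realv ` S) < dim F"
      using dim_le_card'[of "realv ` S"] card_image_le[of S realv] True by auto
    ultimately have "span (realv ` S) \<subset> span F" by (metis dim_span less_irrefl psubsetI)
    then obtain a where a: "a \<noteq> 0" "a \<in> span F" "\<And>y. y \<in> span (realv ` S) \<Longrightarrow> orthogonal a y"
      using orthogonal_to_subspace_exists_gen by blast
    \<comment> \<open>The coefficients of the polynomial in t given by the inner product of a with
      v(t) - c. It is not zero, because a is a nonzero vector of span F and cannot be orthogonal to
      all \<open>h j\<close>.\<close>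
    define p where "p i = (case i of 0 \<Rightarrow> - (a \<bullet> realv c) | Suc j \<Rightarrow> a \<bullet> realv (h j))" for i
    have eval: "(\<Sum>i\<le>k. p i * t ^ i) = a \<bullet> (?v t - realv c)" for t
    proof -
      have "(\<Sum>i\<le>k. p i * t ^ i) = (\<Sum>i<Suc k. p i * t ^ i)" by (simp add: lessThan_Suc_atMost)
      also have "\<dots> = - (a \<bullet> realv c) + (\<Sum>j<k. (a \<bullet> realv (h j)) * t ^ Suc j)"
        by (subst sum.lessThan_Suc_shift) (simp add: p_def)
      also have "\<dots> = a \<bullet> (?v t - realv c)"
        by (simp add: inner_diff_right inner_sum_right mult.commute)
      finally show ?thesis .
    qed
    have "\<exists>j<k. a \<bullet> realv (h j) \<noteq> 0"
    proof (rule ccontr)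
      assume "\<not> ?thesis"
      then have "\<forall>y\<in>realv ` h ` {..<k}. orthogonal a y" by (auto simp: orthogonal_def)
      then have "orthogonal a a" using orthogonal_to_span[of a "realv ` h ` {..<k}" a] a(2) h by blast
      then show False using a(1) by (simp add: orthogonal_def)
    qed
    then obtain j where "j < k" "p (Suc j) \<noteq> 0" by (auto simp: p_def)
    then have "finite {t. (\<Sum>i\<le>k. p i * t ^ i) = 0}"
      by (subst polyfun_finite_roots) (auto intro!: exI[of _ "Suc j"])
    moreover have "bad (S, c) \<subseteq> {t. (\<Sum>i\<le>k. p i * t ^ i) = 0}"
      using a(3) unfolding eval by (auto simp: bad_def orthogonal_def)
    ultimately show ?thesis by (rule finite_subset[rotated])
  next
    case False then show ?thesis by (auto simp: bad_def)
  qed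
  \<comment> \<open>There are countably many pairs of a finite set and a lattice point, each
    excluding finitely many t, while the interval is uncountable.\<close>
  define Bad where "Bad = (\<Union>x\<in>{S :: (int^'n) set. finite S} \<times> (UNIV :: (int^'n) set). bad x)"
  have "countable Bad" unfolding Bad_def
    using fin by (intro countable_UN countable_SIGMA countable_Collect_finite) (auto intro: countable_finite)
  moreover have "uncountable {0<..<\<delta>}" using \<open>0 < \<delta>\<close> by (simp add: uncountable_open_interval)
  ultimately have "\<not> {0<..<\<delta>} \<subseteq> Bad" using countable_subset by blast
  then obtain t where "t \<in> {0<..<\<delta>}" "t \<notin> Bad" by blast
  then have t: "0 < t" "t < \<delta>" "t \<notin> Bad" by auto
  have "generic F (?v t)" unfolding generic_def
  proof (intro allI impI notI)
    fix S c assume *: "finite S" "realv ` S \<subseteq> span F" "card S < dim F" "?v t - realv c \<in> span (realv ` S)"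
    then have "t \<in> bad (S, c)" by (simp add: bad_def)
    then show False using t(3) *(1) unfolding Bad_def by blast
  qed
  then show thesis using that t by blast
qed

text \<open>v is a generic point in the relative interior of F, close to 0. For every lattice point
  c interior to F the difference c - v has to stay in F, with one bound on v for all c. Such a bound
  exists because c is, up to adding an element of F, the sum of the set T of generators occurring in
  it, and there are finitely many sets T.\<close>

lemma exists_generic:
  assumes F: "F \<in> faces P"
  obtains v where "v \<in> F" "generic F v" "conicset F v = {c \<in> C. sf c = F}"
proof -
  obtain B where B: "finite B" "B \<subseteq> lat F" "card B = dim F" "span (realv ` B) = span F"
    using face_basis[OF F] by blast
  define k where "k = dim F"
  obtain h where h: "bij_betw h {..<k} B"
    using ex_bij_betw_nat_finite[OF B(1)] B(3) by (auto simp: k_def lessThan_atLeast0)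
  have hB: "h ` {..<k} = B" using h by (simp add: bij_betw_def)
  obtain G where G: "finite G" "C = sg_gen G" using C_gen .
  define Ts where "Ts = {T. T \<subseteq> G \<and> realv (sum id T) \<in> rel_interior F}"
  have finTs: "finite Ts" unfolding Ts_def using G(1) by simp
  have "\<forall>T\<in>Ts. \<exists>e>0. ball (realv (sum id T)) e \<inter> affine hull F \<subseteq> F"
    unfolding Ts_def mem_rel_interior_ball by blast
  then obtain e where e: "\<And>T. T \<in> Ts \<Longrightarrow> e T > 0"
    "\<And>T. T \<in> Ts \<Longrightarrow> ball (realv (sum id T)) (e T) \<inter> affine hull F \<subseteq> F" by metis
  define e0 where "e0 = Min (insert 1 (e ` Ts))"
  have e0: "e0 > 0" unfolding e0_def using finTs e(1) by (subst Min_gr_iff) auto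
  have e0le: "e0 \<le> e T" if "T \<in> Ts" for T unfolding e0_def using finTs that by (intro Min_le) auto
  define M where "M = (\<Sum>j<k. norm (realv (h j)))"
  have M0: "M \<ge> 0" unfolding M_def by (intro sum_nonneg) auto
  \<comment> \<open>The bound 1 makes all powers of t at most t, hence norm v <= t M < e0; M + 1
    avoids a division by zero.\<close>
  define \<delta> where "\<delta> = min 1 (e0 / (M + 1))"
  have \<delta>: "\<delta> > 0" using e0 M0 by (simp add: \<delta>_def)
  have "span (realv ` h ` {..<k}) = span F" using B(4) hB by simp
  then obtain t where t: "0 < t" "t < \<delta>" "generic F (\<Sum>j<k. t ^ Suc j *\<^sub>R realv (h j))"
    using moment_curve_generic[OF F _ k_def \<delta>] by blast
  define v where "v = (\<Sum>j<k. t ^ Suc j *\<^sub>R realv (h j))"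
  have hF: "realv (h j) \<in> F" if "j < k" for j using hB B(2) that by (auto simp: lat_def)
  have vF: "v \<in> F" unfolding v_def by (rule convex_cone_sum[OF face_cone[OF F]]) (use t hF in auto)
  \<comment> \<open>The coefficients of v with respect to B; their positivity keeps v out of all
    proper faces of F.\<close>
  define u where "u b = t ^ Suc (the_inv_into {..<k} h b)" for b
  have "v = (\<Sum>j<k. u (h j) *\<^sub>R realv (h j))" unfolding v_def u_def
    using h by (intro sum.cong) (auto simp: bij_betw_def the_inv_into_f_f)
  also have "\<dots> = (\<Sum>b\<in>B. u b *\<^sub>R realv b)" using sum.reindex_bij_betw[OF h, of "\<lambda>b. u b *\<^sub>R realv b"] .
  finally have vsum: "v = (\<Sum>b\<in>B. u b *\<^sub>R realv b)" .
  have "norm v \<le> (\<Sum>j<k. t * norm (realv (h j)))" unfolding v_def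
  proof (rule sum_norm_le)
    fix j
    have "t ^ Suc j \<le> t ^ 1" using t \<delta>_def by (intro power_decreasing) auto
    then show "norm (t ^ Suc j *\<^sub>R realv (h j)) \<le> t * norm (realv (h j))"
      using t(1) by (simp add: abs_mult mult_right_mono del: power_Suc)
  qed
  also have "\<dots> = t * M" by (simp add: M_def sum_distrib_left)
  also have "\<dots> \<le> t * (M + 1)" using t by simp
  also have "\<dots> < e0 / (M + 1) * (M + 1)" using t M0 by (intro mult_strict_right_mono) (auto simp: \<delta>_def)
  also have "\<dots> = e0" using M0 by simp
  finally have vsmall: "norm v < e0" .
  have "conicset F v = {c \<in> C. sf c = F}"
  proof
    show "conicset F v \<subseteq> {c \<in> C. sf c = F}"
    proof
      fix c assume "c \<in> conicset F v"
      then have c: "realv c - v \<in> F" by (simp add: conicset_def)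
      then have cF: "realv c \<in> F" using faceD(4)[OF F c vF] by simp
      then have cC: "c \<in> C" using faceD(2)[OF F] C_iff by blast
      have "v + (realv c - v) \<in> sf c" using sf_mem[OF cC] by simp
      then have "v \<in> sf c" using face_sumD(1)[OF sf_face[OF cC], of v "realv c - v"] vF c faceD(2)[OF F] by blast
      then have "F \<subseteq> sf c" unfolding vsum
        by (rule face_of_positive_combination[OF F sf_face[OF cC] B(1,2,4), rotated]) (use t in \<open>simp add: u_def\<close>)
      moreover have "sf c \<subseteq> F" using sf_subset_iff[OF cC F] cF by (simp add: lat_def)
      ultimately show "c \<in> {c \<in> C. sf c = F}" using cC by blast
    qed
    show "{c \<in> C. sf c = F} \<subseteq> conicset F v"
    proof
      fix c assume "c \<in> {c \<in> C. sf c = F}"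
      then have c: "c \<in> C" "sf c = F" by auto
      then obtain n where n: "c = (\<Sum>g\<in>G. int (n g) *s g)" using G(2) by (auto simp: sg_gen_def)
      define T where "T = {g \<in> G. n g \<noteq> 0}"
      have finT: "finite T" using G(1) by (simp add: T_def)
      have GC: "g \<in> C" if "g \<in> G" for g using sg_gen_mem[OF G(1) that] G(2) by simp
      have cT: "realv c = (\<Sum>g\<in>T. real (n g) *\<^sub>R realv g)"
      proof -
        have "realv c = (\<Sum>g\<in>G. real (n g) *\<^sub>R realv g)" by (simp add: n realv_sum realv_smult)
        also have "\<dots> = (\<Sum>g\<in>T. real (n g) *\<^sub>R realv g)"
          by (rule sum.mono_neutral_right) (use G(1) in \<open>auto simp: T_def\<close>)
        finally show ?thesis .
      qed
      let ?r = "\<Sum>g\<in>T. real (n g - 1) *\<^sub>R realv g"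
      have split: "realv c = realv (sum id T) + ?r"
      proof -
        have "realv c = (\<Sum>g\<in>T. realv g + real (n g - 1) *\<^sub>R realv g)"
          unfolding cT by (intro sum.cong) (auto simp: T_def of_nat_diff scaleR_left_diff_distrib)
        then show ?thesis by (simp add: sum.distrib realv_sum)
      qed
      have GP: "realv g \<in> P" if "g \<in> T" for g using that GC C_iff by (auto simp: T_def)
      have sP: "realv (sum id T) \<in> P"
        using convex_cone_sum[OF P_convex_cone, of T "\<lambda>_. 1" realv] GP by (simp add: realv_sum)
      have rP: "?r \<in> P" by (rule convex_cone_sum[OF P_convex_cone]) (use GP in auto)
      have "realv (sum id T) + ?r \<in> F" using split sf_mem[OF c(1)] c(2) by simp
      then have rF: "?r \<in> F" and sF: "realv (sum id T) \<in> F" using face_sumD[OF F sP rP] by auto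
      text \<open>The support face of the sum of the generators occurring in \<open>c\<close> already contains \<open>c\<close>.\<close>
      have sC: "sum id T \<in> C" using sP C_iff by simp
      have "realv g \<in> sf (sum id T)" if g: "g \<in> T" for g
      proof -
        have "realv (sum id T) = realv g + realv (sum id (T - {g}))"
          using finT g by (simp add: sum.remove realv_add)
        moreover have "realv (sum id (T - {g})) \<in> P"
          using convex_cone_sum[OF P_convex_cone, of "T - {g}" "\<lambda>_. 1" realv] GP by (simp add: realv_sum)
        ultimately show ?thesis using face_sumD(1)[OF sf_face[OF sC] GP[OF g]] sf_mem[OF sC] by simp
      qed
      then have "realv c \<in> sf (sum id T)" unfolding cT
        by (intro convex_cone_sum[OF face_cone[OF sf_face[OF sC]]]) auto
      then have "sf c \<subseteq> sf (sum id T)" using sf_subset_iff[OF c(1) sf_face[OF sC]] by (simp add: lat_def)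
      moreover have "sf (sum id T) \<subseteq> F" using sf_subset_iff[OF sC F] sF by (simp add: lat_def)
      ultimately have "sf (sum id T) = F" using c(2) by blast
      then have "T \<in> Ts" using sf_rel_interior[OF sC] by (auto simp: Ts_def T_def)
      then have "ball (realv (sum id T)) e0 \<inter> span F \<subseteq> F"
        using e(2)[of T] e0le[of T] affine_hull_face[OF F] by (force simp: subset_ball)
      moreover have "realv (sum id T) - v \<in> ball (realv (sum id T)) e0" using vsmall by (simp add: dist_norm)
      moreover have "realv (sum id T) - v \<in> span F" using sF vF by (intro span_diff span_base)
      ultimately have "realv (sum id T) - v \<in> F" by blast
      then have "(realv (sum id T) - v) + ?r \<in> F" using faceD(4)[OF F _ rF] by blast
      moreover have "realv c - v = (realv (sum id T) - v) + ?r" unfolding split by simp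
      ultimately show "c \<in> conicset F v" unfolding conicset_def mem_Collect_eq by metis
    qed
  qed
  then show thesis using that vF t(3) unfolding v_def[symmetric] by blast
qed


text \<open>Such a c puts v - c into the span of S, g and a basis of H, and genericity demands at
  least dim F vectors there.\<close>

lemma generic_avoids:
  assumes F: "F \<in> faces P" and v: "generic F v"
    and S: "finite S" "realv ` S \<subseteq> span F" "u - v \<in> span (realv ` S)"
    and H: "H \<in> faces P" "H \<subseteq> F" and g: "realv g \<in> F"
    and c: "realv c - (u + s *\<^sub>R realv g) \<in> H"
  shows "dim F \<le> Suc (card S + dim H)"
proof (rule ccontr)
  assume small: "\<not> ?thesis"
  obtain B where B: "finite B" "B \<subseteq> lat H" "card B = dim H" "span (realv ` B) = span H"
    using face_basis[OF H(1)] by blast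
  let ?T = "insert g (S \<union> B)"
  have "card ?T \<le> Suc (card S + card B)"
    by (rule order_trans[OF card_insert_le_m1]) (auto intro: card_Un_le)
  then have "card ?T < dim F" using small B(3) by linarith
  moreover have "realv ` ?T \<subseteq> span F" using S(2) g B(2) H(2) by (auto simp: lat_def intro: span_base)
  moreover have "v - realv c \<in> span (realv ` ?T)"
  proof -
    have 1: "u - v \<in> span (realv ` ?T)" using S(3) span_mono[of "realv ` S" "realv ` ?T"] by blast
    have 2: "realv g \<in> span (realv ` ?T)" by (intro span_base) auto
    have "realv c - (u + s *\<^sub>R realv g) \<in> span (realv ` B)" using c B(4) span_base by blast
    then have 3: "realv c - (u + s *\<^sub>R realv g) \<in> span (realv ` ?T)"
      using span_mono[of "realv ` B" "realv ` ?T"] by blast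
    have "v - realv c = - (u - v) - (realv c - (u + s *\<^sub>R realv g)) - s *\<^sub>R realv g" by simp
    then show ?thesis using 1 2 3 by (metis span_diff span_neg span_scale)
  qed
  ultimately show False using v S(1) B(1) unfolding generic_def by (meson finite.insertI finite_UnI)
qed

text \<open>As g is not in span H, a lattice point c determines s. Subtracting lattice vectors of H
  from c does not change s and brings c into a bounded region, which has finitely many lattice
  points.\<close>

lemma finite_exit_times:
  assumes H: "H \<in> faces P" and g: "realv g \<in> P" "realv g \<notin> H"
  shows "finite {s. 0 \<le> s \<and> s < 1 \<and> conicset H (u + s *\<^sub>R realv g) \<noteq> {}}"
proof -
  have gH: "realv g \<notin> span H" using g face_eq_span[OF H] by blast
  obtain B where B: "finite B" "B \<subseteq> lat H" "card B = dim H" "span (realv ` B) = span H"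
    using face_basis[OF H] by blast
  define M where "M = norm u + norm (realv g) + (\<Sum>b\<in>B. norm (realv b))"
  let ?X = "{x. norm (realv x) \<le> M}"
  define f where "f x = (THE s. realv x - u - s *\<^sub>R realv g \<in> span H)" for x
  have f: "f x = s" if "realv x - u - s *\<^sub>R realv g \<in> span H" for x s
    unfolding f_def
  proof (rule the_equality)
    show "realv x - u - s *\<^sub>R realv g \<in> span H" by (rule that)
    fix s' assume s': "realv x - u - s' *\<^sub>R realv g \<in> span H"
    have "(s' - s) *\<^sub>R realv g = (realv x - u - s *\<^sub>R realv g) - (realv x - u - s' *\<^sub>R realv g)"
      by (simp add: scaleR_left_diff_distrib)
    also have "\<dots> \<in> span H" using that s' by (rule span_diff)
    finally have "(s' - s) *\<^sub>R realv g \<in> span H" .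
    then have "s' - s \<noteq> 0 \<Longrightarrow> realv g \<in> span H" using span_scale[of "(s' - s) *\<^sub>R realv g" H "1 / (s' - s)"] by simp
    then show "s' = s" using gH by auto
  qed
  have "{s. 0 \<le> s \<and> s < 1 \<and> conicset H (u + s *\<^sub>R realv g) \<noteq> {}} \<subseteq> f ` ?X"
  proof
    fix s assume "s \<in> {s. 0 \<le> s \<and> s < 1 \<and> conicset H (u + s *\<^sub>R realv g) \<noteq> {}}"
    then obtain c where s: "0 \<le> s" "s < 1" and c: "realv c - (u + s *\<^sub>R realv g) \<in> H"
      by (auto simp: conicset_def)
    have inj: "inj_on realv B" by (auto simp: inj_on_def realv_inj)
    have "realv c - (u + s *\<^sub>R realv g) \<in> span (realv ` B)" using c B(4) span_base by blast
    then obtain w where w: "realv c - (u + s *\<^sub>R realv g) = (\<Sum>x\<in>realv ` B. w x *\<^sub>R x)"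
      using span_finite[of "realv ` B"] B(1) by auto
    define \<beta> where "\<beta> b = w (realv b)" for b
    have \<beta>: "realv c = u + s *\<^sub>R realv g + (\<Sum>b\<in>B. \<beta> b *\<^sub>R realv b)"
      using w by (simp add: sum.reindex[OF inj] \<beta>_def algebra_simps)
    \<comment> \<open>Only the fractional parts of the coordinates along B are kept, which bounds
      the norm of x by M.\<close>
    define x where "x = c - (\<Sum>b\<in>B. \<lfloor>\<beta> b\<rfloor> *s b)"
    have xr: "realv x = u + s *\<^sub>R realv g + (\<Sum>b\<in>B. frac (\<beta> b) *\<^sub>R realv b)"
      unfolding x_def realv_diff \<beta> realv_sum realv_smult frac_def
      by (simp add: scaleR_left_diff_distrib sum_subtractf)
    have "norm (realv x) \<le> norm u + norm (s *\<^sub>R realv g) + norm (\<Sum>b\<in>B. frac (\<beta> b) *\<^sub>R realv b)"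
      unfolding xr using norm_triangle_ineq[of "u + s *\<^sub>R realv g"] norm_triangle_ineq[of u "s *\<^sub>R realv g"]
      by (meson add_right_mono order_trans)
    moreover have "norm (s *\<^sub>R realv g) \<le> norm (realv g)" using s by (simp add: mult_left_le_one_le)
    moreover have "norm (\<Sum>b\<in>B. frac (\<beta> b) *\<^sub>R realv b) \<le> (\<Sum>b\<in>B. norm (realv b))"
    proof (rule sum_norm_le)
      fix b
      show "norm (frac (\<beta> b) *\<^sub>R realv b) \<le> norm (realv b)"
        using frac_lt_1[of "\<beta> b"] frac_ge_0[of "\<beta> b"] by (simp add: mult_left_le_one_le)
    qed
    ultimately have "x \<in> ?X" unfolding M_def by simp
    moreover have "f x = s"
    proof (rule f)
      have "realv x - u - s *\<^sub>R realv g = (\<Sum>b\<in>B. frac (\<beta> b) *\<^sub>R realv b)" unfolding xr by simp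
      also have "\<dots> \<in> span H" using B(2) by (intro span_sum span_scale span_base) (auto simp: lat_def)
      finally show "realv x - u - s *\<^sub>R realv g \<in> span H" .
    qed
    ultimately show "s \<in> f ` ?X" by blast
  qed
  then show ?thesis using finite_lattice_ball finite_subset by blast
qed

text \<open>Walk from \<open>c - u\<close> in direction \<open>-g\<close> until the boundary of \<open>G\<close> is reached.\<close>

lemma exit_face:
  assumes G: "G \<in> faces P" and g: "g \<in> lat G" and y: "y \<in> G" "y - realv g \<notin> G"
  obtains H s where "H \<in> faces P" "H \<subset> G" "realv g \<notin> H" "0 \<le> s" "s < 1" "y - s *\<^sub>R realv g \<in> H"
proof -
  define A where "A = {s \<in> {0..1}. y - s *\<^sub>R realv g \<in> G}"
  have "closed G" using faceD(6)[OF G] polyhedron_imp_closed by blast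
  then have "closed ((\<lambda>s. y - s *\<^sub>R realv g) -` G)"
    by (intro continuous_closed_vimage) (auto intro!: continuous_intros)
  then have "compact ({0..1} \<inter> (\<lambda>s. y - s *\<^sub>R realv g) -` G)" by (intro compact_Int_closed) auto
  moreover have "A = {0..1} \<inter> (\<lambda>s. y - s *\<^sub>R realv g) -` G" by (auto simp: A_def)
  ultimately have "compact A" by simp
  moreover have "0 \<in> A" using y(1) by (simp add: A_def)
  ultimately obtain s where s: "s \<in> A" and max: "\<And>t. t \<in> A \<Longrightarrow> t \<le> s"
    using compact_attains_sup[of A] by blast
  have s1: "s < 1" using s y(2) by (cases "s = 1") (auto simp: A_def)
  have s0: "0 \<le> s" using s by (simp add: A_def)
  define z where "z = y - s *\<^sub>R realv g"
  have zG: "z \<in> G" using s by (simp add: A_def z_def)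
  then have zP: "z \<in> P" using faceD(2)[OF G] by blast
  define H where "H = supp_face P z"
  have H: "H \<in> faces P" "z \<in> rel_interior H" "z \<in> H" using supp_face[OF zP] by (auto simp: H_def)
  have HG: "H \<subseteq> G" using supp_face_subset_iff[OF zP G] zG by (simp add: H_def)
  have gH: "realv g \<notin> H"
  proof
    assume gH: "realv g \<in> H"
    obtain e where e: "e > 0" "ball z e \<inter> affine hull H \<subseteq> H" using H(2) unfolding mem_rel_interior_ball by blast
    \<comment> \<open>Were g in H, the point z could move a further t along -g within H, past the
      maximal s. This t fits into the ball around z and keeps s + t at most 1.\<close>
    define t where "t = min (1 - s) (e / (2 * (norm (realv g) + 1)))"
    have t: "t > 0" using s1 e(1) by (simp add: t_def add_nonneg_pos)
    have "t * norm (realv g) \<le> e / (2 * (norm (realv g) + 1)) * norm (realv g)"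
      by (intro mult_right_mono) (auto simp: t_def)
    also have "\<dots> < e" using e(1) by (simp add: divide_simps) (smt (verit) mult_nonneg_nonneg norm_ge_zero mult_pos_pos)
    finally have "z - t *\<^sub>R realv g \<in> ball z e" using t by (simp add: dist_norm)
    moreover have "z - t *\<^sub>R realv g \<in> affine hull H"
      unfolding affine_hull_face[OF H(1)] using H(3) gH by (intro span_diff span_scale span_base)
    ultimately have "z - t *\<^sub>R realv g \<in> G" using e(2) HG by blast
    then have "s + t \<in> A" using s0 t by (simp add: A_def z_def scaleR_add_left t_def algebra_simps)
    then show False using max[of "s + t"] t by simp
  qed
  then have "H \<noteq> G" using g by (auto simp: lat_def)
  then show thesis using that[OF H(1) _ gH s0 s1] HG H(3) by (auto simp: z_def)
qed

text \<open>Induction on dim G. S collects the directions in which u has been moved away from v. The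
  budget \<open>card S + n \<le> dim F\<close> is preserved, since passing to a facet lowers n by
  one and adds at most one direction, and it leaves enough genericity to rule out lattice points on
  faces of G of codimension two or more.\<close>

theorem conic_depth:
  assumes F: "F \<in> faces P" and v: "generic F v"
  shows "G \<in> faces P \<Longrightarrow> G \<subseteq> F \<Longrightarrow> dim G = n \<Longrightarrow> u \<in> F \<Longrightarrow> finite S \<Longrightarrow> realv ` S \<subseteq> span F \<Longrightarrow>
    card S + n \<le> dim F \<Longrightarrow> u - v \<in> span (realv ` S) \<Longrightarrow> sq_depth n (conicset G u)"
proof (induction n arbitrary: G u S)
  case 0
  then show ?case by (simp add: sq_depth_def)
next
  case (Suc n)
  note G = Suc.prems(1,2) and dimG = Suc.prems(3) and uF = Suc.prems(4) and S = Suc.prems(5-8)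
  have GP: "G \<subseteq> P" using faceD(2)[OF G(1)] .
  have "\<exists>g\<in>lat G. g \<noteq> 0"
  proof (rule ccontr)
    assume "\<not> ?thesis"
    then have "realv ` lat G \<subseteq> {0}" by auto
    then have "dim (realv ` lat G) = 0" by (simp only: dim_eq_0)
    then show False using dimG span_lat[OF G(1)] by (metis dim_span nat.distinct(1))
  qed
  then obtain g where g: "g \<in> lat G" "g \<noteq> 0" by blast
  have gG: "realv g \<in> G" and gP: "realv g \<in> P" and gF: "realv g \<in> F" and gC: "g \<in> C"
    using g(1) GP G(2) C_iff by (auto simp: lat_def)
  define E where "E = conicset G u - conicset G (u + realv g)"
  \<comment> \<open>The points that survive division by x^g are sorted by the facet H through which
    they leave and by the time s of leaving.\<close>
  define I where "I = (SIGMA H:{H \<in> faces P. H \<subset> G \<and> dim H = n \<and> realv g \<notin> H}.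
    {s. 0 \<le> s \<and> s < 1 \<and> conicset H (u + s *\<^sub>R realv g) \<noteq> {}})"
  define L where "L i = conicset (fst i) (u + snd i *\<^sub>R realv g)" for i
  have fin: "finite I" unfolding I_def
    using finite_faces finite_exit_times gP by (intro finite_SigmaI) auto
  have avoid: "\<not> dim H < n" if "H \<in> faces P" "H \<subseteq> G" "realv c - (u + s *\<^sub>R realv g) \<in> H" for H c s
    using generic_avoids[OF F v S(1,2,4) that(1) _ gF that(3)] that(2) G(2) S(3) by fastforce
  have sq: "sq_depth n (L i)" if i: "i \<in> I" for i
  proof -
    obtain H s where Hs: "i = (H, s)" by (cases i)
    have H: "H \<in> faces P" "H \<subseteq> F" "dim H = n" and s: "0 \<le> s" using i G(2) by (auto simp: I_def Hs)
    have "sq_depth n (conicset H (u + s *\<^sub>R realv g))"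
    proof (rule Suc.IH[OF H])
      show "u + s *\<^sub>R realv g \<in> F" using faceD(4,5)[OF F] uF gF s by blast
      show "finite (insert g S)" using S(1) by simp
      show "realv ` insert g S \<subseteq> span F" using S(2) gF by (auto intro: span_base)
      show "card (insert g S) + n \<le> dim F" using S(3) card_insert_le_m1[of "Suc (card S)" S g] by simp
      have "u + s *\<^sub>R realv g - v = (u - v) + s *\<^sub>R realv g" by simp
      also have "\<dots> \<in> span (realv ` insert g S)"
        using S(4) span_mono[of "realv ` S" "realv ` insert g S"]
        by (intro span_add span_scale) (auto intro: span_base)
      finally show "u + s *\<^sub>R realv g - v \<in> span (realv ` insert g S)" .
    qed
    then show ?thesis by (simp add: L_def Hs)
  qed
  have cover: "(\<Union>i\<in>I. L i) = E"
  proof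
    show "(\<Union>i\<in>I. L i) \<subseteq> E"
    proof
      fix c assume "c \<in> (\<Union>i\<in>I. L i)"
      then obtain H s where H: "H \<in> faces P" "H \<subset> G" "realv g \<notin> H" and s: "0 \<le> s" "s < 1"
        and c: "realv c - (u + s *\<^sub>R realv g) \<in> H" by (auto simp: I_def L_def conicset_def)
      have "(realv c - (u + s *\<^sub>R realv g)) + s *\<^sub>R realv g \<in> G"
        using faceD(4,5)[OF G(1)] c H(2) gG s(1) by blast
      then have "realv c - u \<in> G" by simp
      moreover have "realv c - (u + realv g) \<notin> G"
      proof
        assume *: "realv c - (u + realv g) \<in> G"
        have "realv c - (u + s *\<^sub>R realv g) = (realv c - (u + realv g)) + (1 - s) *\<^sub>R realv g"
          by (simp add: algebra_simps)
        moreover have "(1 - s) *\<^sub>R realv g \<in> P" using gP s by (intro P_scale) auto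
        ultimately have "(1 - s) *\<^sub>R realv g \<in> H" using face_sumD(2)[OF H(1)] c * GP by (metis subsetD)
        then have "(1 / (1 - s)) *\<^sub>R (1 - s) *\<^sub>R realv g \<in> H" by (rule faceD(5)[OF H(1)]) (use s in simp)
        then show False using H(3) s by simp
      qed
      ultimately show "c \<in> E" by (simp add: E_def conicset_def)
    qed
    show "E \<subseteq> (\<Union>i\<in>I. L i)"
    proof
      fix c assume "c \<in> E"
      then have "realv c - u \<in> G" "realv c - u - realv g \<notin> G"
        by (auto simp: E_def conicset_def diff_diff_eq)
      then obtain H s where H: "H \<in> faces P" "H \<subset> G" "realv g \<notin> H" and s: "0 \<le> s" "s < 1"
        and "realv c - u - s *\<^sub>R realv g \<in> H" using exit_face[OF G(1) g(1)] by metis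
      then have c: "realv c - (u + s *\<^sub>R realv g) \<in> H" by (simp add: diff_diff_eq)
      have "dim H < Suc n" using face_psubset_dim[OF G(1) H(1,2)] dimG by simp
      then have "dim H = n" using avoid[OF H(1) _ c] H(2) by force
      then have "(H, s) \<in> I" "c \<in> L (H, s)" using H s c by (auto simp: I_def L_def conicset_def)
      then show "c \<in> (\<Union>i\<in>I. L i)" by blast
    qed
  qed
  have sqE: "sq_depth n E" unfolding cover[symmetric]
  proof (rule sq_depth_filtration[where \<tau> = snd, OF fin sq])
    fix i j c h assume ij: "i \<in> I" "j \<in> I" and c: "c \<in> L i" and h: "h \<in> C" and ch: "c + h \<in> L j"
    obtain H s H' s' where e: "i = (H, s)" "j = (H', s')" by (cases i, cases j)
    have H: "H \<in> faces P" "H \<subset> G" "realv g \<notin> H" "dim H = n" and H': "H' \<in> faces P" "H' \<subset> G" "realv g \<notin> H'" "dim H' = n"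
      using ij by (auto simp: I_def e)
    define y where "y = realv c - (u + s *\<^sub>R realv g)"
    have y: "y \<in> H" using c by (simp add: y_def L_def e conicset_def)
    have yP: "y \<in> P" using y H(2) GP by blast
    have hP: "realv h \<in> P" using h C_iff by blast
    \<comment> \<open>The base points differ by (s - s') g. If s' < s, all three summands lie in P,
      so the face H' would contain g; hence exit times cannot decrease under multiplication.\<close>
    have z: "y + realv h + (s - s') *\<^sub>R realv g \<in> H'"
      using ch by (simp add: y_def L_def e conicset_def realv_add algebra_simps)
    show "i = j \<or> snd i < snd j"
    proof (cases "s' < s")
      case True
      have "(s - s') *\<^sub>R realv g \<in> P" using gP True by (intro P_scale) auto
      then have "(s - s') *\<^sub>R realv g \<in> H'" using face_sumD(2)[OF H'(1) P_add[OF yP hP]] z by blast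
      then have "(1 / (s - s')) *\<^sub>R (s - s') *\<^sub>R realv g \<in> H'" by (rule faceD(5)[OF H'(1)]) (use True in simp)
      then show ?thesis using H'(3) True by simp
    next
      case False
      show ?thesis
      proof (cases "s = s'")
        case True
        have yH': "y \<in> H'" using face_sumD(1)[OF H'(1) yP hP] z True by simp
        have "H = H'"
        proof (rule ccontr)
          assume ne: "H \<noteq> H'"
          \<comment> \<open>For equal times y lies in both facets; if these differ, its support face
            has smaller dimension, which genericity excludes.\<close>
          let ?Q = "supp_face P y"
          have Q: "?Q \<in> faces P" "?Q \<subseteq> H" "?Q \<subseteq> H'" "y \<in> ?Q"
            using supp_face[OF yP] supp_face_subset_iff[OF yP] H(1) H'(1) y yH' by auto
          then have "?Q \<subset> H \<or> ?Q \<subset> H'" using ne by blast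
          then have "dim ?Q < n" using face_psubset_dim Q(1) H H' by metis
          then show False using avoid[of ?Q c s] Q H(2) by (auto simp: y_def)
        qed
        then show ?thesis using True by (simp add: e)
      qed (use False in \<open>simp add: e\<close>)
    qed
  qed
  show ?case unfolding sq_depth_def
  proof (intro allI impI)
    fix U U' assume U: "upset U" "upset U'" "U' \<subseteq> U" "U - U' = conicset G u"
    have step: "c + g \<in> conicset G u" if "c \<in> conicset G u" for c
    proof -
      have "(realv c - u) + realv g \<in> G" using that faceD(4)[OF G(1) _ gG] by (simp add: conicset_def)
      then show ?thesis by (simp add: conicset_def realv_add algebra_simps)
    qed
    \<comment> \<open>u + G is closed under adding g, so x^g maps the monomial basis injectively
      into itself.\<close>
    have "nzd (monom g) (mspan U) (mspan U')" unfolding nzd_def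
    proof (intro ballI impI)
      fix a assume a: "a \<in> mspan U" "monom g * a \<in> mspan U'"
      have "c \<in> U'" if c: "c \<in> Poly_Mapping.keys a" for c
      proof (rule ccontr)
        assume "c \<notin> U'"
        then have "c \<in> conicset G u" using c a(1) U(4) by (auto simp: mem_semigroup_ring)
        then have "c + g \<notin> U'" using step U(4) by blast
        moreover have "Poly_Mapping.lookup (monom g * a) (c + g) = Poly_Mapping.lookup a c"
          by (simp add: monom_def lookup_single_times)
        then have "c + g \<in> Poly_Mapping.keys (monom g * a)" using c by (simp add: in_keys_iff)
        ultimately show False using a(2) by (auto simp: mem_semigroup_ring)
      qed
      then show "a \<in> mspan U'" by (auto simp: mem_semigroup_ring)
    qed
    moreover have "depth_ge m n (mspan U) (mspan U' + monom g *o mspan U)"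
      unfolding monom_smult semigroup_ring_plus
    proof (rule sq_depthD[OF sqE U(1)])
      show "upset (U' \<union> (+) g ` U)" using upset_Un upset_translate U gC by blast
      show "U' \<union> (+) g ` U \<subseteq> U" using U(1,3) gC by (auto simp: upset_def add.commute)
      show "U - (U' \<union> (+) g ` U) = E"
      proof -
        have "c \<in> (+) g ` U \<longleftrightarrow> c \<in> conicset G (u + realv g)" if c: "c \<in> U - U'" for c
        proof
          assume "c \<in> (+) g ` U"
          then obtain w where w: "w \<in> U" "c = g + w" by blast
          have "w \<notin> U'" using c w U(2) gC by (auto simp: upset_def add.commute)
          then have "realv w - u \<in> G" using w U(4) by (auto simp: conicset_def)
          then show "c \<in> conicset G (u + realv g)" by (simp add: w(2) conicset_def realv_add algebra_simps)
        next
          assume "c \<in> conicset G (u + realv g)"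
          then have "c - g \<in> conicset G u" by (simp add: conicset_def realv_diff algebra_simps)
          then have "c - g \<in> U" using U(4) by blast
          then show "c \<in> (+) g ` U" by (intro image_eqI[of _ _ "c - g"]) auto
        qed
        then show ?thesis unfolding E_def U(4)[symmetric] by blast
      qed
    qed
    ultimately show "depth_ge m (Suc n) (mspan U) (mspan U')"
      unfolding depth_ge.simps(2) using monom_in_m[OF gC g(2)] by blast
  qed
qed

text \<open>For a face \<open>F\<close> this is the Cohen--Macaulay property of the canonical module of \<open>K[lat F]\<close>.\<close>

corollary interior_depth:
  assumes "F \<in> faces P" shows "sq_depth (dim F) {c \<in> C. sf c = F}"
proof -
  obtain v where v: "v \<in> F" "generic F v" "conicset F v = {c \<in> C. sf c = F}"
    using exists_generic[OF assms] .
  show ?thesis unfolding v(3)[symmetric]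
    by (rule conic_depth[OF assms v(2) assms _ _ v(1), of _ "{}"]) (auto simp: span_zero)
qed

end

section \<open>Krull dimension\<close>

fun pw :: "'a::comm_ring_1 list \<Rightarrow> nat list \<Rightarrow> 'a" where
  "pw (y # ys) (a # as) = y ^ a * pw ys as"
| "pw _ _ = 1"

text \<open>Gaussian elimination: a row with a nonzero entry at x clears this column from the other
  rows, and its own coefficient is found by back substitution.\<close>

lemma linear_dependence:
  fixes M :: "'i \<Rightarrow> 'x \<Rightarrow> 'k::field"
  assumes "finite X" "finite I" "card X < card I"
  shows "\<exists>l. (\<exists>i\<in>I. l i \<noteq> 0) \<and> (\<forall>x\<in>X. (\<Sum>i\<in>I. l i * M i x) = 0)"
  using assms
proof (induction X arbitrary: I M rule: finite_induct)
  case empty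
  then have "I \<noteq> {}" by auto
  then show ?case by (intro exI[of _ "\<lambda>i. 1"]) auto
next
  case (insert x X)
  show ?case
  proof (cases "\<forall>i\<in>I. M i x = 0")
    case True
    have "card X < card I" using insert by simp
    then obtain l where l: "\<exists>i\<in>I. l i \<noteq> 0" "\<forall>x\<in>X. (\<Sum>i\<in>I. l i * M i x) = 0"
      using insert.IH[OF insert.prems(1)] by blast
    then show ?thesis using True by (intro exI[of _ l]) auto
  next
    case False
    then obtain i0 where i0: "i0 \<in> I" "M i0 x \<noteq> 0" by blast
    let ?I = "I - {i0}"
    define q where "q i = M i x / M i0 x" for i
    have "card X < card ?I" using insert i0 by simp
    then obtain l where l: "\<exists>i\<in>?I. l i \<noteq> 0" "\<forall>y\<in>X. (\<Sum>i\<in>?I. l i * (M i y - q i * M i0 y)) = 0"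
      using insert.IH[of ?I "\<lambda>i y. M i y - q i * M i0 y"] insert.prems(1) by blast
    define l' where "l' i = (if i = i0 then - (\<Sum>i\<in>?I. l i * q i) else l i)" for i
    have sum: "(\<Sum>i\<in>I. l' i * M i y) = (\<Sum>i\<in>?I. l i * (M i y - q i * M i0 y))" for y
    proof -
      have "(\<Sum>i\<in>I. l' i * M i y) = l' i0 * M i0 y + (\<Sum>i\<in>?I. l' i * M i y)"
        using insert.prems(1) i0(1) by (simp add: sum.remove)
      also have "(\<Sum>i\<in>?I. l' i * M i y) = (\<Sum>i\<in>?I. l i * M i y)" by (intro sum.cong) (auto simp: l'_def)
      also have "l' i0 * M i0 y = (\<Sum>i\<in>?I. - (l i * q i * M i0 y))"
        by (simp add: l'_def sum_distrib_right sum_negf)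
      also have "\<dots> + (\<Sum>i\<in>?I. l i * M i y) = (\<Sum>i\<in>?I. l i * (M i y - q i * M i0 y))"
        by (simp add: sum.distrib[symmetric] algebra_simps)
      finally show ?thesis .
    qed
    have "(\<Sum>i\<in>I. l' i * M i x) = 0" unfolding sum using i0(2) by (simp add: q_def)
    moreover have "\<exists>i\<in>I. l' i \<noteq> 0" using l(1) by (auto simp: l'_def)
    ultimately show ?thesis using l(2) sum by (intro exI[of _ l']) auto
  qed
qed

text \<open>For a smallest set T with the determining property every t in T has a vector of W
  vanishing on T except at t; these vectors are independent, which bounds the size of T.\<close>

lemma determining_coordinates:
  fixes W :: "(real^'n) set"
  assumes W: "subspace W"
  shows "\<exists>T. card T \<le> dim W \<and> (\<forall>x\<in>W. (\<forall>i\<in>T. x $ i = 0) \<longrightarrow> x = 0)"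
proof -
  define Q where "Q T \<longleftrightarrow> (\<forall>x\<in>W. (\<forall>i\<in>T. x $ i = 0) \<longrightarrow> x = 0)" for T :: "'n set"
  have "Q UNIV" by (auto simp: Q_def vec_eq_iff)
  then obtain T where T: "Q T" and min: "\<And>T'. Q T' \<Longrightarrow> card T \<le> card T'"
    using ex_has_least_nat[of Q UNIV card] by blast
  have "\<exists>v\<in>W. v \<noteq> 0 \<and> (\<forall>i\<in>T - {t}. v $ i = 0)" if "t \<in> T" for t
  proof -
    have "card (T - {t}) < card T" using that by (intro card_Diff1_less) auto
    then have "\<not> Q (T - {t})" using min[of "T - {t}"] by linarith
    then show ?thesis unfolding Q_def by blast
  qed
  then obtain v where v: "\<And>t. t \<in> T \<Longrightarrow> v t \<in> W" "\<And>t. t \<in> T \<Longrightarrow> v t \<noteq> 0"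
    "\<And>t i. t \<in> T \<Longrightarrow> i \<in> T - {t} \<Longrightarrow> v t $ i = 0" by metis
  have vt: "v t $ t \<noteq> 0" if "t \<in> T" for t
  proof
    assume "v t $ t = 0"
    then have "\<forall>i\<in>T. v t $ i = 0" using v(3)[OF that] by blast
    then show False using T v(1,2)[OF that] unfolding Q_def by blast
  qed
  have inj: "inj_on v T"
  proof (rule inj_onI, rule ccontr)
    fix s t assume st: "s \<in> T" "t \<in> T" "v s = v t" "s \<noteq> t"
    then show False using v(3)[of t s] vt[of s] by auto
  qed
  have "independent (v ` T)"
  proof (rule independent_if_scalars_zero)
    fix f x assume f: "(\<Sum>x\<in>v ` T. f x *\<^sub>R x) = 0" and "x \<in> v ` T"
    then obtain s where s: "s \<in> T" "x = v s" by blast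
    have "0 = (\<Sum>t\<in>T. f (v t) *\<^sub>R v t) $ s" using f by (simp add: sum.reindex[OF inj])
    also have "\<dots> = (\<Sum>t\<in>T. f (v t) * v t $ s)" by simp
    also have "\<dots> = f (v s) * v s $ s + (\<Sum>t\<in>T - {s}. f (v t) * v t $ s)"
      by (rule sum.remove[OF _ s(1)]) simp
    also have "(\<Sum>t\<in>T - {s}. f (v t) * v t $ s) = 0"
      by (rule sum.neutral) (use v(3) s(1) in auto)
    finally show "f x = 0" using vt[OF s(1)] s(2) by simp
  qed simp
  then have "card (v ` T) \<le> dim W" using v(1) by (intro independent_card_le_dim) auto
  then have "card T \<le> dim W" using card_image[OF inj] by simp
  then show ?thesis using T unfolding Q_def by blast
qed

definition box_pts :: "nat \<Rightarrow> (int^'n) set" where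
  "box_pts D = {c. \<forall>i. \<bar>c $ i\<bar> \<le> int D}"

lemma box_pts_mono: "a \<le> b \<Longrightarrow> box_pts a \<subseteq> box_pts b"
  unfolding box_pts_def by (auto intro: order_trans)

lemma box_pts_add: "a \<in> box_pts D \<Longrightarrow> b \<in> box_pts E \<Longrightarrow> a + b \<in> box_pts (D + E)"
  unfolding box_pts_def by (auto intro: order_trans[OF abs_triangle_ineq] add_mono)

text \<open>The determining coordinates embed these lattice points into a box with at most
  \<open>dim W\<close> factors. This polynomial growth in D is what bounds the Krull
  dimension.\<close>

lemma card_lattice_points_le:
  fixes W :: "(real^'n) set"
  assumes "subspace W"
  shows "finite {c \<in> box_pts D. realv c \<in> W}" "card {c \<in> box_pts D. realv c \<in> W} \<le> (2 * D + 1) ^ dim W"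
proof -
  obtain T where T: "card T \<le> dim W" "\<forall>x\<in>W. (\<forall>i\<in>T. x $ i = 0) \<longrightarrow> x = 0"
    using determining_coordinates[OF assms] by blast
  let ?X = "{c \<in> box_pts D. realv c \<in> W}" and ?f = "\<lambda>c :: int^'n. restrict (vec_nth c) T"
  have inj: "inj_on ?f ?X"
  proof (rule inj_onI)
    fix c d assume cd: "c \<in> ?X" "d \<in> ?X" "?f c = ?f d"
    have "realv (c - d) = 0"
    proof (rule T(2)[rule_format])
      show "realv (c - d) \<in> W" using cd assms by (simp add: realv_diff subspace_diff)
      fix i assume "i \<in> T"
      then have "c $ i = d $ i" using fun_cong[OF cd(3), of i] by simp
      then show "realv (c - d) $ i = 0" by (simp add: realv_def)
    qed
    then show "c = d" using realv_inj[of "c - d" 0] by simp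
  qed
  have sub: "?f ` ?X \<subseteq> T \<rightarrow>\<^sub>E {- int D..int D}"
    by (auto simp: box_pts_def abs_le_iff minus_le_iff)
  have fin: "finite (T \<rightarrow>\<^sub>E {- int D..int D})" by (intro finite_PiE) auto
  show "finite ?X" using finite_imageD[OF finite_subset[OF sub fin] inj] .
  have "card ?X = card (?f ` ?X)" using card_image[OF inj] by simp
  also have "\<dots> \<le> card (T \<rightarrow>\<^sub>E {- int D..int D})" by (rule card_mono[OF fin sub])
  also have "\<dots> = (2 * D + 1) ^ card T" by (simp add: card_PiE nat_add_distrib nat_mult_distrib)
  also have "\<dots> \<le> (2 * D + 1) ^ dim W" by (rule power_increasing[OF T(1)]) simp
  finally show "card ?X \<le> (2 * D + 1) ^ dim W" .
qed

context noetherian_ring_with_ideal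
begin

lemma pw_closed: "set ys \<subseteq> R \<Longrightarrow> pw ys as \<in> R"
  by (induction ys as rule: pw.induct) (auto simp: R_closed)

text \<open>Cancel the lowest power of the first element \<open>y \<notin> Q 0\<close>; since \<open>y \<in> Q 1\<close>, the terms free of \<open>y\<close>
  then vanish modulo \<open>Q 1\<close>.\<close>

lemma prime_chain_independent:
  assumes "\<And>i. i \<le> length ys \<Longrightarrow> is_prime_ideal R (Q i)"
    "\<And>i. i < length ys \<Longrightarrow> Q i \<subseteq> Q (Suc i)"
    "\<And>i. i < length ys \<Longrightarrow> ys ! i \<in> Q (Suc i) - Q i"
    "finite A" "A \<noteq> {}" "\<And>as. as \<in> A \<Longrightarrow> length as = length ys"
    "\<And>as. as \<in> A \<Longrightarrow> l as \<in> R \<and> (\<exists>r\<in>R. r * l as = 1)"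
  shows "(\<Sum>as\<in>A. l as * pw ys as) \<notin> Q 0"
  using assms
proof (induction ys arbitrary: Q A l)
  case Nil
  \<comment> \<open>With no elements left the sum is a single coefficient, a unit, and a prime
    contains no unit.\<close>
  have "A = {[]}" using Nil.prems(5,6) by auto
  show ?case
  proof
    assume "(\<Sum>as\<in>A. l as * pw [] as) \<in> Q 0"
    then have l: "l [] \<in> Q 0" using \<open>A = {[]}\<close> by simp
    note Q = Nil.prems(1)[of 0, simplified]
    obtain r where "r \<in> R" "r * l [] = 1" using Nil.prems(7)[of "[]"] \<open>A = {[]}\<close> by blast
    then have "1 \<in> Q 0" using is_idealD(4)[OF is_prime_idealD(1)[OF Q] _ l] by metis
    then have "x \<in> Q 0" if "x \<in> R" for x
      using is_idealD(4)[OF is_prime_idealD(1)[OF Q] that, of 1] by simp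
    then show False using is_prime_idealD(2)[OF Q] is_idealD(1)[OF is_prime_idealD(1)[OF Q]] by blast
  qed
next
  case (Cons y ys)
  have prime: "is_prime_ideal R (Q 0)" "is_prime_ideal R (Q 1)"
    using Cons.prems(1)[of 0] Cons.prems(1)[of 1] by auto
  note Q0 = is_prime_idealD(1)[OF prime(1)] and Q1 = is_prime_idealD(1)[OF prime(2)]
  have QR: "x \<in> R" if "x \<in> Q i" "i \<le> length (y # ys)" for x i
    using that is_idealD(1)[OF is_prime_idealD(1)[OF Cons.prems(1)]] by blast
  have ysR: "set ys \<subseteq> R"
  proof
    fix x assume "x \<in> set ys"
    then obtain i where i: "i < length ys" "x = ys ! i" by (auto simp: in_set_conv_nth)
    then show "x \<in> R" using Cons.prems(3)[of "Suc i"] QR[of x "Suc (Suc i)"] by simp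
  qed
  have y: "y \<in> Q 1" "y \<notin> Q 0" "y \<in> R" using Cons.prems(3)[of 0] QR[of y 1] by auto
  define k where "k = Min (hd ` A)"
  have kmin: "k \<le> hd as" if "as \<in> A" for as unfolding k_def using that Cons.prems(4) by (intro Min_le) auto
  have "k \<in> hd ` A" unfolding k_def using Cons.prems(4,5) by (intro Min_in) auto
  then obtain a0 where a0: "a0 \<in> A" "hd a0 = k" by blast
  define A0 where "A0 = {as. k # as \<in> A}"
  define A1 where "A1 = A - (#) k ` A0"
  have "A0 = ((#) k) -` A" by (auto simp: A0_def)
  then have finA0: "finite A0" using finite_vimageI[OF Cons.prems(4), of "(#) k"] by (simp add: inj_on_def)
  have ne: "A0 \<noteq> {}"
  proof -
    have "a0 = k # tl a0" using a0 Cons.prems(6)[OF a0(1)] by (cases a0) auto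
    then show ?thesis using a0(1) unfolding A0_def by (metis empty_iff mem_Collect_eq)
  qed
  have A1: "bs = hd bs # tl bs" "k < hd bs" "bs \<in> A" if bs: "bs \<in> A1" for bs
  proof -
    show bA: "bs \<in> A" using bs by (simp add: A1_def)
    then show e: "bs = hd bs # tl bs" using Cons.prems(6)[of bs] by (cases bs) auto
    have "hd bs \<noteq> k"
    proof
      assume "hd bs = k"
      then have "bs \<in> (#) k ` A0" using e bA by (auto simp: A0_def intro!: image_eqI[of _ _ "tl bs"])
      then show False using bs by (simp add: A1_def)
    qed
    then show "k < hd bs" using kmin[OF bA] by simp
  qed
  \<comment> \<open>The sum will be y^k (X + y Z), where X gathers the terms in which the exponent
    of y is exactly k.\<close>
  define X where "X = (\<Sum>as\<in>A0. l (k # as) * pw ys as)"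
  define Z where "Z = (\<Sum>bs\<in>A1. l bs * (y ^ (hd bs - k - 1) * pw ys (tl bs)))"
  have split: "(\<Sum>as\<in>A. l as * pw (y # ys) as) = y ^ k * (X + y * Z)"
  proof -
    have "(\<Sum>as\<in>A. l as * pw (y # ys) as) =
        (\<Sum>as\<in>A1. l as * pw (y # ys) as) + (\<Sum>as\<in>(#) k ` A0. l as * pw (y # ys) as)"
      unfolding A1_def using Cons.prems(4) by (intro sum.subset_diff) (auto simp: A0_def)
    also have "(\<Sum>as\<in>(#) k ` A0. l as * pw (y # ys) as) = (\<Sum>as\<in>A0. y ^ k * (l (k # as) * pw ys as))"
      by (subst sum.reindex) (auto simp: inj_on_def algebra_simps)
    also have "\<dots> = y ^ k * X" by (simp add: X_def sum_distrib_left)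
    also have "(\<Sum>as\<in>A1. l as * pw (y # ys) as) =
        (\<Sum>bs\<in>A1. (y ^ k * y) * (l bs * (y ^ (hd bs - k - 1) * pw ys (tl bs))))"
    proof (rule sum.cong[OF refl])
      fix bs assume "bs \<in> A1"
      note b = A1[OF this]
      have "hd bs = k + 1 + (hd bs - k - 1)" using b(2) by simp
      then have yy: "y ^ hd bs = y ^ k * y * y ^ (hd bs - k - 1)" by (metis power_add power_one_right)
      have "pw (y # ys) bs = y ^ hd bs * pw ys (tl bs)" by (subst b(1)) simp
      then show "l bs * pw (y # ys) bs = (y ^ k * y) * (l bs * (y ^ (hd bs - k - 1) * pw ys (tl bs)))"
        unfolding yy by (simp only: mult_ac)
    qed
    also have "\<dots> = (y ^ k * y) * Z" by (simp add: Z_def sum_distrib_left)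
    finally show ?thesis by (simp add: algebra_simps)
  qed
  have XR: "X \<in> R" unfolding X_def
    by (intro R_closed(8) R_closed(4) pw_closed ysR) (use Cons.prems(7) in \<open>auto simp: A0_def\<close>)
  have ZR: "Z \<in> R" unfolding Z_def
    by (intro R_closed(8) R_closed(4) R_closed(7) pw_closed ysR y) (use Cons.prems(7) A1(3) in auto)
  have "X \<notin> Q 1"
    unfolding X_def One_nat_def
  proof (rule Cons.IH[of "\<lambda>i. Q (Suc i)"])
    show "length as = length ys" if "as \<in> A0" for as
      using that Cons.prems(6)[of "k # as"] by (simp add: A0_def)
    show "l (k # as) \<in> R \<and> (\<exists>r\<in>R. r * l (k # as) = 1)" if "as \<in> A0" for as
      using that Cons.prems(7)[of "k # as"] by (simp add: A0_def)
    show "is_prime_ideal R (Q (Suc i))" if "i \<le> length ys" for i using Cons.prems(1)[of "Suc i"] that by simp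
    show "Q (Suc i) \<subseteq> Q (Suc (Suc i))" if "i < length ys" for i using Cons.prems(2)[of "Suc i"] that by simp
    show "ys ! i \<in> Q (Suc (Suc i)) - Q (Suc i)" if "i < length ys" for i
      using Cons.prems(3)[of "Suc i"] that by simp
  qed (use finA0 ne in auto)
  show ?case
  proof
    assume "(\<Sum>as\<in>A. l as * pw (y # ys) as) \<in> Q 0"
    then have *: "y ^ k * (X + y * Z) \<in> Q 0" by (simp only: split)
    have pow: "y ^ j \<notin> Q 0" for j
    proof (induction j)
      case 0
      show ?case
      proof
        assume "y ^ 0 \<in> Q 0"
        then have "y * y ^ 0 \<in> Q 0" using is_idealD(4)[OF Q0 y(3)] by blast
        then show False using y(2) by simp
      qed
    next
      case (Suc j)
      then show ?case using is_prime_idealD(3)[OF prime(1) y(3) R_closed(7)[OF y(3)], of j] y(2) by auto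
    qed
    have "X + y * Z \<in> R" using XR ZR y(3) R_closed(3,4) by blast
    then have "X + y * Z \<in> Q 0" using is_prime_idealD(3)[OF prime(1) R_closed(7)[OF y(3)] _ *] pow by blast
    then have 1: "X + y * Z \<in> Q 1" using Cons.prems(2)[of 0] by auto
    have 2: "y * Z \<in> Q 1" using is_idealD(4)[OF Q1 ZR y(1)] by (simp add: mult.commute)
    have "X \<in> Q 1" using ideal_diff[OF subring Q1 1 2] by simp
    then show False using \<open>X \<notin> Q 1\<close> by blast
  qed
qed

end

context normal_cone
begin

lemma pw_box:
  assumes "set ys \<subseteq> semigroup_ring (box_pts D)"
  shows "(pw ys as :: (int^'n) \<Rightarrow>\<^sub>0 'k) \<in> semigroup_ring (box_pts (sum_list as * D))"
  using assms
proof (induction ys as rule: pw.induct)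
  have one: "1 \<in> (semigroup_ring (box_pts D) :: ((int^'n) \<Rightarrow>\<^sub>0 'k) set)" for D
    by (simp add: mem_semigroup_ring box_pts_def)
  {
    case (1 y ys a as)
    have y: "y ^ a \<in> semigroup_ring (box_pts (a * D))"
    proof (induction a)
      case (Suc a)
      have "y * y ^ a \<in> semigroup_ring (box_pts (D + a * D))"
        by (rule semigroup_ring_mult[OF _ Suc box_pts_add]) (use 1 in auto)
      then show ?case by simp
    qed (simp add: one)
    have "y ^ a * pw ys as \<in> semigroup_ring (box_pts (a * D + sum_list as * D))"
      by (rule semigroup_ring_mult[OF y _ box_pts_add]) (use 1 in auto)
    then show ?case by (simp add: add_mult_distrib)
  next
    case ("2_1" as) show ?case by (simp add: one)
  next
    case ("2_2" ys) show ?case by (simp add: one)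
  }
qed

text \<open>Too many monomials in algebraically independent elements would fit into too few lattice points
  of a box.\<close>

lemma prime_chain_length:
  assumes F: "F \<in> faces P" and Q: "\<And>i. i \<le> n \<Longrightarrow> is_prime_ideal R (Q i)" "\<And>i. i < n \<Longrightarrow> Q i \<subset> Q (Suc i)"
    and Q0: "mspan (C - lat F) \<subseteq> Q 0"
  shows "n \<le> dim F"
proof (rule ccontr)
  assume "\<not> n \<le> dim F"
  then have n: "Suc (dim F) \<le> n" by simp
  have "\<forall>i<n. \<exists>y. y \<in> Q (Suc i) - Q i" using Q(2) by blast
  then obtain y where y: "\<And>i. i < n \<Longrightarrow> y i \<in> Q (Suc i) - Q i" by metis
  define ys where "ys = map y [0..<n]"
  have ys: "length ys = n" "\<And>i. i < n \<Longrightarrow> ys ! i = y i" by (auto simp: ys_def)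
  have yR: "y i \<in> R" if "i < n" for i
    using y[OF that] is_idealD(1)[OF is_prime_idealD(1)[OF Q(1)[of "Suc i"]]] that by auto
  have ysR: "set ys \<subseteq> R" using yR by (auto simp: ys_def)
  define Ks where "Ks = (\<Union>f\<in>set ys. Poly_Mapping.keys f)"
  have finK: "finite Ks" by (simp add: Ks_def)
  \<comment> \<open>A crude bound for all entries of all exponents occurring in ys.\<close>
  define D where "D = (\<Sum>c\<in>Ks. \<Sum>i\<in>UNIV. nat \<bar>c $ i\<bar>)"
  have ysD: "set ys \<subseteq> mspan (box_pts D)"
  proof
    fix f assume f: "f \<in> set ys"
    have "c \<in> box_pts D" if c: "c \<in> Poly_Mapping.keys f" for c
      unfolding box_pts_def
    proof (intro CollectI allI)
      fix i
      have "nat \<bar>c $ i\<bar> \<le> (\<Sum>i\<in>UNIV. nat \<bar>c $ i\<bar>)" by (intro member_le_sum) auto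
      also have "\<dots> \<le> D" unfolding D_def
        by (rule member_le_sum[of c Ks "\<lambda>c. \<Sum>i\<in>UNIV. nat \<bar>c $ i\<bar>"]) (use f c finK in \<open>auto simp: Ks_def\<close>)
      finally show "\<bar>c $ i\<bar> \<le> int D" by linarith
    qed
    then show "f \<in> mspan (box_pts D)" by (auto simp: mem_semigroup_ring)
  qed
  define k where "k = dim F"
  \<comment> \<open>There are N^n power products with exponents below N, and all live in the box of
    size E = n N D, which meets span F in at most (2 E + 1)^k <= (2 n D + 1)^k N^k lattice points.
    As n > k, this N makes the former number the larger one.\<close>
  define N where "N = Suc ((2 * n * D + 1) ^ k)"
  define I where "I = {as. set as \<subseteq> {..<N} \<and> length as = n}"
  have finI: "finite I" unfolding I_def by (rule finite_lists_length_eq) simp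
  have cardI: "card I = N ^ n" unfolding I_def by (subst card_lists_length_eq) auto
  define E where "E = n * N * D"
  have sumE: "sum_list as * D \<le> E" if "as \<in> I" for as
  proof -
    have "sum_list as \<le> length as * N"
      using that sum_list_mono[of as "\<lambda>x. x" "\<lambda>x. N"] by (auto simp: I_def sum_list_triv less_imp_le subset_iff)
    then show ?thesis using that by (simp add: E_def I_def)
  qed
  define X where "X = {c \<in> box_pts E. realv c \<in> span F}"
  have finX: "finite X" and cardX: "card X \<le> (2 * E + 1) ^ k"
    unfolding X_def k_def using card_lattice_points_le[OF subspace_span, of E F] by auto
  have "2 * E + 1 \<le> (2 * n * D + 1) * N" by (simp add: E_def N_def algebra_simps)
  then have "(2 * E + 1) ^ k \<le> ((2 * n * D + 1) * N) ^ k" by (intro power_mono) auto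
  also have "\<dots> = (2 * n * D + 1) ^ k * N ^ k" by (rule power_mult_distrib)
  also have "\<dots> < N * N ^ k" by (intro mult_strict_right_mono) (auto simp: N_def)
  also have "\<dots> = N ^ Suc k" by simp
  also have "\<dots> \<le> N ^ n" using n by (intro power_increasing) (auto simp: N_def k_def)
  finally have "card X < card I" using cardX cardI by simp
  then obtain l :: "nat list \<Rightarrow> 'k" where l: "\<exists>as\<in>I. l as \<noteq> 0"
    "\<forall>c\<in>X. (\<Sum>as\<in>I. l as * Poly_Mapping.lookup (pw ys as) c) = 0"
    using linear_dependence[OF finX finI, of "\<lambda>as. Poly_Mapping.lookup (pw ys as)"] by blast
  \<comment> \<open>A nontrivial combination of power products without exponents in F, hence a
    member of Q 0, against \<open>prime_chain_independent\<close>.\<close>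
  define f where "f = (\<Sum>as\<in>I. Poly_Mapping.single 0 (l as) * pw ys as)"
  have look: "Poly_Mapping.lookup f c = (\<Sum>as\<in>I. l as * Poly_Mapping.lookup (pw ys as) c)" for c
    by (simp add: f_def lookup_sum lookup_single_times)
  have fR: "f \<in> R" unfolding f_def using ysR C_0
    by (intro R_closed(8) R_closed(4) pw_closed) (auto simp: single_mem)
  have "c \<notin> lat F" if c: "c \<in> Poly_Mapping.keys f" for c
  proof
    assume cF: "c \<in> lat F"
    obtain as where as: "as \<in> I" "l as * Poly_Mapping.lookup (pw ys as) c \<noteq> 0"
      using c unfolding in_keys_iff look by (meson sum.neutral)
    then have "c \<in> Poly_Mapping.keys (pw ys as)" by (auto simp: in_keys_iff)
    then have "c \<in> box_pts (sum_list as * D)" using pw_box[OF ysD, of as] by (auto simp: mem_semigroup_ring)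
    then have "c \<in> X" using box_pts_mono[OF sumE[OF as(1)]] cF by (auto simp: X_def lat_def intro: span_base)
    then show False using l(2) c by (simp add: in_keys_iff look)
  qed
  then have "f \<in> mspan (C - lat F)" using fR by (auto simp: mem_semigroup_ring)
  then have fQ: "f \<in> Q 0" using Q0 by blast
  define A where "A = {as \<in> I. l as \<noteq> 0}"
  have "f = (\<Sum>as\<in>A. Poly_Mapping.single 0 (l as) * pw ys as)" unfolding f_def A_def
    by (rule sum.mono_neutral_right) (use finI in auto)
  moreover have "(\<Sum>as\<in>A. Poly_Mapping.single 0 (l as) * pw ys as) \<notin> Q 0"
  proof (rule prime_chain_independent)
    show "Poly_Mapping.single 0 (l as) \<in> R \<and> (\<exists>r\<in>R. r * Poly_Mapping.single 0 (l as) = 1)" if "as \<in> A" for as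
      using that C_0 by (intro conjI bexI[of _ "Poly_Mapping.single 0 (inverse (l as))"])
        (auto simp: single_mem mult_single A_def)
    show "finite A" using finI by (simp add: A_def)
    show "A \<noteq> {}" using l(1) by (auto simp: A_def)
    show "length as = length ys" if "as \<in> A" for as using that by (simp add: A_def I_def ys(1))
    show "ys ! i \<in> Q (Suc i) - Q i" if "i < length ys" for i using y ys that by simp
    show "Q i \<subseteq> Q (Suc i)" if "i < length ys" for i using Q(2)[of i] ys(1) that by auto
    show "is_prime_ideal R (Q i)" if "i \<le> length ys" for i using Q(1) ys(1) that by simp
  qed
  ultimately show False using fQ by simp
qed

text \<open>A flag of faces from F down to {0}, one dimension at a time; the complements of their
  lattice points in C span the primes.\<close>

lemma face_prime_chain:
  assumes "F \<in> faces P" "dim F = n"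
  shows "\<exists>Q. Q 0 = mspan (C - lat F) \<and> (\<forall>i\<le>n. is_prime_ideal R (Q i)) \<and> (\<forall>i<n. Q i \<subset> Q (Suc i))"
  using assms
proof (induction n arbitrary: F)
  case 0
  then show ?case using prime_face_prime[OF lat_prime_face] by (intro exI[of _ "\<lambda>i. mspan (C - lat F)"]) auto
next
  case (Suc n)
  then have "F \<noteq> {0}" using dim_zero_face by force
  then obtain H where H: "H \<in> faces P" "H \<subset> F" "Suc (dim H) = dim F" using exists_facet[OF Suc.prems(1)] by blast
  then obtain Q where Q: "Q 0 = mspan (C - lat H)" "\<forall>i\<le>n. is_prime_ideal R (Q i)" "\<forall>i<n. Q i \<subset> Q (Suc i)"
    using Suc.IH[of H] Suc.prems(2) by auto
  obtain c where c: "c \<in> C" "sf c = F" using exists_sf[OF Suc.prems(1)] .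
  have "c \<in> lat F" "c \<notin> lat H" using sf_subset_iff[OF c(1)] c(2) H Suc.prems(1) by auto
  then have "C - lat F \<subset> C - lat H" using H(2) c(1) by (auto simp: lat_def)
  then have "mspan (C - lat F) \<subset> Q 0" unfolding Q(1) semigroup_ring_psubset_iff .
  then have "\<forall>i<Suc n. (case i of 0 \<Rightarrow> mspan (C - lat F) | Suc k \<Rightarrow> Q k) \<subset> Q i"
    using Q(3) by (auto split: nat.split)
  then show ?case using Q(2) prime_face_prime[OF lat_prime_face[OF Suc.prems(1)]]
    by (intro exI[of _ "\<lambda>i. case i of 0 \<Rightarrow> mspan (C - lat F) | Suc k \<Rightarrow> Q k"]) (auto split: nat.split)
qed

text \<open>The prime of F kills the monomial x^c, which stays nonzero modulo \<open>sat\<close> by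
  \<open>sat_mspan\<close>; so depth at least n yields a chain of n + 1 primes starting at the prime
  of F.\<close>

lemma depth_le_dim:
  assumes U: "upset U" "upset U'" "U' \<subseteq> U" and c: "c \<in> U - U'"
    and F: "F \<in> faces P" "\<And>h. h \<in> C - lat F \<Longrightarrow> c + h \<in> U'"
    and d: "depth_ge m n (mspan U) (mspan U')"
  shows "n \<le> dim F"
proof -
  have "\<exists>Q. Q 0 = mspan (C - lat F) \<and> (\<forall>i\<le>n. is_prime_ideal R (Q i)) \<and> (\<forall>i<n. Q i \<subset> Q (Suc i))"
  proof (rule prime_chain_of_depth[OF d])
    show "subquotient (mspan U) (mspan U')"
      using U upset_ideal by (auto simp: subquotient_def semigroup_ring_subset_iff)
    show "is_prime_ideal R (mspan (C - lat F))" using prime_face_prime[OF lat_prime_face[OF F(1)]] .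
    show "monom c \<in> mspan U" using c by (simp add: monom_mem)
    show "monom c \<notin> sat (mspan U')" using sat_mspan[OF U(2)] c by (auto simp: monom_mem)
    fix p assume "p \<in> mspan (C - lat F)"
    then have "p * monom c \<in> mspan U'"
      by (rule semigroup_ring_mult[of _ _ _ "{c}"]) (use F(2) in \<open>auto simp: monom_mem add.commute\<close>)
    then show "p * monom c \<in> sat (mspan U')" using sat_superset[OF upset_ideal[OF U(2)]] by blast
  qed
  then obtain Q where "Q 0 = mspan (C - lat F)" "\<forall>i\<le>n. is_prime_ideal R (Q i)" "\<forall>i<n. Q i \<subset> Q (Suc i)" by blast
  then show ?thesis using prime_chain_length[OF F(1), of n Q] by auto
qed

lemma le_mod_dim:
  assumes "F \<in> faces P" "ann R J J' \<subseteq> mspan (C - lat F)"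
  shows "enat (dim F) \<le> mod_dim R J J'"
proof -
  obtain Q where Q: "Q 0 = mspan (C - lat F)" "\<forall>i\<le>dim F. is_prime_ideal R (Q i)" "\<forall>i<dim F. Q i \<subset> Q (Suc i)"
    using face_prime_chain[OF assms(1) refl] by blast
  have "ann R J J' \<subseteq> Q 0" unfolding Q(1) by (rule assms(2))
  then have "enat (dim F) \<in> {enat n | n. \<exists>Q. (\<forall>i\<le>n. is_prime_ideal R (Q i)) \<and> ann R J J' \<subseteq> Q 0 \<and>
      (\<forall>i<n. Q i \<subset> Q (Suc i))}" using Q(2,3) by blast
  then show ?thesis unfolding mod_dim_def by (rule Sup_upper)
qed

text \<open>The translate of \<open>lat F\<close> by c survives entirely, so a copy of K[lat F]
  embeds into the module, and the annihilator of that copy is the prime of F.\<close>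

lemma ann_subset_face:
  assumes U: "upset U" "upset U'" and c: "c \<in> U" and F: "\<And>h. h \<in> lat F \<Longrightarrow> c + h \<notin> U'"
  shows "ann R (mspan U) (mspan U') \<subseteq> mspan (C - lat F)"
proof
  fix r assume r: "r \<in> ann R (mspan U) (mspan U')"
  have "h \<notin> lat F" if h: "h \<in> Poly_Mapping.keys r" for h
  proof
    assume "h \<in> lat F"
    then have "c + h \<notin> U'" using F by blast
    moreover have "monom c * r \<in> mspan U'" using r c by (auto simp: ann_def monom_mem mult.commute)
    moreover have "Poly_Mapping.lookup (monom c * r) (c + h) = Poly_Mapping.lookup r h"
      by (simp add: monom_def lookup_single_times)
    ultimately show False using h by (auto simp: mem_semigroup_ring in_keys_iff subset_iff)
  qed
  then show "r \<in> mspan (C - lat F)" using r by (auto simp: ann_def mem_semigroup_ring)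
qed

definition cells :: "(real^'n) set set \<Rightarrow> (int^'n) set" where
  "cells E = {c \<in> C. sf c \<in> E}"

text \<open>Lower bound: a point with support F can be multiplied by everything in F without leaving
  its cell. Upper bound: a prime over the annihilator contains the prime of some face in E, so
  chains starting there have length at most k.\<close>

lemma mod_dim_cells:
  assumes U: "upset U" "upset U'" "U' \<subseteq> U" "U - U' = cells E"
    and F: "F \<in> E" "F \<in> faces P" "dim F = k" and le: "\<And>G. G \<in> E \<Longrightarrow> G \<in> faces P \<Longrightarrow> dim G \<le> k"
  shows "mod_dim R (mspan U) (mspan U') = enat k"
proof (rule antisym)
  obtain c where c: "c \<in> C" "sf c = F" using exists_sf[OF F(2)] .
  have "ann R (mspan U) (mspan U') \<subseteq> mspan (C - lat F)"
  proof (rule ann_subset_face[OF U(1,2)])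
    show "c \<in> U" using U(4) c F(1) by (auto simp: cells_def)
    fix h assume h: "h \<in> lat F"
    have hC: "h \<in> C" using h lat_subset[OF F(2)] by blast
    have cF: "c \<in> lat F" using sf_subset_iff[OF c(1) F(2)] c(2) by simp
    have "c + h \<in> lat F" using lat_prime_face[OF F(2)] c(1) hC cF h by (simp add: prime_face_def)
    then have "sf (c + h) = F" using sf_add(1)[OF c(1) hC] sf_subset_iff[OF C_add[OF c(1) hC] F(2)] c(2) by blast
    then have "c + h \<in> cells E" using F(1) C_add[OF c(1) hC] by (simp add: cells_def)
    then show "c + h \<notin> U'" using U(4) by blast
  qed
  then show "enat k \<le> mod_dim R (mspan U) (mspan U')" using le_mod_dim[OF F(2)] F(3) by simp
  show "mod_dim R (mspan U) (mspan U') \<le> enat k" unfolding mod_dim_def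
  proof (rule Sup_least, clarify)
    fix n and Q :: "nat \<Rightarrow> ((int^'n) \<Rightarrow>\<^sub>0 'k) set"
    assume Q: "\<forall>i\<le>n. is_prime_ideal R (Q i)" "ann R (mspan U) (mspan U') \<subseteq> Q 0" "\<forall>i<n. Q i \<subset> Q (Suc i)"
    obtain c0 where c0: "c0 \<in> C" "monom c0 \<notin> Q 0"
      and sub: "\<And>F. prime_face F \<Longrightarrow> c0 \<in> F \<Longrightarrow> mspan (C - F) \<subseteq> Q 0"
      using prime_ideal_face[of "Q 0"] Q(1) by blast
    \<comment> \<open>x^c0 does not kill the module, so c0 + u survives for some u; the support face
      of c0 + u belongs to E and contains c0.\<close>
    have "monom c0 \<notin> ann R (mspan U) (mspan U')" using Q(2) c0(2) by blast
    then obtain a where a: "a \<in> mspan U" "monom c0 * a \<notin> mspan U'" using c0(1) by (auto simp: ann_def monom_mem)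
    have "\<exists>u\<in>U. c0 + u \<notin> U'"
    proof (rule ccontr)
      assume "\<not> ?thesis"
      then have "monom c0 * a \<in> mspan U'"
        by (intro semigroup_ring_mult[of _ "{c0}" _ U]) (use a(1) in \<open>auto simp: monom_mem\<close>)
      then show False using a(2) by blast
    qed
    then obtain u where u: "u \<in> U" "c0 + u \<notin> U'" by blast
    have uC: "u \<in> C" using u(1) U(1) by (auto simp: upset_def)
    have "c0 + u \<in> U" using U(1) u(1) c0(1) by (auto simp: upset_def add.commute)
    then have G: "sf (c0 + u) \<in> E" using u(2) U(4) by (auto simp: cells_def)
    have GP: "sf (c0 + u) \<in> faces P" using sf_face C_add c0(1) uC by blast
    have "c0 \<in> lat (sf (c0 + u))" using sf_add(1)[OF c0(1) uC] sf_subset_iff[OF c0(1) GP] by blast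
    then have "mspan (C - lat (sf (c0 + u))) \<subseteq> Q 0" using sub lat_prime_face[OF GP] by blast
    then have "n \<le> dim (sf (c0 + u))" using prime_chain_length[OF GP] Q by blast
    then show "enat n \<le> enat k" using le[OF G GP] by simp
  qed
qed

text \<open>The depth never exceeds k: if a point with support F survived multiplication by a
  monomial outside F, it would end in a larger face of E, against the maximality of dim F. So only
  the lower bound on the depth remains to be checked.\<close>

lemma CM_cells:
  assumes U: "upset U" "upset U'" "U' \<subseteq> U" "U - U' = cells E"
    and F: "F \<in> E" "F \<in> faces P" "dim F = k" and le: "\<And>G. G \<in> E \<Longrightarrow> G \<in> faces P \<Longrightarrow> dim G \<le> k"
  shows "CM R m (mspan U) (mspan U') \<longleftrightarrow> depth_ge m k (mspan U) (mspan U')"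
proof -
  obtain c where c: "c \<in> C" "sf c = F" using exists_sf[OF F(2)] .
  have cU: "c \<in> U - U'" using U(4) c F(1) by (auto simp: cells_def)
  then have ps: "U' \<subset> U" using U(3) by blast
  have "n \<le> k" if "depth_ge m n (mspan U) (mspan U')" for n
    unfolding F(3)[symmetric]
  proof (rule depth_le_dim[OF U(1-3) cU F(2) _ that])
    fix h assume h: "h \<in> C - lat F"
    show "c + h \<in> U'"
    proof (rule ccontr)
      assume "c + h \<notin> U'"
      then have "c + h \<in> cells E" using U(1,4) cU h by (auto simp: upset_def)
      then have G: "sf (c + h) \<in> E" "sf (c + h) \<in> faces P" using sf_face by (auto simp: cells_def)
      have "F \<subseteq> sf (c + h)" "sf h \<subseteq> sf (c + h)" using sf_add[of c h] c h by auto
      moreover have "\<not> sf h \<subseteq> F" using sf_subset_iff[of h F] h F(2) by blast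
      ultimately have "F \<subset> sf (c + h)" by blast
      then show False using face_psubset_dim[OF G(2) F(2)] le[OF G] F(3) by simp
    qed
  qed
  then have "depth R m (mspan U) (mspan U') = enat k \<longleftrightarrow> depth_ge m k (mspan U) (mspan U')"
    using depth_eq_iff[OF U(1,2) ps] by blast
  moreover have "mod_dim R (mspan U) (mspan U') = enat k"
    by (rule mod_dim_cells[OF U F]) (rule le)
  ultimately show ?thesis unfolding CM_def using ps by (simp add: semigroup_ring_psubset_iff)
qed

section \<open>Sequential Cohen--Macaulayness\<close>


definition nonfaces :: "(real^'n) set set \<Rightarrow> (int^'n) set" where
  "nonfaces \<Gamma> = {c \<in> C. sf c \<notin> \<Gamma>}"

text \<open>In contrast to \<open>order_ideal\<close> the empty family is included; for example
  \<open>skel_pskel top_dim\<close> is empty.\<close>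

definition down_closed :: "(real^'n) set set \<Rightarrow> bool" where
  "down_closed \<Gamma> \<longleftrightarrow> \<Gamma> \<subseteq> faces P \<and> (\<forall>F\<in>\<Gamma>. \<forall>G\<in>faces P. G \<subseteq> F \<longrightarrow> G \<in> \<Gamma>)"

lemma upset_nonfaces:
  assumes "down_closed \<Gamma>" shows "upset (nonfaces \<Gamma>)"
  unfolding upset_def
proof (intro conjI ballI)
  fix u c assume u: "u \<in> nonfaces \<Gamma>" and c: "c \<in> C"
  have uC: "u \<in> C" using u by (simp add: nonfaces_def)
  have "sf (u + c) \<in> \<Gamma> \<Longrightarrow> sf u \<in> \<Gamma>"
    using assms sf_face[OF uC] sf_add(1)[OF uC c] unfolding down_closed_def by blast
  then show "u + c \<in> nonfaces \<Gamma>" using u C_add[OF uC c] by (auto simp: nonfaces_def)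
qed (auto simp: nonfaces_def)

lemma I_Delta_eq:
  assumes "down_closed \<Gamma>" shows "I_Delta C \<Gamma> = mspan (nonfaces \<Gamma>)"
proof -
  let ?S = "{monom c :: (int^'n) \<Rightarrow>\<^sub>0 'k | c. c \<in> C \<and> supp_face P (realv c) \<notin> \<Gamma>}"
  have S: "?S = monom ` nonfaces \<Gamma>" by (auto simp: nonfaces_def sf_def)
  show ?thesis unfolding I_Delta_def gen_ideal_def
  proof
    have "is_ideal R (mspan (nonfaces \<Gamma>))" using upset_ideal upset_nonfaces assms by blast
    then show "\<Inter> {J. is_ideal R J \<and> ?S \<subseteq> J} \<subseteq> mspan (nonfaces \<Gamma>)"
      unfolding S by (intro Inter_lower) (auto simp: monom_mem)
    show "mspan (nonfaces \<Gamma>) \<subseteq> \<Inter> {J. is_ideal R J \<and> ?S \<subseteq> J}"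
      unfolding S by (intro Inter_greatest mspan_subset_ideal) auto
  qed
qed

lemma exists_subface:
  assumes "G \<in> faces P" "k \<le> dim G"
  shows "\<exists>H\<in>faces P. H \<subseteq> G \<and> dim H = k"
  using assms(2)
proof (induction k rule: inc_induct)
  case base
  then show ?case using assms(1) by blast
next
  case (step k)
  then obtain H where H: "H \<in> faces P" "H \<subseteq> G" "dim H = Suc k" by blast
  then have "H \<noteq> {0}" using dim_zero_face by force
  then obtain H' where H': "H' \<in> faces P" "H' \<subset> H" "Suc (dim H') = dim H" using exists_facet[OF H(1)] by blast
  then have "H' \<subseteq> G" "dim H' = k" using H by auto
  then show ?case using H'(1) by blast
qed

end

section \<open>Pure skeleta and the dimension filtration\<close>

locale face_complex = normal_cone C K for C :: "(int^'n) set" and K :: "'k::field itself" +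
  fixes \<Delta> :: "(real^'n) set set"
  assumes \<Delta>: "order_ideal (cone_of C) \<Delta>"
begin

lemma \<Delta>_ne: "\<Delta> \<noteq> {}" and \<Delta>_faces: "\<Delta> \<subseteq> faces P"
  and \<Delta>_down: "F \<in> \<Delta> \<Longrightarrow> G \<in> faces P \<Longrightarrow> G \<subseteq> F \<Longrightarrow> G \<in> \<Delta>"
  using \<Delta> unfolding order_ideal_def by blast+

lemma \<Delta>_finite: "finite \<Delta>"
  using finite_subset[OF \<Delta>_faces finite_faces] .

text \<open>The function \<open>delta_face\<close> in terms of cone dimensions: larger by one, and a
  natural number.\<close>

definition dl :: "(real^'n) set \<Rightarrow> nat" where
  "dl F = Max (dim ` {G \<in> \<Delta>. F \<subseteq> G})"

definition top_dim :: nat where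
  "top_dim = Max (dim ` \<Delta>)"

lemma dim_le_dl: "G \<in> \<Delta> \<Longrightarrow> F \<subseteq> G \<Longrightarrow> dim G \<le> dl F"
  unfolding dl_def using \<Delta>_finite by (intro Max_ge) auto

lemma dl_attained:
  assumes "F \<in> \<Delta>" obtains G where "G \<in> \<Delta>" "F \<subseteq> G" "dim G = dl F"
proof -
  have "dl F \<in> dim ` {G \<in> \<Delta>. F \<subseteq> G}" unfolding dl_def using \<Delta>_finite assms by (intro Max_in) auto
  then show thesis using that by auto
qed

lemma dl_antimono:
  assumes "G \<in> \<Delta>" "F \<subseteq> G" shows "dl G \<le> dl F"
proof -
  obtain H where "H \<in> \<Delta>" "G \<subseteq> H" "dim H = dl G" using dl_attained[OF assms(1)] .
  then show ?thesis using dim_le_dl[of H F] assms(2) by auto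
qed

lemma dl_le_top: assumes "F \<in> \<Delta>" shows "dl F \<le> top_dim"
proof -
  obtain H where "H \<in> \<Delta>" "dim H = dl F" using dl_attained[OF assms] .
  then show ?thesis unfolding top_dim_def using \<Delta>_finite by (metis Max_ge finite_imageI image_eqI)
qed

lemma Max_int_shift:
  assumes "finite A" "A \<noteq> {}" shows "Max ((\<lambda>F. int (f F) - 1) ` A) = int (Max (f ` A)) - 1"
proof -
  have "Max ((\<lambda>n. int n - 1) ` f ` A) = int (Max (f ` A)) - 1"
    using assms by (subst mono_Max_commute[symmetric]) (auto simp: mono_def)
  then show ?thesis by (simp add: image_image)
qed

lemma dim_cplx_eq: "dim_cplx \<Delta> = int top_dim - 1"
proof -
  have "dimbar ` \<Delta> = (\<lambda>F. int (dim F) - 1) ` \<Delta>"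
    using dimbar_face \<Delta>_faces by (intro image_cong) auto
  then show ?thesis unfolding dim_cplx_def top_dim_def using Max_int_shift[OF \<Delta>_finite \<Delta>_ne] by simp
qed

lemma delta_face_eq: assumes "F \<in> \<Delta>" shows "delta_face \<Delta> F = int (dl F) - 1"
proof -
  have "{dimbar G | G. G \<in> \<Delta> \<and> F \<subseteq> G} = dimbar ` {G \<in> \<Delta>. F \<subseteq> G}" by blast
  also have "\<dots> = (\<lambda>F. int (dim F) - 1) ` {G \<in> \<Delta>. F \<subseteq> G}"
    using dimbar_face \<Delta>_faces by (intro image_cong) auto
  finally have "delta_face \<Delta> F = Max ((\<lambda>F. int (dim F) - 1) ` {G \<in> \<Delta>. F \<subseteq> G})"
    by (simp add: delta_face_def)
  then show ?thesis unfolding dl_def using \<Delta>_finite assms by (subst (asm) Max_int_shift) auto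
qed

text \<open>\<open>dim\<close> exceeds \<open>dimbar\<close> by one: \<open>pskel (i + 1)\<close> is the paper's pure \<open>i\<close>-skeleton, and
  \<open>skel_pskel k\<close> the \<open>(k - 1)\<close>-skeleton of the pure \<open>k\<close>-skeleton.\<close>

definition pskel :: "nat \<Rightarrow> (real^'n) set set" where
  "pskel k = {F \<in> \<Delta>. dim F \<le> k \<and> k \<le> dl F}"

definition skel_pskel :: "nat \<Rightarrow> (real^'n) set set" where
  "skel_pskel k = {F \<in> \<Delta>. dim F \<le> k \<and> Suc k \<le> dl F}"

lemma pure_skel_eq: "pure_skel \<Delta> (int i) = pskel (Suc i)"
  using dimbar_face \<Delta>_faces delta_face_eq by (fastforce simp: pure_skel_def skel_def pskel_def)

lemma down_closed_sub:
  assumes "\<And>F G. F \<in> \<Gamma> \<Longrightarrow> G \<in> \<Delta> \<Longrightarrow> G \<subseteq> F \<Longrightarrow> G \<in> \<Gamma>" "\<Gamma> \<subseteq> \<Delta>"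
  shows "down_closed \<Gamma>"
  unfolding down_closed_def using assms \<Delta>_faces \<Delta>_down by blast

lemma down_closed_\<Delta>: "down_closed \<Delta>"
  by (rule down_closed_sub) auto

lemma down_closed_pskel: "down_closed (pskel k)"
proof (rule down_closed_sub)
  fix F G assume "F \<in> pskel k" "G \<in> \<Delta>" "G \<subseteq> F"
  then show "G \<in> pskel k" using dl_antimono[of F G] dim_subset[of G F] by (auto simp: pskel_def)
qed (auto simp: pskel_def)

lemma down_closed_skel_pskel: "down_closed (skel_pskel k)"
proof (rule down_closed_sub)
  fix F G assume "F \<in> skel_pskel k" "G \<in> \<Delta>" "G \<subseteq> F"
  then show "G \<in> skel_pskel k" using dl_antimono[of F G] dim_subset[of G F] by (auto simp: skel_pskel_def)
qed (auto simp: skel_pskel_def)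

text \<open>Modulo \<open>level 0\<close> these are the exponents whose support face has
  \<open>dl\<close> below k: the step of the dimension filtration made of the layers of dimension
  less than k.\<close>

definition level :: "nat \<Rightarrow> (int^'n) set" where
  "level k = nonfaces {F \<in> \<Delta>. k \<le> dl F}"

lemma upset_level: "upset (level k)"
  unfolding level_def
proof (rule upset_nonfaces, rule down_closed_sub)
  fix F G assume "F \<in> {F \<in> \<Delta>. k \<le> dl F}" "G \<in> \<Delta>" "G \<subseteq> F"
  then show "G \<in> {F \<in> \<Delta>. k \<le> dl F}" using dl_antimono[of F G] by auto
qed auto

lemma level_mono: "level k \<subseteq> level (Suc k)"
  by (auto simp: level_def nonfaces_def)

lemma level_0: "level 0 = nonfaces \<Delta>"
  by (simp add: level_def)

lemma level_top: "level (Suc top_dim) = C"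
  using dl_le_top by (fastforce simp: level_def nonfaces_def)

lemma level_diff: "level (Suc k) - level k = cells {F \<in> \<Delta>. dl F = k}"
  by (auto simp: level_def nonfaces_def cells_def)

text \<open>This condition and the next use \<open>depth_ge\<close> instead of \<open>CM\<close>.
  They hold for zero modules, so they can be required for all k, although layers may vanish and
  skeleta may be empty.\<close>

definition depth_N :: "nat \<Rightarrow> bool" where
  "depth_N k \<longleftrightarrow> depth_ge m k (mspan (level (Suc k))) (mspan (level k))"

definition depth_D :: "nat \<Rightarrow> bool" where
  "depth_D k \<longleftrightarrow> depth_ge m k R (mspan (nonfaces (pskel k)))"

lemma level_facet:
  assumes "F \<in> \<Delta>" "dl F = k"
  obtains G where "G \<in> {F \<in> \<Delta>. dl F = k}" "G \<in> faces P" "dim G = k"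
proof -
  obtain G where G: "G \<in> \<Delta>" "F \<subseteq> G" "dim G = dl F" using dl_attained[OF assms(1)] .
  have "dl G = k" using dl_antimono[OF G(1,2)] dim_le_dl[OF G(1) order_refl] G(3) assms(2) by simp
  then show thesis by (intro that[of G]) (use G \<Delta>_faces assms(2) in auto)
qed

lemma level_CM:
  assumes "F \<in> \<Delta>" "dl F = k"
  shows "CM R m (mspan (level (Suc k))) (mspan (level k)) \<longleftrightarrow> depth_N k"
    "mod_dim R (mspan (level (Suc k))) (mspan (level k)) = enat k"
proof -
  obtain G where G: "G \<in> {F \<in> \<Delta>. dl F = k}" "G \<in> faces P" "dim G = k" using level_facet[OF assms] .
  have le: "dim H \<le> k" if "H \<in> {F \<in> \<Delta>. dl F = k}" "H \<in> faces P" for H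
    using that dim_le_dl[of H H] by auto
  show "CM R m (mspan (level (Suc k))) (mspan (level k)) \<longleftrightarrow> depth_N k"
    unfolding depth_N_def
    by (rule CM_cells[OF upset_level upset_level level_mono level_diff G]) (rule le)
  show "mod_dim R (mspan (level (Suc k))) (mspan (level k)) = enat k"
    by (rule mod_dim_cells[OF upset_level upset_level level_mono level_diff G]) (rule le)
qed

lemma pskel_CM:
  assumes "Suc i \<le> top_dim"
  shows "CM_face_ring TYPE('k) C (pure_skel \<Delta> (int i)) \<longleftrightarrow> depth_D (Suc i)"
proof -
  have "top_dim \<in> dim ` \<Delta>" unfolding top_dim_def using \<Delta>_finite \<Delta>_ne by (intro Max_in) auto
  then obtain G where G: "G \<in> \<Delta>" "dim G = top_dim" by auto
  \<comment> \<open>A face of the full cone dimension i + 1, found inside a face of maximal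
    dimension; it serves as the top cell in \<open>CM_cells\<close>.\<close>
  obtain H where H: "H \<in> faces P" "H \<subseteq> G" "dim H = Suc i"
    using exists_subface[of G "Suc i"] G \<Delta>_faces assms by auto
  have Hp: "H \<in> pskel (Suc i)" using H \<Delta>_down[OF G(1)] dim_le_dl[OF G(1) H(2)] G(2) assms by (auto simp: pskel_def)
  have diff: "C - nonfaces (pskel (Suc i)) = cells (pskel (Suc i))" by (auto simp: nonfaces_def cells_def)
  have "CM R m R (mspan (nonfaces (pskel (Suc i)))) \<longleftrightarrow> depth_D (Suc i)"
    unfolding depth_D_def
    by (rule CM_cells[OF upset_C upset_nonfaces[OF down_closed_pskel] _ diff Hp H(1,3)])
      (auto simp: nonfaces_def pskel_def)
  then show ?thesis unfolding CM_face_ring_def pure_skel_eq I_Delta_eq[OF down_closed_pskel] .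
qed

lemma depth_D_trivial: assumes "top_dim < k" shows "depth_D k"
proof -
  have "pskel k = {}" using assms dl_le_top by (force simp: pskel_def)
  then have "nonfaces (pskel k) = C" by (simp add: nonfaces_def)
  then show ?thesis unfolding depth_D_def using depth_ge_refl[OF upset_ideal[OF upset_C]] by simp
qed

lemma skeleton_depth:
  assumes "depth_D (Suc k)"
  shows "depth_ge m k R (mspan (nonfaces (skel_pskel k)))"
proof -
  let ?T = "{F \<in> \<Delta>. dim F = Suc k}"
  let ?J0 = "nonfaces (pskel (Suc k))" and ?J1 = "nonfaces (skel_pskel k)"
  have sq: "sq_depth (Suc k) (\<Union>F\<in>?T. {c \<in> C. sf c = F})"
  \<comment> \<open>A constant \<tau> suffices: distinct faces of equal dimension are never
    contained in one another, so the interior ideals form a direct sum.\<close>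
  proof (rule sq_depth_filtration[where \<tau> = "\<lambda>_. 0"])
    show "finite ?T" using \<Delta>_finite by simp
    show "sq_depth (Suc k) {c \<in> C. sf c = F}" if "F \<in> ?T" for F
      using interior_depth[of F] that \<Delta>_faces by auto
    fix F G c h assume FG: "F \<in> ?T" "G \<in> ?T" "c \<in> {c \<in> C. sf c = F}" "h \<in> C" "c + h \<in> {c \<in> C. sf c = G}"
    then have "F \<subseteq> G" using sf_add(1) by blast
    then have "F = G" using face_psubset_dim[of G F] FG(1,2) \<Delta>_faces by fastforce
    then show "F = G \<or> (0::real) < 0" by blast
  qed
  have diff: "?J1 - ?J0 = (\<Union>F\<in>?T. {c \<in> C. sf c = F})"
    using dim_le_dl by (fastforce simp: nonfaces_def pskel_def skel_pskel_def)
  have sub: "?J0 \<subseteq> ?J1" by (auto simp: nonfaces_def pskel_def skel_pskel_def)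
  have up: "upset ?J0" "upset ?J1" using upset_nonfaces down_closed_pskel down_closed_skel_pskel by auto
  have A: "depth_ge m (Suc k) (mspan ?J1) (mspan ?J0)" by (rule sq_depthD[OF sq up(2,1) sub diff])
  have JR: "mspan ?J0 \<subseteq> mspan ?J1" "mspan ?J1 \<subseteq> R"
    using sub up(2) unfolding semigroup_ring_subset_iff upset_def by blast+
  have "subquotient R (mspan ?J0)" unfolding subquotient_def
    using upset_ideal[OF upset_C] upset_ideal[OF up(1)] JR by blast
  then have "depth_ge m k R (mspan ?J0)" by (rule depth_ge_Suc_D[OF _ assms[unfolded depth_D_def]])
  then show ?thesis
    using depth_ge_right[OF upset_ideal[OF up(1)] upset_ideal[OF up(2)] upset_ideal[OF upset_C] JR A] by blast
qed

text \<open>The exact sequence \<open>0 \<rightarrow> N_k \<rightarrow> K[pskel k] \<rightarrow> K[skel_pskel k] \<rightarrow> 0\<close>, where \<open>N_k\<close> is the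
  \<open>k\<close>-dimensional layer of the dimension filtration.\<close>

lemma layer_sequence:
  shows "upset (nonfaces (pskel k))" "upset (nonfaces (skel_pskel k))"
    "nonfaces (pskel k) \<subseteq> nonfaces (skel_pskel k)"
    "depth_ge m n (mspan (nonfaces (skel_pskel k))) (mspan (nonfaces (pskel k))) \<longleftrightarrow>
      depth_ge m n (mspan (level (Suc k))) (mspan (level k))"
proof -
  show 1: "upset (nonfaces (pskel k))" "upset (nonfaces (skel_pskel k))"
    using upset_nonfaces down_closed_pskel down_closed_skel_pskel by auto
  show 2: "nonfaces (pskel k) \<subseteq> nonfaces (skel_pskel k)"
    by (auto simp: nonfaces_def pskel_def skel_pskel_def)
  have "F \<in> pskel k \<and> F \<notin> skel_pskel k \<longleftrightarrow> F \<in> \<Delta> \<and> dl F = k" for F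
    using dim_le_dl[of F F] by (auto simp: pskel_def skel_pskel_def)
  then have "nonfaces (skel_pskel k) - nonfaces (pskel k) = level (Suc k) - level k"
    unfolding level_diff cells_def nonfaces_def by blast
  then show "depth_ge m n (mspan (nonfaces (skel_pskel k))) (mspan (nonfaces (pskel k))) \<longleftrightarrow>
      depth_ge m n (mspan (level (Suc k))) (mspan (level k))"
    using depth_ge_independent[OF 1(2,1) 2 upset_level upset_level level_mono] by blast
qed

text \<open>From skeleta to layers each k is treated alone, the truncation
  \<open>skel_pskel k\<close> being controlled by \<open>depth_D (Suc k)\<close>. The converse
  therefore descends from k = \<open>top_dim\<close> + 1, where the skeleton is empty.\<close>

lemma depth_D_iff_depth_N: "(\<forall>k. depth_D k) \<longleftrightarrow> (\<forall>k. depth_N k)"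
proof -
  note ideals = upset_ideal[OF layer_sequence(1)] upset_ideal[OF layer_sequence(2)] upset_ideal[OF upset_C]
  have sub: "mspan (nonfaces (pskel k)) \<subseteq> mspan (nonfaces (skel_pskel k))"
    "mspan (nonfaces (skel_pskel k)) \<subseteq> R" for k
    using layer_sequence(3) by (auto simp: semigroup_ring_subset_iff nonfaces_def)
  show ?thesis
  proof
    assume D: "\<forall>k. depth_D k"
    show "\<forall>k. depth_N k"
    proof
      fix k show "depth_N k"
      proof (cases k)
        case (Suc n)
        have "depth_ge m k R (mspan (nonfaces (skel_pskel k)))" using skeleton_depth D by blast
        moreover have "subquotient R (mspan (nonfaces (skel_pskel k)))"
          using ideals(2,3) sub(2) by (auto simp: subquotient_def)
        ultimately have "depth_ge m n R (mspan (nonfaces (skel_pskel k)))"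
          using depth_ge_mono[of R _ k n] Suc by simp
        moreover have "depth_ge m (Suc n) R (mspan (nonfaces (pskel k)))" using D[rule_format, of k] Suc by (simp add: depth_D_def)
        ultimately have "depth_ge m (Suc n) (mspan (nonfaces (skel_pskel k))) (mspan (nonfaces (pskel k)))"
          using depth_ge_left[OF ideals sub(1,2)] by blast
        then show ?thesis unfolding layer_sequence(4) depth_N_def using Suc by simp
      qed (simp add: depth_N_def)
    qed
  next
    assume N: "\<forall>k. depth_N k"
    have "depth_D k" if "k \<le> Suc top_dim" for k
      using that
    proof (induction k rule: inc_induct)
      case base show ?case by (rule depth_D_trivial) simp
    next
      case (step k)
      have "depth_ge m k (mspan (nonfaces (skel_pskel k))) (mspan (nonfaces (pskel k)))"
        using N unfolding layer_sequence(4) depth_N_def by blast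
      then show ?case unfolding depth_D_def
        using depth_ge_middle[OF ideals sub(1,2)] skeleton_depth[OF step(3)] by blast
    qed
    moreover have "depth_D k" if "\<not> k \<le> Suc top_dim" for k using that by (intro depth_D_trivial) simp
    ultimately show "\<forall>k. depth_D k" by blast
  qed
qed

text \<open>Here i = k - 1; the remaining indices, k = 0 and k > \<open>top_dim\<close>, satisfy
  \<open>depth_D\<close> trivially.\<close>

lemma pure_skeletons_CM_iff:
  "(\<forall>i::nat. int i \<le> dim_cplx \<Delta> \<longrightarrow> CM_face_ring TYPE('k) C (pure_skel \<Delta> (int i))) \<longleftrightarrow> (\<forall>k. depth_D k)"
proof
  assume CM: "\<forall>i::nat. int i \<le> dim_cplx \<Delta> \<longrightarrow> CM_face_ring TYPE('k) C (pure_skel \<Delta> (int i))"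
  show "\<forall>k. depth_D k"
  proof
    fix k show "depth_D k"
    proof (cases k)
      case (Suc i)
      then show ?thesis using depth_D_trivial[of k] CM[rule_format, of i] pskel_CM[of i]
        by (cases "k \<le> top_dim") (auto simp: dim_cplx_eq)
    qed (simp add: depth_D_def)
  qed
next
  assume "\<forall>k. depth_D k"
  then show "\<forall>i::nat. int i \<le> dim_cplx \<Delta> \<longrightarrow> CM_face_ring TYPE('k) C (pure_skel \<Delta> (int i))"
    using pskel_CM by (auto simp: dim_cplx_eq)
qed

text \<open>The conditions on a Cohen--Macaulay filtration with its end points left open, so that
  partial filtrations can be extended in \<open>level_chain\<close>.\<close>

definition cm_chain :: "nat \<Rightarrow> (nat \<Rightarrow> ((int^'n) \<Rightarrow>\<^sub>0 'k) set) \<Rightarrow> bool" where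
  "cm_chain r Js \<longleftrightarrow> (\<forall>i\<le>r. is_ideal R (Js i) \<and> homogeneous (Js i)) \<and>
     (\<forall>i<r. Js i \<subseteq> Js (Suc i)) \<and> (\<forall>i<r. CM R m (Js (Suc i)) (Js i)) \<and>
     (\<forall>i j. i < j \<and> j < r \<longrightarrow> mod_dim R (Js (Suc i)) (Js i) < mod_dim R (Js (Suc j)) (Js j))"

lemma seqCM_iff_cm_chain:
  "seqCM_face_ring TYPE('k) C \<Delta> \<longleftrightarrow> (\<exists>r Js. Js 0 = mspan (level 0) \<and> Js r = R \<and> cm_chain r Js)"
  unfolding seqCM_face_ring_def cm_chain_def I_Delta_eq[OF down_closed_\<Delta>] level_0 by (rule refl)

text \<open>A layer is appended only when it is nonzero, as \<open>CM\<close> excludes zero modules.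
  The bound n on all earlier dimensions is what makes the new dimension n strictly larger.\<close>

lemma level_chain:
  assumes N: "\<forall>k. depth_N k"
  shows "\<exists>r Js. Js 0 = mspan (level 0) \<and> Js r = mspan (level n) \<and> cm_chain r Js \<and>
    (\<forall>i<r. mod_dim R (Js (Suc i)) (Js i) < enat n)"
proof (induction n)
  case 0
  show ?case using upset_ideal[OF upset_level] homogeneous_mspan
    by (intro exI[of _ "0::nat"] exI[of _ "\<lambda>_. mspan (level 0)"]) (auto simp: cm_chain_def)
next
  case (Suc n)
  then obtain r Js where J: "Js 0 = mspan (level 0)" "Js r = mspan (level n)" "cm_chain r Js"
    and lt: "\<forall>i<r. mod_dim R (Js (Suc i)) (Js i) < enat n" by blast
  have lt': "mod_dim R (Js (Suc i)) (Js i) < enat (Suc n)" if "i < r" for i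
    using lt that by (meson enat_ord_simps(2) lessI less_trans)
  show ?case
  proof (cases "\<exists>F\<in>\<Delta>. dl F = n")
    case False
    then have "level (Suc n) - level n = {}" unfolding level_diff by (auto simp: cells_def)
    then have "level (Suc n) = level n" using level_mono by blast
    then show ?thesis using J lt' by (intro exI[of _ r] exI[of _ Js]) auto
  next
    case True
    then obtain F where F: "F \<in> \<Delta>" "dl F = n" by blast
    note CM = level_CM[OF F]
    define Js' where "Js' = Js(Suc r := mspan (level (Suc n)))"
    have e: "Js' i = Js i" if "i \<le> r" for i using that by (simp add: Js'_def)
    have e1: "Js' (Suc r) = mspan (level (Suc n))" by (simp add: Js'_def)
    have md: "mod_dim R (Js' (Suc i)) (Js' i) < enat n" if "i < r" for i using lt that by (simp add: e)
    have mr: "mod_dim R (Js' (Suc r)) (Js' r) = enat n" using CM(2) J(2) by (simp add: e e1)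
    have "cm_chain (Suc r) Js'" unfolding cm_chain_def
    proof (intro conjI allI impI)
      fix i assume i: "i \<le> Suc r"
      show "is_ideal R (Js' i)" "homogeneous (Js' i)"
        using i J(3) upset_ideal[OF upset_level] homogeneous_mspan
        by (cases "i = Suc r"; simp add: e e1 cm_chain_def)+
    next
      fix i assume i: "i < Suc r"
      show "Js' i \<subseteq> Js' (Suc i)"
        using i J(2,3) level_mono[of n]
        by (cases "i = r") (simp_all add: e e1 cm_chain_def semigroup_ring_mono)
      show "CM R m (Js' (Suc i)) (Js' i)"
        using i J(2,3) CM(1) N by (cases "i = r") (simp_all add: e e1 cm_chain_def)
    next
      fix i j assume ij: "i < j \<and> j < Suc r"
      show "mod_dim R (Js' (Suc i)) (Js' i) < mod_dim R (Js' (Suc j)) (Js' j)"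
        using ij J(3) md[of i] mr by (cases "j = r") (simp_all add: e cm_chain_def)
    qed
    moreover have "mod_dim R (Js' (Suc i)) (Js' i) < enat (Suc n)" if "i < Suc r" for i
      using that lt'[of i] mr by (cases "i = r") (simp_all add: e)
    ultimately show ?thesis using J(1) e1 by (intro exI[of _ "Suc r"] exI[of _ Js']) (auto simp: e)
  qed
qed

text \<open>Conversely, the layers of any Cohen--Macaulay filtration are those of the dimension filtration:
  a layer containing \<open>x\<^sup>c\<close> has dimension at least \<open>dl (sf c)\<close> because a translate of \<open>K[G]\<close> for a
  facet \<open>G\<close> above \<open>sf c\<close> embeds in this or an earlier layer, and at most that because its depth is
  bounded by the dimension of each nonzero submodule.\<close>

lemma layer_dimension:
  fixes W :: "nat \<Rightarrow> (int^'n) set"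
  assumes W: "\<And>i. i \<le> r \<Longrightarrow> upset (W i)" "\<And>i. i < r \<Longrightarrow> W i \<subseteq> W (Suc i)" "W 0 = nonfaces \<Delta>"
    and CM: "\<And>i. i < r \<Longrightarrow> CM R m (mspan (W (Suc i))) (mspan (W i))"
    and inc: "\<And>i j. i < j \<Longrightarrow> j < r \<Longrightarrow>
      mod_dim R (mspan (W (Suc i))) (mspan (W i)) < mod_dim R (mspan (W (Suc j))) (mspan (W j))"
    and i: "i < r" and c: "c \<in> W (Suc i) - W i"
  shows "sf c \<in> \<Delta> \<and> mod_dim R (mspan (W (Suc i))) (mspan (W i)) = enat (dl (sf c)) \<and>
    depth_ge m (dl (sf c)) (mspan (W (Suc i))) (mspan (W i))"
proof -
  let ?e = "\<lambda>i. mod_dim R (mspan (W (Suc i))) (mspan (W i))"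
  have Wle: "W a \<subseteq> W b" if "a \<le> b" "b \<le> r" for a b
    using that by (induction b rule: dec_induct) (use W(2) in \<open>auto dest: Suc_le_lessD\<close>)
  have up: "upset (W i)" "upset (W (Suc i))" "W i \<subseteq> W (Suc i)" using W i by auto
  have cC: "c \<in> C" using up(2) c by (auto simp: upset_def)
  have in\<Delta>: "sf x \<in> \<Delta>" if "x \<in> C" "x \<notin> W 0" for x using that W(3) by (auto simp: nonfaces_def)
  have W0i: "W 0 \<subseteq> W i" using Wle[of 0 i] i by simp
  have c\<Delta>: "sf c \<in> \<Delta>" using in\<Delta>[OF cC] c W0i by blast
  have lower: "enat (dl (sf c)) \<le> ?e i"
  proof -
    obtain G where G: "G \<in> \<Delta>" "sf c \<subseteq> G" "dim G = dl (sf c)" using dl_attained[OF c\<Delta>] .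
    have GP: "G \<in> faces P" using G(1) \<Delta>_faces by blast
    obtain g0 where g0: "g0 \<in> C" "sf g0 = G" using exists_sf[OF GP] .
    have cG: "c \<in> lat G" using sf_subset_iff[OF cC GP] G(2) by blast
    have g0G: "g0 \<in> lat G" using sf_subset_iff[OF g0(1) GP] g0(2) by blast
    have pf: "prime_face (lat G)" by (rule lat_prime_face[OF GP])
    have latG_add: "x + y \<in> lat G" if "x \<in> lat G" "y \<in> lat G" for x y
      using that faceD(4)[OF GP] by (simp add: lat_def realv_add)
    \<comment> \<open>A translate of \<open>lat G\<close>, pushed by g0 into the relative interior
      of G, so that no monomial of Y is zero in K[\<Delta>].\<close>
    define Y where "Y = {c + g0 + g | g. g \<in> lat G}"
    have YC: "x \<in> C" "x \<in> lat G" if "x \<in> Y" for x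
      using that cG g0G latG_add lat_subset[OF GP] by (auto simp: Y_def)
    have Y0: "x \<notin> W 0" if x: "x \<in> Y" for x
    proof -
      obtain g where g: "x = c + g0 + g" "g \<in> lat G" using x by (auto simp: Y_def)
      have "x = g0 + (c + g)" by (simp add: g(1) algebra_simps)
      moreover have "c + g \<in> C" using latG_add[OF cG g(2)] lat_subset[OF GP] by blast
      ultimately have "G \<subseteq> sf x" using sf_add(1)[OF g0(1)] g0(2) by metis
      moreover have "sf x \<subseteq> G" using sf_subset_iff[OF YC(1)[OF x] GP] YC(2)[OF x] by blast
      ultimately have "sf x \<in> \<Delta>" using G(1) by simp
      then show ?thesis using W(3) by (simp add: nonfaces_def)
    qed
    have YW: "x \<in> W (Suc i)" if x: "x \<in> Y" for x
    proof -
      obtain g where g: "x = c + (g0 + g)" "g \<in> lat G" using x by (auto simp: Y_def add.assoc)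
      have "g0 + g \<in> C" using latG_add[OF g0G g(2)] lat_subset[OF GP] by blast
      then show ?thesis using up(2) c g(1) by (auto simp: upset_def)
    qed
    \<comment> \<open>Let W j be the first ideal meeting Y. Adding \<open>lat G\<close> to a point
      of Y in W j stays in Y and hence outside the previous ideal, so K[lat G] embeds into that
      layer, whose dimension is at most that of layer i.\<close>
    define Q where "Q l \<longleftrightarrow> (\<exists>x\<in>Y. x \<in> W l)" for l
    have "c + g0 + 0 \<in> Y" using pf unfolding Y_def prime_face_def by blast
    then have "Q (Suc i)" unfolding Q_def using YW by blast
    then obtain j where j: "Q j" "\<And>l. Q l \<Longrightarrow> j \<le> l" using ex_has_least_nat[of Q "Suc i" "\<lambda>l. l"] by blast
    have ji: "j \<le> Suc i" using j(2) \<open>Q (Suc i)\<close> by blast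
    have "\<not> Q 0" unfolding Q_def using Y0 by blast
    then obtain l where l: "j = Suc l" using j(1) by (cases j) auto
    have li: "l \<le> i" "l < r" using ji l i by auto
    obtain x where x: "x \<in> Y" "x \<in> W (Suc l)" using j(1) l by (auto simp: Q_def)
    have nQ: "\<not> Q l" using j(2)[of l] l by auto
    have "ann R (mspan (W (Suc l))) (mspan (W l)) \<subseteq> mspan (C - lat G)"
    proof (rule ann_subset_face[OF _ _ x(2)])
      fix h assume h: "h \<in> lat G"
      obtain g where g: "x = c + g0 + g" "g \<in> lat G" using x(1) by (auto simp: Y_def)
      have "x + h \<in> Y" unfolding Y_def using g latG_add[OF g(2) h] by (auto simp: add.assoc)
      then show "x + h \<notin> W l" using nQ unfolding Q_def by blast
    qed (use W(1) li in auto)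
    then have "enat (dim G) \<le> ?e l" using le_mod_dim[OF GP] by blast
    also have "?e l \<le> ?e i" using inc[of l i] li(1) i by (cases "l = i") (auto simp: less_imp_le)
    finally show ?thesis using G(3) by simp
  qed
  have upper: "n \<le> dl (sf c)" if d: "depth_ge m n (mspan (W (Suc i))) (mspan (W i))" for n
  proof -
    \<comment> \<open>The multiples of c that survive in layer i. One with largest support face is
      killed by all monomials outside that face, so the dimension of the face bounds the depth; the
      face lies in \<Delta> above the support of c.\<close>
    define X where "X = {x \<in> W (Suc i) - W i. \<exists>h\<in>C. x = c + h}"
    have XC: "x \<in> C" if "x \<in> X" for x using that up(2) by (auto simp: X_def upset_def)
    have cX: "c \<in> X" unfolding X_def using c C_0 by (auto intro!: bexI[of _ 0])
    have "finite (dim ` sf ` X)" using XC sf_face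
      by (intro finite_imageI finite_subset[OF _ finite_faces]) auto
    then have "Max (dim ` sf ` X) \<in> dim ` sf ` X" using cX by (intro Max_in) auto
    then obtain x where x: "x \<in> X" "dim (sf x) = Max (dim ` sf ` X)" by auto
    have max: "dim (sf y) \<le> dim (sf x)" if "y \<in> X" for y
      unfolding x(2) using \<open>finite (dim ` sf ` X)\<close> that by (intro Max_ge) auto
    obtain h where h: "h \<in> C" "x = c + h" using x(1) by (auto simp: X_def)
    have xP: "sf x \<in> faces P" using sf_face XC x(1) by blast
    have "n \<le> dim (sf x)"
    proof (rule depth_le_dim[OF up(2,1,3) _ xP _ d])
      show "x \<in> W (Suc i) - W i" using x(1) by (simp add: X_def)
      fix k assume k: "k \<in> C - lat (sf x)"
      show "x + k \<in> W i"
      proof (rule ccontr)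
        assume "x + k \<notin> W i"
        moreover have "x + k \<in> W (Suc i)" using up(2) x(1) k by (auto simp: upset_def X_def)
        moreover have "x + k = c + (h + k)" "h + k \<in> C" using h k C_add by (auto simp: add.assoc)
        ultimately have xk: "x + k \<in> X" unfolding X_def by blast
        have "sf x \<subseteq> sf (x + k)" "sf k \<subseteq> sf (x + k)" using sf_add[OF XC[OF x(1)], of k] k by auto
        moreover have "\<not> sf k \<subseteq> sf x" using sf_subset_iff[of k "sf x"] k xP by blast
        ultimately have "sf x \<subset> sf (x + k)" by blast
        then show False using face_psubset_dim[OF sf_face[OF XC[OF xk]] xP] max[OF xk] by simp
      qed
    qed
    moreover have "sf x \<in> \<Delta>" using in\<Delta>[OF XC[OF x(1)]] x(1) W0i by (auto simp: X_def)
    moreover have "sf c \<subseteq> sf x" using sf_add(1)[OF cC h(1)] h(2) by simp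
    ultimately show ?thesis using dim_le_dl[of "sf x" "sf c"] by simp
  qed
  have ps: "W i \<subset> W (Suc i)" using up(3) c by blast
  have eq: "depth R m (mspan (W (Suc i))) (mspan (W i)) = ?e i" using CM[OF i] by (simp add: CM_def)
  have "depth R m (mspan (W (Suc i))) (mspan (W i)) \<le> enat (dl (sf c))" unfolding depth_def
  proof (rule Sup_least, clarify)
    fix xs assume "regular_seq R m (mspan (W (Suc i))) (mspan (W i)) xs"
    then have "depth_ge m (length xs) (mspan (W (Suc i))) (mspan (W i))"
      using depth_ge_iff_regular[OF up(2,1) ps] by blast
    then show "enat (length xs) \<le> enat (dl (sf c))" using upper by simp
  qed
  then have e: "?e i = enat (dl (sf c))" using lower eq by simp
  then have "depth_ge m (dl (sf c)) (mspan (W (Suc i))) (mspan (W i))"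
    using depth_eq_iff[OF up(2,1) ps upper] eq by simp
  then show ?thesis using c\<Delta> e by blast
qed

text \<open>By \<open>layer_dimension\<close> the layer of an exponent c has dimension
  \<open>dl (sf c)\<close>, and strictly increasing dimensions leave one layer per value. So the
  layer of dimension k and the k-th layer of the dimension filtration have the same
  exponents.\<close>

lemma depth_N_if_seqCM:
  assumes J: "Js 0 = mspan (level 0)" "Js r = R" "cm_chain r Js"
  shows "depth_N k"
proof (cases "\<exists>F\<in>\<Delta>. dl F = k")
  case False
  then have "level (Suc k) - level k = {}" unfolding level_diff by (auto simp: cells_def)
  then have "level (Suc k) = level k" using level_mono by blast
  then show ?thesis unfolding depth_N_def using depth_ge_refl[OF upset_ideal[OF upset_level]] by simp
next
  case True
  then obtain F where F: "F \<in> \<Delta>" "dl F = k" by blast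
  have "\<exists>U. upset U \<and> Js i = mspan U" if "i \<le> r" for i
    using homogeneous_ideal_upset[of "Js i"] J(3) that unfolding cm_chain_def by metis
  then obtain W where W: "\<And>i. i \<le> r \<Longrightarrow> upset (W i)" "\<And>i. i \<le> r \<Longrightarrow> Js i = mspan (W i)" by metis
  have msp: "mspan U = mspan V \<longleftrightarrow> U = V" for U V
    by (simp add: set_eq_subset semigroup_ring_subset_iff)
  have W0: "W 0 = nonfaces \<Delta>" using W(2)[of 0] J(1) msp level_0 by simp
  have Wr: "W r = C" using W(2)[of r] J(2) msp by simp
  have Wsub: "W i \<subseteq> W (Suc i)" if "i < r" for i
  proof -
    have "Js i \<subseteq> Js (Suc i)" using J(3) that unfolding cm_chain_def by blast
    then show ?thesis using W(2)[of i] W(2)[of "Suc i"] that by (simp add: semigroup_ring_subset_iff)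
  qed
  have WCM: "CM R m (mspan (W (Suc i))) (mspan (W i))" if "i < r" for i
  proof -
    have "CM R m (Js (Suc i)) (Js i)" using J(3) that unfolding cm_chain_def by blast
    then show ?thesis using W(2)[of i] W(2)[of "Suc i"] that by simp
  qed
  have Winc: "mod_dim R (mspan (W (Suc i))) (mspan (W i)) < mod_dim R (mspan (W (Suc j))) (mspan (W j))"
    if "i < j" "j < r" for i j
  proof -
    have "mod_dim R (Js (Suc i)) (Js i) < mod_dim R (Js (Suc j)) (Js j)"
      using J(3) that unfolding cm_chain_def by blast
    then show ?thesis using W(2)[of i] W(2)[of "Suc i"] W(2)[of j] W(2)[of "Suc j"] that by simp
  qed
  have dim: "sf c \<in> \<Delta> \<and> mod_dim R (mspan (W (Suc i))) (mspan (W i)) = enat (dl (sf c)) \<and>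
    depth_ge m (dl (sf c)) (mspan (W (Suc i))) (mspan (W i))" if "i < r" "c \<in> W (Suc i) - W i" for i c
    by (rule layer_dimension[OF W(1) Wsub W0 WCM Winc that])
  have layer: "\<exists>i<r. c \<in> W (Suc i) - W i" if "c \<in> C" "sf c \<in> \<Delta>" for c
  proof -
    have "c \<notin> W 0" using W0 that by (simp add: nonfaces_def)
    moreover have "c \<in> W r" using Wr that by simp
    ultimately show ?thesis
    proof (induction r)
      case (Suc n) then show ?case by (cases "c \<in> W n") (auto intro: less_SucI)
    qed simp
  qed
  obtain c where c: "c \<in> C" "sf c = F" using exists_sf F(1) \<Delta>_faces by blast
  obtain i where i: "i < r" "c \<in> W (Suc i) - W i" using layer[OF c(1)] c(2) F(1) by blast
  have ei: "mod_dim R (mspan (W (Suc i))) (mspan (W i)) = enat k" using dim[OF i] c(2) F(2) by simp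
  have WW: "upset (W (Suc i))" "upset (W i)" "W i \<subseteq> W (Suc i)" using W(1) Wsub i(1) by auto
  have "W (Suc i) - W i = level (Suc k) - level k"
  proof
    show "W (Suc i) - W i \<subseteq> level (Suc k) - level k"
    proof
      fix x assume x: "x \<in> W (Suc i) - W i"
      have "x \<in> C" using x W(1)[of "Suc i"] i(1) by (auto simp: upset_def)
      then show "x \<in> level (Suc k) - level k" using dim[OF i(1) x] ei by (simp add: level_diff cells_def)
    qed
    show "level (Suc k) - level k \<subseteq> W (Suc i) - W i"
    proof
      fix x assume "x \<in> level (Suc k) - level k"
      then have x: "x \<in> C" "sf x \<in> \<Delta>" "dl (sf x) = k" by (auto simp: level_diff cells_def)
      then obtain j where j: "j < r" "x \<in> W (Suc j) - W j" using layer by blast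
      have "mod_dim R (mspan (W (Suc j))) (mspan (W j)) = enat k" using dim[OF j] x(3) by simp
      then have "j = i" using Winc[of i j] Winc[of j i] i(1) j(1) ei by (cases i j rule: linorder_cases) auto
      then show "x \<in> W (Suc i) - W i" using j(2) by simp
    qed
  qed
  then have "depth_ge m k (mspan (W (Suc i))) (mspan (W i)) \<longleftrightarrow> depth_N k" unfolding depth_N_def
    by (rule depth_ge_independent[OF WW upset_level upset_level level_mono])
  then show ?thesis using dim[OF i] c(2) F(2) by simp
qed

theorem seqCM_iff: "seqCM_face_ring TYPE('k) C \<Delta> \<longleftrightarrow> (\<forall>k. depth_N k)"
proof
  assume "seqCM_face_ring TYPE('k) C \<Delta>"
  then show "\<forall>k. depth_N k" unfolding seqCM_iff_cm_chain using depth_N_if_seqCM by blast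
next
  assume "\<forall>k. depth_N k"
  then show "seqCM_face_ring TYPE('k) C \<Delta>" unfolding seqCM_iff_cm_chain
    using level_chain[of "Suc top_dim"] level_top by auto
qed

end

theorem theorem4p4:
  fixes C :: "(int^'n) set" and \<Delta> :: "(real^'n) set set"
  assumes "affine_semigroup C"
    and "generates_lattice C"
    and "pointed C"
    and "normal_sg C"
    and "order_ideal (cone_of C) \<Delta>"
  shows "seqCM_face_ring TYPE('k::field) C \<Delta> \<longleftrightarrow>
           (\<forall>i::nat. int i \<le> dim_cplx \<Delta> \<longrightarrow>
              CM_face_ring TYPE('k) C (pure_skel \<Delta> (int i)))"
proof -
  interpret face_complex C "TYPE('k)" \<Delta>
    by unfold_locales (use assms in auto)
  show ?thesis unfolding seqCM_iff pure_skeletons_CM_iff depth_D_iff_depth_N by (rule refl)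
qed

end
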